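(* Let $D$ be a planar lattice diagram. Then $D$ is a slim rectangular diagram if and only if (up to similarity) $D$ can be obtained from a grid by a finite (possibly empty) sequence of resections.
   Context: All lattices are finite. A planar diagram is a planar Hasse diagram of a finite lattice; notions for lattices are applied to diagrams. Its boundary is the union of its left and right boundary chains. $\prec$ denotes covering and $C_n$ the $n$-element chain. A sublattice of $D$ is cover-preserving if its coverings are coverings of $D$. A lattice $L$ is slim if it is finite and the set $\mathrm{Ji}\,L$ of its join-irreducible elements contains no three-element antichain; slim lattices are planar. A slim semimodular diagram is a planar diagram of a slim semimodular lattice. Two planar diagrams are similar if there is a bijection between them that preserves the left-right order of the upper covers and of the lower covers of each element; diagrams are considered only up to similarity. A grid is a planar diagram of the form $C_m\times C_n$ with $m,n\ge 2$. A weak corner of a planar semimodular diagram $D$ is an element $x$ on the boundary of $D$ such that $x$ is doubly irreducible (both join- and meet-irreducible) and $x$ is incomparable to some $y\in D$; it is a left (right) weak corner if it is on the left (right) boundary chain. A planar semimodular diagram is rectangular if it has exactly one left weak corner and exactly one right weak corner, and these two elements are complementary. A slim rectangular diagram is a slim semimodular diagram that is rectangular. $C_3$-trajectories. Let $D$ be a slim semimodular diagram. Two cover-preserving $C_3$-chains $a_0\prec a_1\prec a_2$ and $b_0\prec b_1\prec b_2$ of $D$ are consecutive if they are opposite sides of a cover-preserving $C_3\times C_2$ in $D$. A class of the reflexive transitive closure of this relation is a $C_3$-trajectory; it is a sequence of chains, listed from left to right, and it does not branch out. For a cover-preserving $C_3$-chain $A$, the chains of the trajectory through $A$ that are to the left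 of $A$, including $A$, form the left wing of $A$; those to the right of $A$, including $A$, form the right wing of $A$. $C_3$-schemes. Let $B$ be a cover-preserving sublattice $C_3\times C_3$ of $D$. Let $W_l$ be the left wing of the upper left boundary of $B$ (the three-element chain from the left corner of $B$ to its top) and let $W_r$ be the right wing of the upper right boundary of $B$. If both wings terminate on the boundary of $D$ (the last $C_3$-chain of $W_l$ and the last $C_3$-chain of $W_r$ are on the boundary of $D$), then the set $S$ of elements of $B\cup W_l\cup W_r$ is a $C_3$-scheme of $D$, and the middle element of $B$ is its anchor. The interior elements of $S$ are the anchor and the middle elements of the $C_3$-chains belonging to $W_l$ and $W_r$ (including the middle elements of the last chains). Resection. Given a $C_3$-scheme $S$ of a slim semimodular diagram $D$, the resection at its anchor produces the diagram obtained from $D$ by deleting all interior elements of $S$ except its anchor (with the inherited order and drawing). *)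

theory Defs
  imports "HOL-Analysis.Analysis" "HOL-Algebra.Lattice"
begin

section \<open>Planar lattice diagrams\<close>

text \<open>
  A diagram is an ordered set together with the positions of its elements in the plane
  (abscissa, ordinate); a covering is drawn as the straight segment between its end points.
\<close>

record 'a diagram = "'a gorder" +
  pos :: "'a \<Rightarrow> real \<times> real"

definition covers :: "('a, 'b) diagram_scheme \<Rightarrow> 'a \<Rightarrow> 'a \<Rightarrow> bool" where
  "covers D x y \<longleftrightarrow> x \<in> carrier D \<and> y \<in> carrier D \<and> x \<sqsubseteq>\<^bsub>D\<^esub> y \<and> x \<noteq> y \<and>
     (\<forall>z\<in>carrier D. x \<sqsubseteq>\<^bsub>D\<^esub> z \<and> z \<sqsubseteq>\<^bsub>D\<^esub> y \<longrightarrow> z = x \<or> z = y)"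

definition incomparable :: "('a, 'b) diagram_scheme \<Rightarrow> 'a \<Rightarrow> 'a \<Rightarrow> bool" where
  "incomparable D x y \<longleftrightarrow> \<not> x \<sqsubseteq>\<^bsub>D\<^esub> y \<and> \<not> y \<sqsubseteq>\<^bsub>D\<^esub> x"

definition edge :: "('a, 'b) diagram_scheme \<Rightarrow> 'a \<Rightarrow> 'a \<Rightarrow> (real \<times> real) set" where
  "edge D a b = closed_segment (pos D a) (pos D b)"

text \<open>
  Edges go upwards and meet only in common end points; since every element of a lattice with at
  least two elements lies on an edge, it follows that no edge passes through a third element.
\<close>

definition planar_diagram :: "('a, 'b) diagram_scheme \<Rightarrow> bool" where
  "planar_diagram D \<longleftrightarrow>
     lattice D \<and> finite (carrier D) \<and> carrier D \<noteq> {} \<and> inj_on (pos D) (carrier D) \<and>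
     (\<forall>a b. covers D a b \<longrightarrow> snd (pos D a) < snd (pos D b)) \<and>
     (\<forall>a b c d. covers D a b \<and> covers D c d \<and> (a, b) \<noteq> (c, d) \<longrightarrow>
        edge D a b \<inter> edge D c d \<subseteq> pos D ` ({a, b} \<inter> {c, d}))"

text \<open>
  Horizontal displacement, per unit of height, of the edge between \<open>x\<close> and \<open>y\<close> when it is
  traversed starting at \<open>x\<close>. Two upper covers (or two lower covers) of \<open>x\<close> are
  ordered from left to right by this number.
\<close>

definition drift :: "('a, 'b) diagram_scheme \<Rightarrow> 'a \<Rightarrow> 'a \<Rightarrow> real" where
  "drift D x y =
     (fst (pos D y) - fst (pos D x)) / \<bar>snd (pos D y) - snd (pos D x)\<bar>"

definition left_upper :: "('a, 'b) diagram_scheme \<Rightarrow> 'a \<Rightarrow> 'a \<Rightarrow> 'a \<Rightarrow> bool" where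
  "left_upper D x b c \<longleftrightarrow> covers D x b \<and> covers D x c \<and> drift D x b < drift D x c"

definition left_lower :: "('a, 'b) diagram_scheme \<Rightarrow> 'a \<Rightarrow> 'a \<Rightarrow> 'a \<Rightarrow> bool" where
  "left_lower D x b c \<longleftrightarrow> covers D b x \<and> covers D c x \<and> drift D x b < drift D x c"

definition similar :: "('a, 'c) diagram_scheme \<Rightarrow> ('b, 'd) diagram_scheme \<Rightarrow> bool" where
  "similar D E \<longleftrightarrow> (\<exists>\<phi>. bij_betw \<phi> (carrier D) (carrier E) \<and>
     (\<forall>x\<in>carrier D. \<forall>y\<in>carrier D. x \<sqsubseteq>\<^bsub>D\<^esub> y \<longleftrightarrow> \<phi> x \<sqsubseteq>\<^bsub>E\<^esub> \<phi> y) \<and>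
     (\<forall>x\<in>carrier D. \<forall>b\<in>carrier D. \<forall>c\<in>carrier D.
        (left_upper D x b c \<longleftrightarrow> left_upper E (\<phi> x) (\<phi> b) (\<phi> c)) \<and>
        (left_lower D x b c \<longleftrightarrow> left_lower E (\<phi> x) (\<phi> b) (\<phi> c))))"

text \<open>
  For incomparable elements the diagrams branch at their meet: \<open>x\<close> is to the left of
  \<open>y\<close> if the branch leading to \<open>x\<close> is to the left of the branch leading to \<open>y\<close>.
\<close>

definition left_of :: "('a, 'b) diagram_scheme \<Rightarrow> 'a \<Rightarrow> 'a \<Rightarrow> bool" where
  "left_of D x y \<longleftrightarrow> x \<in> carrier D \<and> y \<in> carrier D \<and> incomparable D x y \<and>
     (\<exists>b c. left_upper D (x \<sqinter>\<^bsub>D\<^esub> y) b c \<and> b \<sqsubseteq>\<^bsub>D\<^esub> x \<and> c \<sqsubseteq>\<^bsub>D\<^esub> y)"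

text \<open>
  The elements of the left (right) boundary chain are those having no point of the drawing at
  the same height strictly to their left (right).
\<close>

definition drawing :: "('a, 'b) diagram_scheme \<Rightarrow> (real \<times> real) set" where
  "drawing D = pos D ` carrier D \<union> (\<Union>(a, b)\<in>{(a, b). covers D a b}. edge D a b)"

definition left_boundary :: "('a, 'b) diagram_scheme \<Rightarrow> 'a set" where
  "left_boundary D = {x \<in> carrier D.
     \<forall>p\<in>drawing D. snd p = snd (pos D x) \<longrightarrow> fst (pos D x) \<le> fst p}"

definition right_boundary :: "('a, 'b) diagram_scheme \<Rightarrow> 'a set" where
  "right_boundary D = {x \<in> carrier D.
     \<forall>p\<in>drawing D. snd p = snd (pos D x) \<longrightarrow> fst p \<le> fst (pos D x)}"

definition boundary :: "('a, 'b) diagram_scheme \<Rightarrow> 'a set" where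
  "boundary D = left_boundary D \<union> right_boundary D"


section \<open>Slim rectangular diagrams\<close>

definition join_irreducible :: "('a, 'b) diagram_scheme \<Rightarrow> 'a \<Rightarrow> bool" where
  "join_irreducible D x \<longleftrightarrow> x \<in> carrier D \<and> \<not> least D x (carrier D) \<and>
     (\<forall>a\<in>carrier D. \<forall>b\<in>carrier D. x = a \<squnion>\<^bsub>D\<^esub> b \<longrightarrow> x = a \<or> x = b)"

definition meet_irreducible :: "('a, 'b) diagram_scheme \<Rightarrow> 'a \<Rightarrow> bool" where
  "meet_irreducible D x \<longleftrightarrow> x \<in> carrier D \<and> \<not> greatest D x (carrier D) \<and>
     (\<forall>a\<in>carrier D. \<forall>b\<in>carrier D. x = a \<sqinter>\<^bsub>D\<^esub> b \<longrightarrow> x = a \<or> x = b)"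

definition slim :: "('a, 'b) diagram_scheme \<Rightarrow> bool" where
  "slim D \<longleftrightarrow> \<not> (\<exists>x y z. join_irreducible D x \<and> join_irreducible D y \<and> join_irreducible D z \<and>
     incomparable D x y \<and> incomparable D x z \<and> incomparable D y z)"

definition semimodular :: "('a, 'b) diagram_scheme \<Rightarrow> bool" where
  "semimodular D \<longleftrightarrow> (\<forall>a b. \<forall>c\<in>carrier D. covers D a b \<longrightarrow>
     a \<squnion>\<^bsub>D\<^esub> c = b \<squnion>\<^bsub>D\<^esub> c \<or> covers D (a \<squnion>\<^bsub>D\<^esub> c) (b \<squnion>\<^bsub>D\<^esub> c))"

definition slim_semimodular_diagram :: "('a, 'b) diagram_scheme \<Rightarrow> bool" where
  "slim_semimodular_diagram D \<longleftrightarrow> planar_diagram D \<and> slim D \<and> semimodular D"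

definition weak_corner :: "('a, 'b) diagram_scheme \<Rightarrow> 'a \<Rightarrow> bool" where
  "weak_corner D x \<longleftrightarrow> x \<in> boundary D \<and> join_irreducible D x \<and> meet_irreducible D x \<and>
     (\<exists>y\<in>carrier D. incomparable D x y)"

definition complementary :: "('a, 'b) diagram_scheme \<Rightarrow> 'a \<Rightarrow> 'a \<Rightarrow> bool" where
  "complementary D x y \<longleftrightarrow>
     least D (x \<sqinter>\<^bsub>D\<^esub> y) (carrier D) \<and> greatest D (x \<squnion>\<^bsub>D\<^esub> y) (carrier D)"

definition rectangular :: "('a, 'b) diagram_scheme \<Rightarrow> bool" where
  "rectangular D \<longleftrightarrow> (\<exists>u v.
     {x \<in> left_boundary D. weak_corner D x} = {u} \<and>
     {x \<in> right_boundary D. weak_corner D x} = {v} \<and>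
     complementary D u v)"

definition slim_rectangular_diagram :: "('a, 'b) diagram_scheme \<Rightarrow> bool" where
  "slim_rectangular_diagram D \<longleftrightarrow> slim_semimodular_diagram D \<and> rectangular D"

definition grid :: "(nat \<times> nat) diagram \<Rightarrow> bool" where
  "grid G \<longleftrightarrow> planar_diagram G \<and> (\<exists>m\<ge>2. \<exists>n\<ge>2.
     carrier G = {..<m} \<times> {..<n} \<and>
     (\<forall>x\<in>carrier G. \<forall>y\<in>carrier G. x \<sqsubseteq>\<^bsub>G\<^esub> y \<longleftrightarrow> fst x \<le> fst y \<and> snd x \<le> snd y))"


section \<open>Resections\<close>

text \<open>
  \<open>f\<close> is an isomorphism of \<open>C\<^sub>m \<times> C\<^sub>n\<close> (with the chains
  \<open>0 < \<dots> < m - 1\<close> and \<open>0 < \<dots> < n - 1\<close>) onto a cover-preserving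
  sublattice of \<open>D\<close>.
\<close>

definition cover_preserving_grid ::
    "('a, 'b) diagram_scheme \<Rightarrow> nat \<Rightarrow> nat \<Rightarrow> (nat \<Rightarrow> nat \<Rightarrow> 'a) \<Rightarrow> bool" where
  "cover_preserving_grid D m n f \<longleftrightarrow>
     (\<forall>i<m. \<forall>j<n. f i j \<in> carrier D) \<and>
     inj_on (\<lambda>(i, j). f i j) ({..<m} \<times> {..<n}) \<and>
     (\<forall>i<m. \<forall>j<n. \<forall>k<m. \<forall>l<n.
        f i j \<squnion>\<^bsub>D\<^esub> f k l = f (max i k) (max j l) \<and>
        f i j \<sqinter>\<^bsub>D\<^esub> f k l = f (min i k) (min j l)) \<and>
     (\<forall>i j. Suc i < m \<and> j < n \<longrightarrow> covers D (f i j) (f (Suc i) j)) \<and>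
     (\<forall>i j. i < m \<and> Suc j < n \<longrightarrow> covers D (f i j) (f i (Suc j)))"

text \<open>A three-element chain is represented by the triple of its elements in increasing order.\<close>

type_synonym 'a chain3 = "'a \<times> 'a \<times> 'a"

definition consecutive :: "('a, 'b) diagram_scheme \<Rightarrow> 'a chain3 \<Rightarrow> 'a chain3 \<Rightarrow> bool" where
  "consecutive D A B \<longleftrightarrow> (\<exists>f. cover_preserving_grid D 3 2 f \<and>
     {A, B} = {(f 0 0, f 1 0, f 2 0), (f 0 1, f 1 1, f 2 1)})"

definition C3_trajectory :: "('a, 'b) diagram_scheme \<Rightarrow> 'a chain3 \<Rightarrow> 'a chain3 set" where
  "C3_trajectory D A = {B. (consecutive D)\<^sup>*\<^sup>* A B}"

text \<open>
  Let \<open>B\<close> and \<open>A\<close> be opposite sides of a cover-preserving \<open>C\<^sub>3 \<times> C\<^sub>2\<close>.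
  Its least element is \<open>a0\<close> or \<open>b0\<close>, and which side is on the left is read off from the two
  edges of \<open>C\<^sub>3 \<times> C\<^sub>2\<close> starting there.
\<close>

fun next_left :: "('a, 'b) diagram_scheme \<Rightarrow> 'a chain3 \<Rightarrow> 'a chain3 \<Rightarrow> bool" where
  "next_left D (a0, a1, a2) (b0, b1, b2) \<longleftrightarrow>
     consecutive D (a0, a1, a2) (b0, b1, b2) \<and>
     (left_upper D a0 b0 a1 \<or> left_upper D b0 b1 a0)"

definition next_right :: "('a, 'b) diagram_scheme \<Rightarrow> 'a chain3 \<Rightarrow> 'a chain3 \<Rightarrow> bool" where
  "next_right D A B \<longleftrightarrow> next_left D B A"

definition left_wing :: "('a, 'b) diagram_scheme \<Rightarrow> 'a chain3 \<Rightarrow> 'a chain3 set" where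
  "left_wing D A = {B \<in> C3_trajectory D A. (next_left D)\<^sup>*\<^sup>* A B}"

definition right_wing :: "('a, 'b) diagram_scheme \<Rightarrow> 'a chain3 \<Rightarrow> 'a chain3 set" where
  "right_wing D A = {B \<in> C3_trajectory D A. (next_right D)\<^sup>*\<^sup>* A B}"

definition chain3_set :: "'a chain3 \<Rightarrow> 'a set" where
  "chain3_set = (\<lambda>(a0, a1, a2). {a0, a1, a2})"

definition middle :: "'a chain3 \<Rightarrow> 'a" where
  "middle = (\<lambda>(a0, a1, a2). a1)"

text \<open>
  \<open>f\<close> describes a cover-preserving sublattice \<open>C\<^sub>3 \<times> C\<^sub>3\<close> whose left corner is
  \<open>f 2 0\<close> and whose right corner is \<open>f 0 2\<close>.
\<close>

definition oriented_C3_square :: "('a, 'b) diagram_scheme \<Rightarrow> (nat \<Rightarrow> nat \<Rightarrow> 'a) \<Rightarrow> bool" where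
  "oriented_C3_square D f \<longleftrightarrow>
     cover_preserving_grid D 3 3 f \<and> left_upper D (f 0 0) (f 1 0) (f 0 1)"

definition scheme_left_wing ::
    "('a, 'b) diagram_scheme \<Rightarrow> (nat \<Rightarrow> nat \<Rightarrow> 'a) \<Rightarrow> 'a chain3 set" where
  "scheme_left_wing D f = left_wing D (f 2 0, f 2 1, f 2 2)"

definition scheme_right_wing ::
    "('a, 'b) diagram_scheme \<Rightarrow> (nat \<Rightarrow> nat \<Rightarrow> 'a) \<Rightarrow> 'a chain3 set" where
  "scheme_right_wing D f = right_wing D (f 0 2, f 1 2, f 2 2)"

text \<open>The square described by \<open>f\<close> determines a \<open>C\<^sub>3\<close>-scheme, with anchor \<open>f 1 1\<close>.\<close>

definition C3_scheme :: "('a, 'b) diagram_scheme \<Rightarrow> (nat \<Rightarrow> nat \<Rightarrow> 'a) \<Rightarrow> bool" where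
  "C3_scheme D f \<longleftrightarrow> oriented_C3_square D f \<and>
     (\<exists>Z\<in>scheme_left_wing D f. (\<nexists>Y. next_left D Z Y) \<and> chain3_set Z \<subseteq> boundary D) \<and>
     (\<exists>Z\<in>scheme_right_wing D f. (\<nexists>Y. next_right D Z Y) \<and> chain3_set Z \<subseteq> boundary D)"

definition scheme_interior ::
    "('a, 'b) diagram_scheme \<Rightarrow> (nat \<Rightarrow> nat \<Rightarrow> 'a) \<Rightarrow> 'a set" where
  "scheme_interior D f =
     {f 1 1} \<union> middle ` scheme_left_wing D f \<union> middle ` scheme_right_wing D f"

text \<open>
  \<open>D'\<close> is a drawing of what remains of \<open>D\<close>. An edge of \<open>D'\<close> may replace a path of
  \<open>D\<close> through deleted elements, and then the old positions need not be suitable for a planar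
  drawing with straight edges. Hence the positions may be changed, but every two incomparable
  elements retain their left-right order.
\<close>

definition resection :: "('a, 'b) diagram_scheme \<Rightarrow> ('a, 'b) diagram_scheme \<Rightarrow> bool" where
  "resection D D' \<longleftrightarrow> slim_semimodular_diagram D \<and> planar_diagram D' \<and>
     (\<exists>f. C3_scheme D f \<and>
        carrier D' = carrier D - (scheme_interior D f - {f 1 1}) \<and>
        (\<forall>x\<in>carrier D'. \<forall>y\<in>carrier D'. x \<sqsubseteq>\<^bsub>D'\<^esub> y \<longleftrightarrow> x \<sqsubseteq>\<^bsub>D\<^esub> y) \<and>
        (\<forall>x\<in>carrier D'. \<forall>y\<in>carrier D'. left_of D' x y \<longleftrightarrow> left_of D x y))"

end

theory Submission
  imports Defs
begin

text \<open>
  In a planar diagram, maximal chains are graphs of continuous functions of the height, and two of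
  them can cross only at a common element. Hence the left-right order of two incomparable elements can
  be read off from any maximal chain through one of them, and it is compatible with the order.

  Counting the elements of the left and of the right boundary chain that lie below an element gives
  coordinates in which the order of a slim semimodular diagram is componentwise. Let \<open>P\<close> consist of the
  coordinates of the meet-irreducible elements and of the top. By semimodularity the points of \<open>P\<close> have
  distinct abscissas and distinct ordinates. The elements of the diagram correspond to the quadrants
  \<open>{z \<in> P. p \<le> z}\<close>, and a covering deletes the leftmost or the lowest point of a quadrant. Conversely,
  drawing an element with coordinates \<open>(a, b)\<close> at \<open>(b - a, a + b)\<close> is planar.

  The diagram is rectangular iff, for the lowest point \<open>u\<close> and the leftmost point \<open>v\<close>, the points to the
  right of \<open>u\<close> and those above \<open>v\<close> form increasing sequences having only the top in common. It is a
  grid iff, moreover, no point lies to the left of \<open>u\<close> and below \<open>v\<close>. A resection replaces two points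
  \<open>a2\<close> and \<open>b2\<close> of \<open>P\<close> by the coordinates \<open>(fst a2, snd b2)\<close> of the anchor, a point to the left of
  \<open>u\<close> and below \<open>v\<close>; it can be undone at the leftmost such point. This terminates, as is
  seen from any weight of the points that decreases towards the lower right.
\<close>

section \<open>Maximal chains as curves\<close>

text \<open>A resection may be redrawn and diagrams count only up to similarity, so the argument
  must not depend on positions. What matters is the order and \<open>left_of\<close>;
  \<open>represents\<close> records these two relations and recovers both from the points.

  A covering is labelled by the point that it deletes. Opposite sides of a covering square have the
  same label, so all chains of a trajectory share their two labels. A wing thus becomes the set of
  all chains with these labels beyond some fixed abscissa or ordinate, and the elements deleted by a
  resection become those on certain lines.

  The obstacle in undoing a resection is termination. Of the two restored points, \<open>b2\<close>
  may again lie to the left of \<open>u\<close> and below \<open>v\<close>, so the number of such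
  points need not drop. But \<open>b2\<close> can take over the weight of an old point to the lower
  right of the replaced one, which is smaller. The leftmost point is the one to replace because then
  the other restored point, \<open>a2\<close>, lands above \<open>v\<close>.\<close>

locale planar =
  fixes D :: "('a, 'b) diagram_scheme" (structure)
  assumes planar: "planar_diagram D"
begin

sublocale lattice D
  using planar by (simp add: planar_diagram_def)

abbreviation "X x \<equiv> fst (pos D x)"
abbreviation "H x \<equiv> snd (pos D x)"

lemma fin [simp]: "finite (carrier D)"
  using planar by (simp add: planar_diagram_def)

lemma nonempty: "carrier D \<noteq> {}"
  using planar by (simp add: planar_diagram_def)

lemma pos_inj: "x \<in> carrier D \<Longrightarrow> y \<in> carrier D \<Longrightarrow> pos D x = pos D y \<Longrightarrow> x = y"
  using planar by (auto simp: planar_diagram_def inj_on_def)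

lemma covers_height: "covers D a b \<Longrightarrow> H a < H b"
  using planar by (auto simp: planar_diagram_def)

lemma edges_meet:
  assumes "covers D a b" "covers D c d" "(a, b) \<noteq> (c, d)" "p \<in> edge D a b" "p \<in> edge D c d"
  shows "\<exists>z \<in> {a, b} \<inter> {c, d}. p = pos D z"
proof -
  have "edge D a b \<inter> edge D c d \<subseteq> pos D ` ({a, b} \<inter> {c, d})"
    using planar assms(1-3) unfolding planar_diagram_def by blast
  then show ?thesis
    using assms(4,5) by blast
qed

lemma coversD:
  assumes "covers D a b"
  shows "a \<in> carrier D" "b \<in> carrier D" "a \<sqsubseteq> b" "a \<noteq> b"
  using assms by (auto simp: covers_def)

lemma covers_between: "covers D a b \<Longrightarrow> z \<in> carrier D \<Longrightarrow> a \<sqsubseteq> z \<Longrightarrow> z \<sqsubseteq> b \<Longrightarrow> z = a \<or> z = b"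
  by (auto simp: covers_def)

section \<open>Extremal elements, covers and heights in a finite lattice\<close>

lemma order_rel:
  assumes "A \<subseteq> carrier D"
  shows "asymp_on A (\<lambda>x y. x \<sqsubseteq> y \<and> x \<noteq> y)" "transp_on A (\<lambda>x y. x \<sqsubseteq> y \<and> x \<noteq> y)"
proof -
  show "asymp_on A (\<lambda>x y. x \<sqsubseteq> y \<and> x \<noteq> y)"
    using assms le_antisym by (intro asymp_onI) blast
  show "transp_on A (\<lambda>x y. x \<sqsubseteq> y \<and> x \<noteq> y)"
  proof (intro transp_onI conjI)
    fix x y z assume m: "x \<in> A" "y \<in> A" "z \<in> A" and h: "x \<sqsubseteq> y \<and> x \<noteq> y" "y \<sqsubseteq> z \<and> y \<noteq> z"
    then have c: "x \<in> carrier D" "y \<in> carrier D" "z \<in> carrier D" using assms by auto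
    show "x \<sqsubseteq> z" using h c le_trans[of x y z] by blast
    show "x \<noteq> z" using h c le_antisym[of x y] by blast
  qed
qed

lemma ex_minimal:
  assumes "A \<subseteq> carrier D" "A \<noteq> {}"
  shows "\<exists>m\<in>A. \<forall>z\<in>A. z \<sqsubseteq> m \<longrightarrow> z = m"
  using Finite_Set.bex_min_element[OF finite_subset[OF assms(1) fin] order_rel[OF assms(1)] assms(2)] by blast

lemma ex_maximal:
  assumes "A \<subseteq> carrier D" "A \<noteq> {}"
  shows "\<exists>m\<in>A. \<forall>z\<in>A. m \<sqsubseteq> z \<longrightarrow> z = m"
  using Finite_Set.bex_max_element[OF finite_subset[OF assms(1) fin] order_rel[OF assms(1)] assms(2)] by blast

lemma ex_bottom: "\<exists>z\<in>carrier D. \<forall>x\<in>carrier D. z \<sqsubseteq> x"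
proof -
  obtain m where m: "m \<in> carrier D" "\<And>z. z \<in> carrier D \<Longrightarrow> z \<sqsubseteq> m \<Longrightarrow> z = m"
    using ex_minimal[OF subset_refl nonempty] by blast
  have "m \<sqsubseteq> x" if "x \<in> carrier D" for x
    using m(2)[of "m \<sqinter> x"] meet_left[of m x] meet_right[of m x] m(1) that by simp
  with m(1) show ?thesis by blast
qed

lemma ex_top: "\<exists>z\<in>carrier D. \<forall>x\<in>carrier D. x \<sqsubseteq> z"
proof -
  obtain m where m: "m \<in> carrier D" "\<And>z. z \<in> carrier D \<Longrightarrow> m \<sqsubseteq> z \<Longrightarrow> z = m"
    using ex_maximal[OF subset_refl nonempty] by blast
  have "x \<sqsubseteq> m" if "x \<in> carrier D" for x
    using m(2)[of "m \<squnion> x"] join_left[of m x] join_right[of m x] m(1) that by simp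
  with m(1) show ?thesis by blast
qed

lemma ex_upper_cover:
  assumes "x \<in> carrier D" "y \<in> carrier D" "x \<sqsubseteq> y" "x \<noteq> y"
  shows "\<exists>z. covers D x z \<and> z \<sqsubseteq> y"
proof -
  obtain z where z: "z \<in> carrier D" "x \<sqsubseteq> z" "z \<noteq> x" "z \<sqsubseteq> y"
    and min: "\<And>w. w \<in> carrier D \<Longrightarrow> x \<sqsubseteq> w \<Longrightarrow> w \<noteq> x \<Longrightarrow> w \<sqsubseteq> y \<Longrightarrow> w \<sqsubseteq> z \<Longrightarrow> w = z"
    using ex_minimal[of "{z \<in> carrier D. x \<sqsubseteq> z \<and> z \<noteq> x \<and> z \<sqsubseteq> y}"] assms by auto
  have "covers D x z"
    unfolding covers_def using z min assms(1,2) le_trans by metis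
  with z(4) show ?thesis by blast
qed

lemma height_strict:
  assumes "x \<in> carrier D" "y \<in> carrier D" "x \<sqsubseteq> y" "x \<noteq> y"
  shows "H x < H y"
proof (rule ccontr)
  assume "\<not> H x < H y"
  then have "{x \<in> carrier D. x \<sqsubseteq> y \<and> x \<noteq> y \<and> \<not> H x < H y} \<noteq> {}"
    using assms by blast
  then obtain x' where x: "x' \<in> carrier D" "x' \<sqsubseteq> y" "x' \<noteq> y" "\<not> H x' < H y"
    and max: "\<And>z. z \<in> carrier D \<Longrightarrow> z \<sqsubseteq> y \<Longrightarrow> z \<noteq> y \<Longrightarrow> \<not> H z < H y \<Longrightarrow> x' \<sqsubseteq> z \<Longrightarrow> z = x'"
    using ex_maximal[of "{x \<in> carrier D. x \<sqsubseteq> y \<and> x \<noteq> y \<and> \<not> H x < H y}"] by auto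
  obtain z where "covers D x' z" "z \<sqsubseteq> y"
    using ex_upper_cover x assms(2) by blast
  then show False
    using covers_height[of x' z] max[of z] coversD[of x' z] x by (smt (verit))
qed

lemma height_mono: "x \<in> carrier D \<Longrightarrow> y \<in> carrier D \<Longrightarrow> x \<sqsubseteq> y \<Longrightarrow> H x \<le> H y"
  using height_strict[of x y] by fastforce

text \<open>Maximality is tested on single elements. In this form membership is proved by comparing
  one element with \<open>C\<close>, and an element outside \<open>C\<close> comes with an
  incomparable member of \<open>C\<close>.\<close>

definition mchain :: "'a set \<Rightarrow> bool" where
  "mchain C \<longleftrightarrow> C \<subseteq> carrier D \<and> (\<forall>a\<in>C. \<forall>b\<in>C. a \<sqsubseteq> b \<or> b \<sqsubseteq> a) \<and>
     (\<forall>z\<in>carrier D. (\<forall>c\<in>C. z \<sqsubseteq> c \<or> c \<sqsubseteq> z) \<longrightarrow> z \<in> C)"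

lemma mchainD:
  assumes "mchain C"
  shows "\<And>a. a \<in> C \<Longrightarrow> a \<in> carrier D"
    and "\<And>a b. a \<in> C \<Longrightarrow> b \<in> C \<Longrightarrow> a \<sqsubseteq> b \<or> b \<sqsubseteq> a"
    and "\<And>z. z \<in> carrier D \<Longrightarrow> (\<And>c. c \<in> C \<Longrightarrow> z \<sqsubseteq> c \<or> c \<sqsubseteq> z) \<Longrightarrow> z \<in> C"
  using assms unfolding mchain_def by blast+

lemma mchain_less:
  assumes "mchain C" "a \<in> C" "b \<in> C" "H a < H b"
  shows "a \<sqsubseteq> b" "a \<noteq> b"
  using mchainD[OF assms(1)] assms(2-4) height_mono[of b a] by force+

lemma mchain_eq:
  assumes "mchain C" "a \<in> C" "b \<in> C" "H a = H b"
  shows "a = b"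
  using mchainD[OF assms(1)] assms(2-4) height_strict[of b a] height_strict[of a b] by fastforce

lemma ex_mchain:
  assumes "K \<subseteq> carrier D" "\<And>a b. a \<in> K \<Longrightarrow> b \<in> K \<Longrightarrow> a \<sqsubseteq> b \<or> b \<sqsubseteq> a"
  shows "\<exists>C. mchain C \<and> K \<subseteq> C"
proof -
  define F where "F = {C. C \<subseteq> carrier D \<and> (\<forall>a\<in>C. \<forall>b\<in>C. a \<sqsubseteq> b \<or> b \<sqsubseteq> a)}"
  have "finite F" unfolding F_def by (rule finite_subset[of _ "Pow (carrier D)"]) auto
  moreover have "K \<in> F" using assms by (simp add: F_def)
  ultimately obtain C where C: "C \<in> F" "K \<subseteq> C" "\<forall>B\<in>F. C \<subseteq> B \<longrightarrow> C = B"
    using finite_has_maximal2[of F K] by blast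
  have "z \<in> C" if "z \<in> carrier D" "\<forall>c\<in>C. z \<sqsubseteq> c \<or> c \<sqsubseteq> z" for z
  proof -
    have "insert z C \<in> F" using C(1) that by (auto simp: F_def)
    with C(3) show ?thesis by blast
  qed
  with C(1,2) show ?thesis unfolding mchain_def F_def by blast
qed

section \<open>The polygonal curve of a maximal chain\<close>

definition curve :: "'a set \<Rightarrow> (real \<times> real) set" where
  "curve C = pos D ` C \<union> (\<Union>(a, b)\<in>{(a, b). a \<in> C \<and> b \<in> C \<and> covers D a b}. edge D a b)"

lemma edge_iff:
  assumes "H a < H b"
  shows "p \<in> edge D a b \<longleftrightarrow>
    H a \<le> snd p \<and> snd p \<le> H b \<and> fst p = X a + (X b - X a) / (H b - H a) * (snd p - H a)"
proof
  assume "p \<in> edge D a b"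
  then obtain u where u: "0 \<le> u" "u \<le> 1" "p = (1 - u) *\<^sub>R pos D a + u *\<^sub>R pos D b"
    unfolding edge_def closed_segment_def by blast
  have "fst p = (1 - u) * X a + u * X b" "snd p = (1 - u) * H a + u * H b"
    using u(3) by simp_all
  then have s: "snd p - H a = u * (H b - H a)" and f: "fst p = X a + u * (X b - X a)"
    by (simp_all add: algebra_simps)
  have "0 \<le> u * (H b - H a)" "u * (H b - H a) \<le> H b - H a"
    using u assms by (auto intro: mult_left_le_one_le)
  then have "H a \<le> snd p" "snd p \<le> H b"
    using s by argo+
  then show "H a \<le> snd p \<and> snd p \<le> H b \<and> fst p = X a + (X b - X a) / (H b - H a) * (snd p - H a)"
    using s f assms by auto
next
  assume p: "H a \<le> snd p \<and> snd p \<le> H b \<and> fst p = X a + (X b - X a) / (H b - H a) * (snd p - H a)"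
  define u where "u = (snd p - H a) / (H b - H a)"
  have "0 \<le> u" "u \<le> 1" using p assms by (auto simp: u_def divide_simps)
  moreover have "u * (H b - H a) = snd p - H a" using assms by (simp add: u_def)
  then have "snd p = (1 - u) * H a + u * H b" by (simp add: algebra_simps)
  moreover have "fst p = X a + (X b - X a) * u" using p by (simp add: u_def)
  then have "fst p = (1 - u) * X a + u * X b" by (simp add: algebra_simps)
  ultimately have "0 \<le> u" "u \<le> 1" "p = (1 - u) *\<^sub>R pos D a + u *\<^sub>R pos D b"
    by (simp_all add: prod_eq_iff)
  then show "p \<in> edge D a b"
    unfolding edge_def closed_segment_def by blast
qed

lemma edge_ends: "pos D a \<in> edge D a b" "pos D b \<in> edge D a b"
  by (auto simp: edge_def)

text \<open>An edge of the chain passing the height of \<open>c\<close> has \<open>c\<close> as an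
  end point: otherwise \<open>c\<close> would lie strictly between its ends in height, hence in the
  order, against the covering.\<close>

lemma curve_at_vertex:
  assumes C: "mchain C" "c \<in> C" and p: "p \<in> curve C" "snd p = H c"
  shows "p = pos D c"
  using p(1) unfolding curve_def
proof
  assume "p \<in> pos D ` C"
  then show ?thesis using mchain_eq[OF C(1), of _ c] C(2) p(2) by auto
next
  assume "p \<in> (\<Union>(a, b)\<in>{(a, b). a \<in> C \<and> b \<in> C \<and> covers D a b}. edge D a b)"
  then obtain a b where ab: "a \<in> C" "b \<in> C" "covers D a b" "p \<in> edge D a b" by auto
  have h: "H a < H b" using ab(3) by (rule covers_height)
  have e: "H a \<le> H c" "H c \<le> H b" "fst p = X a + (X b - X a) / (H b - H a) * (H c - H a)"
    using edge_iff[OF h, of p] ab(4) p(2) by auto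
  have "c = a \<or> c = b"
  proof (cases "H c = H a \<or> H c = H b")
    case True then show ?thesis using mchain_eq[OF C(1)] C(2) ab by blast
  next
    case False
    then have "a \<sqsubseteq> c" "c \<sqsubseteq> b" using mchain_less[OF C(1)] e(1,2) ab C(2) by auto
    then show ?thesis using covers_between[OF ab(3)] mchainD(1)[OF C] by blast
  qed
  then show ?thesis using e(3) p(2) h by (auto simp: prod_eq_iff)
qed

text \<open>Between two successive heights of the chain only one edge is available: of two different
  edges, one would have an end point of the other strictly between its ends.\<close>

lemma curve_unique:
  assumes C: "mchain C" and p: "p \<in> curve C" "q \<in> curve C" "snd p = snd q"
  shows "p = q"
proof (cases "\<exists>c\<in>C. H c = snd p")
  case True
  then obtain c where "c \<in> C" "H c = snd p" by blast
  then show ?thesis using curve_at_vertex[OF C] p by metis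
next
  case False
  have edge: "\<exists>a\<in>C. \<exists>b\<in>C. covers D a b \<and> r \<in> edge D a b \<and> H a < snd p \<and> snd p < H b"
    if r: "r \<in> curve C" "snd r = snd p" for r
  proof -
    have "r \<notin> pos D ` C" using False r(2) by auto
    then obtain a b where ab: "a \<in> C" "b \<in> C" "covers D a b" "r \<in> edge D a b"
      using r(1) unfolding curve_def by auto
    then have "H a \<le> snd p" "snd p \<le> H b"
      using edge_iff[OF covers_height[OF ab(3)], of r] r(2) by auto
    then show ?thesis using ab False by (metis order_le_less)
  qed
  obtain a b where ab: "a \<in> C" "b \<in> C" "covers D a b" "p \<in> edge D a b" "H a < snd p" "snd p < H b"
    using edge[OF p(1)] by blast
  obtain c d where cd: "c \<in> C" "d \<in> C" "covers D c d" "q \<in> edge D c d" "H c < snd p" "snd p < H d"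
    using edge[OF p(2)] p(3) by metis
  have "a = c"
  proof (rule ccontr)
    assume "a \<noteq> c"
    then have "H a < H c \<or> H c < H a" using mchain_eq[OF C] ab cd by force
    then show False
    proof
      assume "H a < H c"
      then have "a \<sqsubseteq> c" "c \<sqsubseteq> b" "c \<noteq> a" "c \<noteq> b"
        using mchain_less[OF C, of a c] mchain_less[OF C, of c b] ab cd by auto
      then show False using covers_between[OF ab(3)] mchainD(1)[OF C cd(1)] by blast
    next
      assume "H c < H a"
      then have "c \<sqsubseteq> a" "a \<sqsubseteq> d" "a \<noteq> c" "a \<noteq> d"
        using mchain_less[OF C, of c a] mchain_less[OF C, of a d] ab cd by auto
      then show False using covers_between[OF cd(3)] mchainD(1)[OF C ab(1)] by blast
    qed
  qed
  moreover have "b = d"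
  proof (rule ccontr)
    assume "b \<noteq> d"
    then have "H b < H d \<or> H d < H b" using mchain_eq[OF C] ab cd by force
    then show False
    proof
      assume "H b < H d"
      then have "c \<sqsubseteq> b" "b \<sqsubseteq> d" "b \<noteq> c" "b \<noteq> d"
        using mchain_less[OF C, of b d] mchain_less[OF C, of c b] ab cd by auto
      then show False using covers_between[OF cd(3)] mchainD(1)[OF C ab(2)] by blast
    next
      assume "H d < H b"
      then have "a \<sqsubseteq> d" "d \<sqsubseteq> b" "d \<noteq> a" "d \<noteq> b"
        using mchain_less[OF C, of d b] mchain_less[OF C, of a d] ab cd by auto
      then show False using covers_between[OF ab(3)] mchainD(1)[OF C cd(2)] by blast
    qed
  qed
  ultimately show ?thesis
    using edge_iff[OF covers_height[OF ab(3)], of p] edge_iff[OF covers_height[OF ab(3)], of q]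
      ab(4) cd(4) p(3) by (simp add: prod_eq_iff)
qed

definition lo :: real where "lo = Min (H ` carrier D)"
definition hi :: real where "hi = Max (H ` carrier D)"

lemma height_bounds: "x \<in> carrier D \<Longrightarrow> lo \<le> H x" "x \<in> carrier D \<Longrightarrow> H x \<le> hi"
  unfolding lo_def hi_def by auto

lemma mchain_ends:
  assumes C: "mchain C"
  shows "\<exists>c\<in>C. H c = lo" "\<exists>c\<in>C. H c = hi"
proof -
  obtain z where z: "z \<in> carrier D" "\<And>x. x \<in> carrier D \<Longrightarrow> z \<sqsubseteq> x" using ex_bottom by blast
  have "lo \<in> H ` carrier D" unfolding lo_def using nonempty by (intro Min_in) auto
  then obtain x where "x \<in> carrier D" "lo = H x" by blast
  then have "H z = lo" using height_bounds(1)[OF z(1)] height_mono[OF z(1) \<open>x \<in> carrier D\<close> z(2)] \<open>x \<in> carrier D\<close> by simp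
  moreover have "z \<in> C"
    by (rule mchainD(3)[OF C z(1)]) (simp add: z(2) mchainD(1)[OF C])
  ultimately show "\<exists>c\<in>C. H c = lo" by blast
next
  obtain z where z: "z \<in> carrier D" "\<And>x. x \<in> carrier D \<Longrightarrow> x \<sqsubseteq> z" using ex_top by blast
  have "hi \<in> H ` carrier D" unfolding hi_def using nonempty by (intro Max_in) auto
  then obtain x where "x \<in> carrier D" "hi = H x" by blast
  then have "H z = hi" using height_bounds(2)[OF z(1)] height_mono[OF \<open>x \<in> carrier D\<close> z(1) z(2)] \<open>x \<in> carrier D\<close> by simp
  moreover have "z \<in> C"
    by (rule mchainD(3)[OF C z(1)]) (simp add: z(2) mchainD(1)[OF C])
  ultimately show "\<exists>c\<in>C. H c = hi" by blast
qed

text \<open>Maximality enters here: the last element below the height \<open>h\<close> and the first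
  one above it form a covering, so the curve has no gap.\<close>

lemma curve_exists:
  assumes C: "mchain C" and h: "lo \<le> h" "h \<le> hi"
  shows "\<exists>x. (x, h) \<in> curve C"
proof (cases "\<exists>c\<in>C. H c = h")
  case True
  then obtain c where "c \<in> C" "H c = h" by blast
  then have "(X c, h) \<in> curve C" by (auto simp: curve_def intro!: image_eqI)
  then show ?thesis ..
next
  case False
  have finC: "finite C" using mchainD(1)[OF C] by (meson fin finite_subset subsetI)
  have ne: "{c\<in>C. H c < h} \<noteq> {}" "{c\<in>C. h < H c} \<noteq> {}"
    using mchain_ends[OF C] h False by force+
  obtain a where a: "a \<in> C" "H a < h" "\<And>c. c \<in> C \<Longrightarrow> H c < h \<Longrightarrow> H c \<le> H a"
  proof -
    have "Max (H ` {c\<in>C. H c < h}) \<in> H ` {c\<in>C. H c < h}"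
      using ne finC by (intro Max_in) auto
    then obtain a where "a \<in> C" "H a < h" "Max (H ` {c\<in>C. H c < h}) = H a" by auto
    moreover have "H c \<le> Max (H ` {c\<in>C. H c < h})" if "c \<in> C" "H c < h" for c
      using that finC by (intro Max_ge) auto
    ultimately show ?thesis using that by metis
  qed
  obtain b where b: "b \<in> C" "h < H b" "\<And>c. c \<in> C \<Longrightarrow> h < H c \<Longrightarrow> H b \<le> H c"
  proof -
    have "Min (H ` {c\<in>C. h < H c}) \<in> H ` {c\<in>C. h < H c}"
      using ne finC by (intro Min_in) auto
    then obtain a where "a \<in> C" "h < H a" "Min (H ` {c\<in>C. h < H c}) = H a" by auto
    moreover have "Min (H ` {c\<in>C. h < H c}) \<le> H c" if "c \<in> C" "h < H c" for c
      using that finC by (intro Min_le) auto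
    ultimately show ?thesis using that by metis
  qed
  have ab: "a \<in> carrier D" "b \<in> carrier D" "a \<sqsubseteq> b" "a \<noteq> b"
    using mchainD(1)[OF C] mchain_less[OF C a(1) b(1)] a b by auto
  have low: "c \<sqsubseteq> a \<or> b \<sqsubseteq> c" if "c \<in> C" for c
  proof -
    have "H c \<le> H a \<or> H b \<le> H c" using a(3)[OF that] b(3)[OF that] False that by force
    then show ?thesis
      using mchain_less[OF C that a(1)] mchain_eq[OF C that a(1)]
        mchain_less[OF C b(1) that] mchain_eq[OF C that b(1)] ab by force
  qed
  have cov: "covers D a b"
    unfolding covers_def
  proof (intro conjI ballI impI)
    fix z assume z: "z \<in> carrier D" "a \<sqsubseteq> z \<and> z \<sqsubseteq> b"
    have "z \<in> C"
    proof (rule mchainD(3)[OF C z(1)])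
      fix c assume c: "c \<in> C"
      then show "z \<sqsubseteq> c \<or> c \<sqsubseteq> z"
        using low[OF c] z mchainD(1)[OF C c] ab le_trans by blast
    qed
    then show "z = a \<or> z = b"
      using low[of z] z ab le_antisym by blast
  qed (use ab in auto)
  define x where "x = X a + (X b - X a) / (H b - H a) * (h - H a)"
  have "(x, h) \<in> edge D a b"
    using edge_iff[OF covers_height[OF cov], of "(x, h)"] a b by (simp add: x_def)
  then have "(x, h) \<in> curve C"
    unfolding curve_def using a(1) b(1) cov by blast
  then show ?thesis ..
qed

section \<open>The curve as a continuous function of the height\<close>

definition abscissa :: "'a set \<Rightarrow> real \<Rightarrow> real" where
  "abscissa C h = (THE x. (x, h) \<in> curve C)"

lemma abscissa_iff:
  assumes "mchain C" "lo \<le> h" "h \<le> hi"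
  shows "(x, h) \<in> curve C \<longleftrightarrow> x = abscissa C h"
proof -
  have "\<exists>!x. (x, h) \<in> curve C"
    using curve_exists[OF assms] curve_unique[OF assms(1)] by fastforce
  then show ?thesis unfolding abscissa_def by (metis (mono_tags, lifting) theI')
qed

lemma abscissa_vertex:
  assumes "mchain C" "c \<in> C"
  shows "abscissa C (H c) = X c"
proof -
  have "(X c, H c) \<in> curve C" using assms(2) by (auto simp: curve_def)
  then show ?thesis
    using abscissa_iff[OF assms(1), of "H c"] height_bounds mchainD(1)[OF assms] by metis
qed

lemma curve_heights:
  assumes "mchain C" "p \<in> curve C"
  shows "lo \<le> snd p" "snd p \<le> hi"
proof -
  have "lo \<le> snd p \<and> snd p \<le> hi"
    using assms(2) unfolding curve_def
  proof
    assume "p \<in> pos D ` C"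
    then show ?thesis using height_bounds mchainD(1)[OF assms(1)] by auto
  next
    assume "p \<in> (\<Union>(a, b)\<in>{(a, b). a \<in> C \<and> b \<in> C \<and> covers D a b}. edge D a b)"
    then obtain a b where ab: "covers D a b" "p \<in> edge D a b" by auto
    then show ?thesis
      using edge_iff[OF covers_height[OF ab(1)], of p] height_bounds coversD(1,2)[OF ab(1)]
      by force
  qed
  then show "lo \<le> snd p" "snd p \<le> hi" by auto
qed

lemma vertex_on_curve:
  assumes C: "mchain C" and x: "x \<in> carrier D" "pos D x \<in> curve C"
  shows "x \<in> C"
proof -
  have "pos D x \<in> pos D ` C \<or> (\<exists>a b. a \<in> C \<and> b \<in> C \<and> covers D a b \<and> pos D x \<in> edge D a b)"
    using x(2) unfolding curve_def by auto
  then show ?thesis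
  proof
    assume "pos D x \<in> pos D ` C"
    then show ?thesis using pos_inj[OF x(1)] mchainD(1)[OF C] by blast
  next
    assume "\<exists>a b. a \<in> C \<and> b \<in> C \<and> covers D a b \<and> pos D x \<in> edge D a b"
    then obtain a b where ab: "a \<in> C" "b \<in> C" "covers D a b" "pos D x \<in> edge D a b" by blast
    show ?thesis
    proof (cases "x = a \<or> x = b")
      case True then show ?thesis using ab by blast
    next
      case False
      \<comment> \<open>Some edge ends at \<open>x\<close>, as the lattice has another element.\<close>
      obtain c d where cd: "covers D c d" "x \<in> {c, d}"
      proof -
        obtain t where t: "t \<in> carrier D" "\<And>y. y \<in> carrier D \<Longrightarrow> y \<sqsubseteq> t" using ex_top by blast
        show ?thesis
        proof (cases "x = t")
          case True
          define A where "A = {y \<in> carrier D. y \<noteq> x}"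
          have "A \<subseteq> carrier D" "A \<noteq> {}" using False coversD[OF ab(3)] by (auto simp: A_def)
          then obtain m where m: "m \<in> A" "\<And>z. z \<in> A \<Longrightarrow> m \<sqsubseteq> z \<Longrightarrow> z = m"
            using ex_maximal by meson
          then have "covers D m x"
            unfolding covers_def using t(2) True x(1) by (auto simp: A_def)
          then show ?thesis using that by blast
        next
          case False
          then show ?thesis using ex_upper_cover[OF x(1) t(1) t(2)[OF x(1)]] that by blast
        qed
      qed
      have "(a, b) \<noteq> (c, d)" using cd(2) False by auto
      moreover have "pos D x \<in> edge D c d" using cd(2) edge_ends by auto
      ultimately obtain z where "z \<in> {a, b}" "pos D x = pos D z"
        using edges_meet[OF ab(3) cd(1) _ ab(4)] by blast
      then show ?thesis using pos_inj[OF x(1)] mchainD(1)[OF C] ab(1,2) by blast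
    qed
  qed
qed

lemma not_on_curve:
  assumes C: "mchain C" and x: "x \<in> carrier D" "x \<notin> C"
  shows "abscissa C (H x) \<noteq> X x"
  using abscissa_iff[OF C, of "H x" "X x"] vertex_on_curve[OF C x(1)] height_bounds[OF x(1)] x(2) by auto

lemma curve_compact: "mchain C \<Longrightarrow> compact (curve C)"
proof -
  assume C: "mchain C"
  have finC: "finite C" using mchainD(1)[OF C] by (meson fin finite_subset subsetI)
  have "finite {(a, b). a \<in> C \<and> b \<in> C \<and> covers D a b}"
    by (rule finite_subset[of _ "C \<times> C"]) (use finC in auto)
  then show ?thesis
    unfolding curve_def using finC
    by (intro compact_Un[OF finite_imp_compact compact_UN] finite_imageI) (simp_all add: edge_def split_beta)
qed

text \<open>A function into a compact set is continuous if its graph is closed. Here the graph is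
  the compact curve with its coordinates exchanged, so the pieces of the polygonal line need not be
  glued.\<close>

lemma abscissa_continuous:
  assumes C: "mchain C"
  shows "continuous_on {lo..hi} (abscissa C)"
proof (rule continuous_from_closed_graph)
  show "compact (fst ` curve C)"
    by (rule compact_continuous_image[OF continuous_on_fst[OF continuous_on_id] curve_compact[OF C]])
  show "abscissa C \<in> {lo..hi} \<rightarrow> fst ` curve C"
  proof
    fix h assume "h \<in> {lo..hi}"
    then have "(abscissa C h, h) \<in> curve C" using abscissa_iff[OF C] by auto
    then show "abscissa C h \<in> fst ` curve C" by force
  qed
  have "(\<lambda>x. Pair x (abscissa C x)) ` {lo..hi} = prod.swap ` curve C"
  proof (intro equalityI subsetI)
    fix p assume "p \<in> (\<lambda>x. Pair x (abscissa C x)) ` {lo..hi}"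
    then obtain h where "p = (h, abscissa C h)" "h \<in> {lo..hi}" by auto
    then show "p \<in> prod.swap ` curve C" using abscissa_iff[OF C, of h] by force
  next
    fix p assume "p \<in> prod.swap ` curve C"
    then obtain x h where "p = (h, x)" "(x, h) \<in> curve C" by auto
    then show "p \<in> (\<lambda>x. Pair x (abscissa C x)) ` {lo..hi}"
      using abscissa_iff[OF C, of h] curve_heights[OF C, of "(x, h)"] by auto
  qed
  moreover have "compact (prod.swap ` curve C)"
    by (rule compact_continuous_image[OF _ curve_compact[OF C]])
      (auto simp: prod.swap_def intro!: continuous_intros)
  ultimately show "closed ((\<lambda>x. Pair x (abscissa C x)) ` {lo..hi})"
    by (simp add: compact_imp_closed)
qed

text \<open>By the intermediate value theorem the curves meet between the two heights. By planarity
  a meeting point is an element of both chains unless it lies on a common edge, and then the lower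
  end of that edge serves.\<close>

lemma crossing:
  assumes C: "mchain C" "mchain C'" and h: "lo \<le> h1" "h1 \<le> h2" "h2 \<le> hi"
    and l: "abscissa C h1 < abscissa C' h1" and r: "abscissa C' h2 < abscissa C h2"
  shows "\<exists>z\<in>C \<inter> C'. h1 < H z \<and> H z < h2"
proof -
  have "continuous_on {h1..h2} (\<lambda>h. abscissa C h - abscissa C' h)"
    using abscissa_continuous[OF C(1)] abscissa_continuous[OF C(2)] h
    by (intro continuous_on_diff; elim continuous_on_subset; auto)
  then obtain h where hh: "h1 \<le> h" "h \<le> h2" "abscissa C h = abscissa C' h"
    using IVT'[of "\<lambda>h. abscissa C h - abscissa C' h" h1 0 h2] l r h(2) by force
  have ne: "h \<noteq> h1" "h \<noteq> h2" using hh(3) l r by auto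
  define p where "p = (abscissa C h, h)"
  have p: "p \<in> curve C" "p \<in> curve C'"
    unfolding p_def using abscissa_iff[OF C(1), of h] abscissa_iff[OF C(2), of h] hh h by auto
  have fin: "z \<in> C \<and> z \<in> C' \<Longrightarrow> p = pos D z \<Longrightarrow> ?thesis" for z
    using ne hh by (intro bexI[of _ z]) (auto simp: p_def prod_eq_iff)
  have "p \<in> pos D ` C \<or> p \<in> pos D ` C' \<or>
    (\<exists>a b. a \<in> C \<and> b \<in> C \<and> covers D a b \<and> p \<in> edge D a b) \<and>
    (\<exists>a b. a \<in> C' \<and> b \<in> C' \<and> covers D a b \<and> p \<in> edge D a b)"
    using p unfolding curve_def by auto
  then consider "p \<in> pos D ` C" | "p \<in> pos D ` C'"
    | a b c d where "a \<in> C" "b \<in> C" "covers D a b" "p \<in> edge D a b"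
      "c \<in> C'" "d \<in> C'" "covers D c d" "p \<in> edge D c d"
    by auto
  then show ?thesis
  proof cases
    case 1
    then show ?thesis using vertex_on_curve[OF C(2)] p(2) mchainD(1)[OF C(1)] fin by blast
  next
    case 2
    then show ?thesis using vertex_on_curve[OF C(1)] p(1) mchainD(1)[OF C(2)] fin by blast
  next
    case 3
    show ?thesis
    proof (cases "(a, b) = (c, d)")
      case False
      then obtain z where "z \<in> {a, b} \<inter> {c, d}" "p = pos D z"
        using edges_meet[OF 3(3,7) _ 3(4,8)] by blast
      then show ?thesis using fin 3 by blast
    next
      case True
      have hab: "H a < H b" using 3 covers_height by blast
      have ph: "H a \<le> h" "h \<le> H b" using edge_iff[OF hab, of p] 3(4) by (auto simp: p_def)
      \<comment> \<open>If the common edge reached down to \<open>h1\<close>, the two curves would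
        agree there.\<close>
      have "\<not> H a \<le> h1"
      proof
        assume a1: "H a \<le> h1"
        define x where "x = X a + (X b - X a) / (H b - H a) * (h1 - H a)"
        have "(x, h1) \<in> edge D a b"
          using edge_iff[OF hab, of "(x, h1)"] a1 ph hh by (simp add: x_def)
        then have "(x, h1) \<in> curve C" "(x, h1) \<in> curve C'"
          unfolding curve_def using 3 True by blast+
        then show False using abscissa_iff[OF C(1), of h1] abscissa_iff[OF C(2), of h1] h l by auto
      qed
      moreover have "H a \<noteq> h2"
        using abscissa_vertex[OF C(1), of a] abscissa_vertex[OF C(2), of a] 3 True r by auto
      ultimately have "h1 < H a" "H a < h2" using ph hh by auto
      moreover have "a \<in> C \<inter> C'" using 3 True by auto
      ultimately show ?thesis by blast
    qed
  qed
qed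

end

section \<open>The left-right order of a planar diagram\<close>

context planar
begin

section \<open>The side of a maximal chain on which an element lies\<close>

lemma not_in_mchain:
  assumes "mchain C" "y \<in> C" "incomparable D x y"
  shows "x \<notin> C"
  using mchainD(2)[OF assms(1) assms(2), of x] assms(3) by (auto simp: incomparable_def)

lemma incomparable_sym: "incomparable D x y \<longleftrightarrow> incomparable D y x"
  by (auto simp: incomparable_def)

lemma no_common_vertex_between:
  assumes C: "mchain C" "mchain C'" and x: "x \<in> C" and y: "y \<in> C'" and inc: "incomparable D x y"
    and z: "z \<in> C \<inter> C'" "H x < H z \<and> H z < H y \<or> H y < H z \<and> H z < H x"
  shows False
proof -
  have c: "x \<in> carrier D" "y \<in> carrier D" "z \<in> carrier D" using mchainD(1) C x y z by auto
  from z(2) show False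
  proof
    assume "H x < H z \<and> H z < H y"
    then have "x \<sqsubseteq> z" "z \<sqsubseteq> y" using mchain_less[OF C(1) x] mchain_less[OF C(2) _ y] z(1) by auto
    then show False using inc le_trans[of x z y] c by (auto simp: incomparable_def)
  next
    assume "H y < H z \<and> H z < H x"
    then have "y \<sqsubseteq> z" "z \<sqsubseteq> x" using mchain_less[OF C(2) y] mchain_less[OF C(1) _ x] z(1) by auto
    then show False using inc le_trans[of y z x] c by (auto simp: incomparable_def)
  qed
qed

text \<open>If the two tests disagreed, the curves would change sides between the heights of
  \<open>x\<close> and \<open>y\<close>; the common element at which they cross would make
  \<open>x\<close> and \<open>y\<close> comparable.\<close>

lemma side_of_chain_swap:
  assumes C: "mchain C" "mchain C'" and x: "x \<in> C" and y: "y \<in> C'" and inc: "incomparable D x y"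
  shows "X x < abscissa C' (H x) \<longleftrightarrow> abscissa C (H y) < X y"
proof (rule ccontr)
  assume n: "\<not> ?thesis"
  have inc': "incomparable D y x" using inc incomparable_sym by blast
  have xy: "x \<in> carrier D" "y \<in> carrier D" using mchainD(1) C x y by auto
  have hb: "lo \<le> H x" "H x \<le> hi" "lo \<le> H y" "H y \<le> hi" using height_bounds xy by auto
  have "abscissa C' (H x) \<noteq> X x" "abscissa C (H y) \<noteq> X y"
    using not_on_curve[OF C(2) xy(1) not_in_mchain[OF C(2) y inc]]
      not_on_curve[OF C(1) xy(2) not_in_mchain[OF C(1) x inc']] .
  then consider "abscissa C (H x) < abscissa C' (H x)" "abscissa C' (H y) < abscissa C (H y)"
    | "abscissa C' (H x) < abscissa C (H x)" "abscissa C (H y) < abscissa C' (H y)"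
    using n abscissa_vertex[OF C(1) x] abscissa_vertex[OF C(2) y] by fastforce
  then have "\<exists>z\<in>C \<inter> C'. H x < H z \<and> H z < H y \<or> H y < H z \<and> H z < H x"
  proof cases
    case 1
    then show ?thesis
      using crossing[OF C hb(1) _ hb(4)] crossing[OF C(2,1) hb(3) _ hb(2)] by (cases "H x \<le> H y") auto
  next
    case 2
    then show ?thesis
      using crossing[OF C(2,1) hb(1) _ hb(4)] crossing[OF C hb(3) _ hb(2)] by (cases "H x \<le> H y") auto
  qed
  then show False using no_common_vertex_between[OF assms] by blast
qed

text \<open>The geometric form of \<open>left_of\<close>. The test uses some chain through
  \<open>y\<close>; every other chain through \<open>y\<close>, and every chain through
  \<open>x\<close>, will give the same answer.\<close>

definition west :: "'a \<Rightarrow> 'a \<Rightarrow> bool" where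
  "west x y \<longleftrightarrow> x \<in> carrier D \<and> y \<in> carrier D \<and> incomparable D x y \<and>
     (\<exists>C. mchain C \<and> y \<in> C \<and> X x < abscissa C (H x))"

lemma ex_mchain1: "x \<in> carrier D \<Longrightarrow> \<exists>C. mchain C \<and> x \<in> C"
  using ex_mchain[of "{x}"] by auto

lemma ex_mchain2: "x \<in> carrier D \<Longrightarrow> y \<in> carrier D \<Longrightarrow> x \<sqsubseteq> y \<Longrightarrow> \<exists>C. mchain C \<and> x \<in> C \<and> y \<in> C"
  using ex_mchain[of "{x, y}"] by auto

lemma westD: "west x y \<Longrightarrow> x \<in> carrier D" "west x y \<Longrightarrow> y \<in> carrier D"
  "west x y \<Longrightarrow> \<not> x \<sqsubseteq> y" "west x y \<Longrightarrow> \<not> y \<sqsubseteq> x"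
  by (auto simp: west_def incomparable_def)

text \<open>A chain through \<open>x\<close> mediates: by \<open>side_of_chain_swap\<close> all
  chains through \<open>y\<close> agree with it.\<close>

lemma west_right_chain:
  assumes "x \<in> carrier D" "y \<in> carrier D" "incomparable D x y" "mchain C" "y \<in> C"
  shows "west x y \<longleftrightarrow> X x < abscissa C (H x)"
proof -
  obtain K where K: "mchain K" "x \<in> K" using ex_mchain1 assms(1) by blast
  show ?thesis
    using side_of_chain_swap[OF K(1) _ K(2) _ assms(3)] assms unfolding west_def by metis
qed

lemma west_left_chain:
  assumes "x \<in> carrier D" "y \<in> carrier D" "incomparable D x y" "mchain C" "x \<in> C"
  shows "west x y \<longleftrightarrow> abscissa C (H y) < X y"
proof -
  obtain K where K: "mchain K" "y \<in> K" using ex_mchain1 assms(2) by blast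
  show ?thesis
    using side_of_chain_swap[OF assms(4) K(1) assms(5) K(2) assms(3)] west_right_chain[OF assms(1-3) K]
    by simp
qed

lemma west_total:
  assumes "x \<in> carrier D" "y \<in> carrier D" "incomparable D x y"
  shows "west x y \<longleftrightarrow> \<not> west y x"
proof -
  obtain K where K: "mchain K" "x \<in> K" using ex_mchain1 assms(1) by blast
  have i: "incomparable D y x" using assms(3) incomparable_sym by blast
  have "abscissa K (H y) \<noteq> X y"
    using not_on_curve[OF K(1) assms(2) not_in_mchain[OF K i]] .
  then show ?thesis
    using west_left_chain[OF assms K] west_right_chain[OF assms(2,1) i K] by auto
qed

lemma west_asym: "west x y \<Longrightarrow> \<not> west y x"
  using west_total westD unfolding west_def by blast

text \<open>A chain through both \<open>y\<close> and \<open>z\<close> decides both comparisons, and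
  by the same inequality at the height of \<open>x\<close>. The three variants below work
  alike.\<close>

lemma west_mono_right:
  assumes "west x y" "z \<in> carrier D" "y \<sqsubseteq> z" "\<not> x \<sqsubseteq> z"
  shows "west x z"
proof -
  note w = westD[OF assms(1)]
  have inc: "incomparable D x z"
    using assms(4) w le_trans[OF assms(3)] assms(2) by (auto simp: incomparable_def)
  obtain C where C: "mchain C" "y \<in> C" "z \<in> C" using ex_mchain2 w(2) assms(2,3) by blast
  have "X x < abscissa C (H x)"
    using west_right_chain[OF w(1,2) _ C(1,2)] assms(1) w by (simp add: incomparable_def)
  then show ?thesis using west_right_chain[OF w(1) assms(2) inc C(1,3)] by simp
qed

lemma west_antimono_right:
  assumes "west x y" "z \<in> carrier D" "z \<sqsubseteq> y" "\<not> z \<sqsubseteq> x"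
  shows "west x z"
proof -
  note w = westD[OF assms(1)]
  have inc: "incomparable D x z"
    using assms(4) w le_trans[OF _ assms(3)] assms(2) by (auto simp: incomparable_def)
  obtain C where C: "mchain C" "z \<in> C" "y \<in> C" using ex_mchain2 w(2) assms(2,3) by blast
  have "X x < abscissa C (H x)"
    using west_right_chain[OF w(1,2) _ C(1,3)] assms(1) w by (simp add: incomparable_def)
  then show ?thesis using west_right_chain[OF w(1) assms(2) inc C(1,2)] by simp
qed

lemma west_mono_left:
  assumes "west x y" "z \<in> carrier D" "x \<sqsubseteq> z" "\<not> y \<sqsubseteq> z"
  shows "west z y"
proof -
  note w = westD[OF assms(1)]
  have inc: "incomparable D z y"
    using assms(4) w le_trans[OF assms(3)] assms(2) by (auto simp: incomparable_def)
  obtain C where C: "mchain C" "x \<in> C" "z \<in> C" using ex_mchain2 w(1) assms(2,3) by blast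
  have "abscissa C (H y) < X y"
    using west_left_chain[OF w(1,2) _ C(1,2)] assms(1) w by (simp add: incomparable_def)
  then show ?thesis using west_left_chain[OF assms(2) w(2) inc C(1,3)] by simp
qed

lemma west_antimono_left:
  assumes "west x y" "z \<in> carrier D" "z \<sqsubseteq> x" "\<not> z \<sqsubseteq> y"
  shows "west z y"
proof -
  note w = westD[OF assms(1)]
  have inc: "incomparable D z y"
    using assms(4) w le_trans[OF _ assms(3)] assms(2) by (auto simp: incomparable_def)
  obtain C where C: "mchain C" "z \<in> C" "x \<in> C" using ex_mchain2 w(1) assms(2,3) by blast
  have "abscissa C (H y) < X y"
    using west_left_chain[OF w(1,2) _ C(1,3)] assms(1) w by (simp add: incomparable_def)
  then show ?thesis using west_left_chain[OF assms(2) w(2) inc C(1,2)] by simp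
qed

lemma west_separates:
  assumes "west x y" "west y z"
  shows "\<not> x \<sqsubseteq> z"
proof
  assume le: "x \<sqsubseteq> z"
  show False
    using west_mono_left[OF assms(1) westD(2)[OF assms(2)] le westD(3)[OF assms(2)]]
      west_asym[OF assms(2)] by blast
qed

lemma west_separates':
  assumes "west x y" "west y z"
  shows "\<not> z \<sqsubseteq> x"
proof
  assume le: "z \<sqsubseteq> x"
  show False
    using west_antimono_left[OF assms(1) westD(2)[OF assms(2)] le westD(4)[OF assms(2)]]
      west_asym[OF assms(2)] by blast
qed

text \<open>Here \<open>y\<close> is the middle one in height. Chains through \<open>x\<close> and
  through \<open>z\<close> pass the height of \<open>y\<close> in one order and the heights of
  \<open>x\<close> and \<open>z\<close> in the other. So they cross on the way, at an element that
  makes \<open>x\<close> and \<open>z\<close> comparable.\<close>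

lemma no_west_cycle_aux:
  assumes w: "west x y" "west y z" "west z x"
    and h: "H x \<le> H y \<and> H y \<le> H z \<or> H z \<le> H y \<and> H y \<le> H x"
  shows False
proof -
  have c: "x \<in> carrier D" "y \<in> carrier D" "z \<in> carrier D" using westD w by auto
  have inc: "incomparable D x y" "incomparable D y z" "incomparable D z x"
    using w by (auto simp: west_def)
  obtain A where A: "mchain A" "x \<in> A" using ex_mchain1 c by blast
  obtain C where C: "mchain C" "z \<in> C" using ex_mchain1 c by blast
  have hb: "lo \<le> H x" "H x \<le> hi" "lo \<le> H z" "H z \<le> hi" "lo \<le> H y" "H y \<le> hi"
    using height_bounds c by auto
  have 1: "abscissa A (H y) < abscissa C (H y)"
    using west_left_chain[OF c(1,2) inc(1) A] west_right_chain[OF c(2,3) inc(2) C] w by simp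
  have 2: "abscissa C (H x) < abscissa A (H x)"
    using west_left_chain[OF c(3,1) inc(3) C] abscissa_vertex[OF A] w by simp
  have 3: "abscissa C (H z) < abscissa A (H z)"
    using west_right_chain[OF c(3,1) inc(3) A] abscissa_vertex[OF C] w by simp
  from h show False
  proof
    assume h: "H x \<le> H y \<and> H y \<le> H z"
    then obtain v where v: "v \<in> C \<inter> A" "H x < H v" "H v < H y"
      using crossing[OF C(1) A(1) hb(1) _ hb(6) 2 1] by blast
    have "x \<sqsubseteq> v" "v \<sqsubseteq> z" "v \<in> carrier D"
      using mchain_less[OF A, of v] mchain_less[OF C(1) _ C(2), of v] v h mchainD(1)[OF A(1)] by auto
    then show False using inc(3) le_trans c by (auto simp: incomparable_def)
  next
    assume h: "H z \<le> H y \<and> H y \<le> H x"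
    then obtain v where v: "v \<in> C \<inter> A" "H z < H v" "H v < H y"
      using crossing[OF C(1) A(1) hb(3) _ hb(6) 3 1] by blast
    have "z \<sqsubseteq> v" "v \<sqsubseteq> x" "v \<in> carrier D"
      using mchain_less[OF C, of v] mchain_less[OF A(1) _ A(2), of v] v h mchainD(1)[OF A(1)] by auto
    then show False using inc(3) le_trans c by (auto simp: incomparable_def)
  qed
qed

lemma no_west_cycle:
  assumes "west x y" "west y z" "west z x"
  shows False
  using no_west_cycle_aux[OF assms] no_west_cycle_aux[OF assms(2,3,1)] no_west_cycle_aux[OF assms(3,1,2)]
  by linarith

lemma west_trans:
  assumes "west x y" "west y z"
  shows "west x z"
proof -
  have "incomparable D x z"
    using west_separates west_separates' assms by (auto simp: incomparable_def)
  then show ?thesis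
    using west_total[of x z] no_west_cycle[OF assms] westD assms by blast
qed

section \<open>Directions of edges and the left-right order\<close>

lemma abscissa_edge:
  assumes C: "mchain C" "a \<in> C" "b \<in> C" "covers D a b" and h: "H a \<le> h" "h \<le> H b"
  shows "abscissa C h = X a + (X b - X a) / (H b - H a) * (h - H a)"
proof -
  define x where "x = X a + (X b - X a) / (H b - H a) * (h - H a)"
  have "(x, h) \<in> edge D a b"
    using edge_iff[OF covers_height[OF C(4)], of "(x, h)"] h by (simp add: x_def)
  then have "(x, h) \<in> curve C" unfolding curve_def using C by blast
  moreover have "lo \<le> h" "h \<le> hi"
    using height_bounds coversD[OF C(4)] h by (meson order_trans)+
  ultimately show ?thesis using abscissa_iff[OF C(1)] by (simp add: x_def)
qed

lemma upper_covers_incomparable: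
  assumes "covers D x b" "covers D x c" "b \<noteq> c"
  shows "incomparable D b c"
  using assms unfolding covers_def incomparable_def by metis

lemma lower_covers_incomparable:
  assumes "covers D b x" "covers D c x" "b \<noteq> c"
  shows "incomparable D b c"
  using assms unfolding covers_def incomparable_def by metis

text \<open>At the lower of the two heights both edges are present. There the test along a chain
  compares two lines through \<open>x\<close>, that is, their drifts.\<close>

lemma left_upper_west: "left_upper D x b c \<longleftrightarrow> covers D x b \<and> covers D x c \<and> west b c"
proof (cases "covers D x b \<and> covers D x c \<and> b \<noteq> c")
  case False
  then show ?thesis using westD(3)[of b c] by (auto simp: left_upper_def covers_def)
next
  case True
  then have cb: "covers D x b" "covers D x c" "b \<noteq> c" by auto
  have inc: "incomparable D b c" using upper_covers_incomparable[OF cb] .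
  note b = coversD[OF cb(1)] and c = coversD[OF cb(2)]
  have hb: "H x < H b" "H x < H c" using covers_height cb by auto
  obtain B where B: "mchain B" "x \<in> B" "b \<in> B" using ex_mchain2 b by blast
  obtain C where C: "mchain C" "x \<in> C" "c \<in> C" using ex_mchain2 c by blast
  have "west b c \<longleftrightarrow> drift D x b < drift D x c"
  proof (cases "H b \<le> H c")
    case True
    have "west b c \<longleftrightarrow> X b < X x + (X c - X x) / (H c - H x) * (H b - H x)"
      using west_right_chain[OF b(2) c(2) inc C(1,3)] abscissa_edge[OF C cb(2)] hb True by simp
    also have "\<dots> \<longleftrightarrow> drift D x b < drift D x c"
      using hb by (simp add: drift_def divide_less_eq mult.commute) linarith
    finally show ?thesis .
  next
    case False
    have "west b c \<longleftrightarrow> X x + (X b - X x) / (H b - H x) * (H c - H x) < X c"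
      using west_left_chain[OF b(2) c(2) inc B(1,3)] abscissa_edge[OF B cb(1)] hb False by simp
    also have "\<dots> \<longleftrightarrow> drift D x b < drift D x c"
      using hb by (simp add: drift_def less_divide_eq mult.commute) linarith
    finally show ?thesis .
  qed
  then show ?thesis using cb by (simp add: left_upper_def)
qed

lemma left_lower_west: "left_lower D x b c \<longleftrightarrow> covers D b x \<and> covers D c x \<and> west b c"
proof (cases "covers D b x \<and> covers D c x \<and> b \<noteq> c")
  case False
  then show ?thesis using westD(3)[of b c] by (auto simp: left_lower_def covers_def)
next
  case True
  then have cb: "covers D b x" "covers D c x" "b \<noteq> c" by auto
  have inc: "incomparable D b c" using lower_covers_incomparable[OF cb] .
  note b = coversD[OF cb(1)] and c = coversD[OF cb(2)]
  have hb: "H b < H x" "H c < H x" using covers_height cb by auto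
  obtain B where B: "mchain B" "b \<in> B" "x \<in> B" using ex_mchain2 b by blast
  obtain C where C: "mchain C" "c \<in> C" "x \<in> C" using ex_mchain2 c by blast
  have lin: "X p + (X x - X p) / (H x - H p) * (h - H p) = X x + drift D x p * (H x - h)"
    if "H p < H x" for p h
    using that by (simp add: drift_def field_simps)
  have "west b c \<longleftrightarrow> drift D x b < drift D x c"
  proof (cases "H c \<le> H b")
    case True
    have "west b c \<longleftrightarrow> X b < X x + drift D x c * (H x - H b)"
      using west_right_chain[OF b(1) c(1) inc C(1,2)] abscissa_edge[OF C cb(2)] hb True lin by simp
    also have "\<dots> \<longleftrightarrow> (X b - X x) / (H x - H b) < drift D x c"
      using hb by (subst pos_divide_less_eq) auto
    finally show ?thesis using hb by (simp add: drift_def)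
  next
    case False
    have "west b c \<longleftrightarrow> X x + drift D x b * (H x - H c) < X c"
      using west_left_chain[OF b(1) c(1) inc B(1,2)] abscissa_edge[OF B cb(1)] hb False lin by simp
    also have "\<dots> \<longleftrightarrow> drift D x b < (X c - X x) / (H x - H c)"
      using hb by (subst pos_less_divide_eq) auto
    finally show ?thesis using hb by (simp add: drift_def)
  qed
  then show ?thesis using cb by (simp add: left_lower_def)
qed

text \<open>A branch below both \<open>x\<close> and \<open>y\<close> would lie below their meet, so
  \<open>b\<close> is not below \<open>y\<close> and \<open>c\<close> is not below \<open>x\<close>.
  Monotonicity then carries the order of \<open>b\<close> and \<open>c\<close> up to
  \<open>x\<close> and \<open>y\<close>.\<close>

lemma meet_branch:
  assumes "x \<in> carrier D" "y \<in> carrier D" "incomparable D x y"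
    "covers D (x \<sqinter> y) b" "covers D (x \<sqinter> y) c" "b \<sqsubseteq> x" "c \<sqsubseteq> y"
  shows "west b c \<longleftrightarrow> west x y"
proof -
  note b = coversD[OF assms(4)] and c = coversD[OF assms(5)]
  have nb: "\<not> b \<sqsubseteq> y"
    using meet_le[OF assms(6) _ assms(1,2) b(2)] b le_antisym by blast
  have nc: "\<not> c \<sqsubseteq> x"
    using meet_le[OF _ assms(7) assms(1,2) c(2)] c le_antisym by blast
  have bc: "incomparable D b c"
    using upper_covers_incomparable[OF assms(4,5)] nb assms(7) by blast
  have bx: "west x y" if "west b c"
  proof -
    have "west b y" by (rule west_mono_right[OF that assms(2,7) nb])
    then show ?thesis
      using west_mono_left[OF _ assms(1,6)] assms(3) by (auto simp: incomparable_def)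
  qed
  have "west y x" if "west c b"
  proof -
    have "west c x" by (rule west_mono_right[OF that assms(1,6) nc])
    then show ?thesis
      using west_mono_left[OF _ assms(2,7)] assms(3) by (auto simp: incomparable_def)
  qed
  then show ?thesis
    using bx west_total[OF b(2) c(2) bc] west_total[OF assms(1-3)] by blast
qed

lemma left_of_west: "left_of D x y \<longleftrightarrow> west x y"
proof
  assume "left_of D x y"
  then obtain b c where "x \<in> carrier D" "y \<in> carrier D" "incomparable D x y"
    "left_upper D (x \<sqinter> y) b c" "b \<sqsubseteq> x" "c \<sqsubseteq> y"
    unfolding left_of_def by blast
  then show "west x y" using meet_branch[of x y b c] by (simp add: left_upper_west)
next
  assume w: "west x y"
  note xy = westD[OF w]
  have inc: "incomparable D x y" using xy by (auto simp: incomparable_def)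
  have m: "x \<sqinter> y \<in> carrier D" "x \<sqinter> y \<sqsubseteq> x" "x \<sqinter> y \<sqsubseteq> y"
    using meet_left[OF xy(1,2)] meet_right[OF xy(1,2)] xy by auto
  obtain b where b: "covers D (x \<sqinter> y) b" "b \<sqsubseteq> x" using ex_upper_cover[OF m(1) xy(1) m(2)] m xy by metis
  obtain c where c: "covers D (x \<sqinter> y) c" "c \<sqsubseteq> y" using ex_upper_cover[OF m(1) xy(2) m(3)] m xy by metis
  have "west b c" using meet_branch[OF xy(1,2) inc b(1) c(1) b(2) c(2)] w by blast
  then show "left_of D x y"
    unfolding left_of_def left_upper_west using xy inc b c by blast
qed

lemmas left_ofD = westD[folded left_of_west]
lemmas left_of_total = west_total[folded left_of_west]
lemmas left_of_asym = west_asym[folded left_of_west]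
lemmas left_of_trans = west_trans[folded left_of_west]
lemmas left_of_mono_right = west_mono_right[folded left_of_west]
lemmas left_of_antimono_right = west_antimono_right[folded left_of_west]
lemmas left_of_mono_left = west_mono_left[folded left_of_west]
lemmas left_of_antimono_left = west_antimono_left[folded left_of_west]
lemmas left_upper_iff = left_upper_west[folded left_of_west]
lemmas left_lower_iff = left_lower_west[folded left_of_west]

section \<open>The boundary chains in terms of the left-right order\<close>

lemma curve_drawing: "mchain C \<Longrightarrow> curve C \<subseteq> drawing D"
  unfolding curve_def drawing_def using mchainD(1) by blast

lemma in_drawing_curve:
  assumes "p \<in> drawing D"
  shows "\<exists>C. mchain C \<and> p \<in> curve C"
proof -
  have "p \<in> pos D ` carrier D \<or> (\<exists>a b. covers D a b \<and> p \<in> edge D a b)"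
    using assms unfolding drawing_def by auto
  then show ?thesis
  proof
    assume "p \<in> pos D ` carrier D"
    then show ?thesis using ex_mchain1 unfolding curve_def by blast
  next
    assume "\<exists>a b. covers D a b \<and> p \<in> edge D a b"
    then obtain a b where ab: "covers D a b" "p \<in> edge D a b" by blast
    obtain C where "mchain C" "a \<in> C" "b \<in> C" using ex_mchain2 coversD[OF ab(1)] by blast
    then show ?thesis using ab unfolding curve_def by blast
  qed
qed

lemma ex_incomparable_in_mchain:
  assumes "mchain C" "x \<in> carrier D" "x \<notin> C"
  shows "\<exists>c\<in>C. incomparable D x c"
  using mchainD(3)[OF assms(1,2)] assms(3) unfolding incomparable_def by blast

text \<open>A point of the drawing to the left of \<open>x\<close> lies on the curve of a maximal
  chain. This chain misses \<open>x\<close>, so it has a member incomparable to \<open>x\<close>,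
  and that member is to the left of \<open>x\<close>. Conversely, a chain through an element on the
  left supplies such a point.\<close>

lemma left_boundary_iff:
  "x \<in> left_boundary D \<longleftrightarrow> x \<in> carrier D \<and> \<not> (\<exists>y. left_of D y x)"
proof (cases "x \<in> carrier D")
  case x: True
  have hx: "lo \<le> H x" "H x \<le> hi" using height_bounds x by auto
  have "\<exists>y. west y x" if p: "p \<in> drawing D" "snd p = H x" "fst p < X x" for p
  proof -
    obtain C where C: "mchain C" "p \<in> curve C" using in_drawing_curve p(1) by blast
    have g: "abscissa C (H x) < X x"
      using abscissa_iff[OF C(1) hx, of "fst p"] C(2) p(2,3) by (metis prod.collapse)
    then have "x \<notin> C" using abscissa_vertex[OF C(1)] by force
    then obtain c where c: "c \<in> C" "incomparable D x c" using ex_incomparable_in_mchain C(1) x by blast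
    have "west c x"
      using west_left_chain[of c x C] c C(1) g mchainD(1)[OF C(1) c(1)] x incomparable_sym by blast
    then show ?thesis ..
  qed
  moreover have "\<exists>p\<in>drawing D. snd p = H x \<and> fst p < X x" if w: "west y x" for y
  proof -
    note y = westD[OF w]
    obtain C where C: "mchain C" "y \<in> C" using ex_mchain1 y by blast
    have "abscissa C (H x) < X x"
      using west_left_chain[OF y(1,2) _ C] w y by (simp add: incomparable_def)
    moreover have "(abscissa C (H x), H x) \<in> drawing D"
      using abscissa_iff[OF C(1) hx] curve_drawing[OF C(1)] by blast
    ultimately show ?thesis by (intro bexI[of _ "(abscissa C (H x), H x)"]) auto
  qed
  ultimately show ?thesis
    unfolding left_of_west left_boundary_def using x by (fastforce simp: not_le)
qed (simp add: left_boundary_def)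

lemma right_boundary_iff:
  "x \<in> right_boundary D \<longleftrightarrow> x \<in> carrier D \<and> \<not> (\<exists>y. left_of D x y)"
proof (cases "x \<in> carrier D")
  case x: True
  have hx: "lo \<le> H x" "H x \<le> hi" using height_bounds x by auto
  have "\<exists>y. west x y" if p: "p \<in> drawing D" "snd p = H x" "X x < fst p" for p
  proof -
    obtain C where C: "mchain C" "p \<in> curve C" using in_drawing_curve p(1) by blast
    have g: "X x < abscissa C (H x)"
      using abscissa_iff[OF C(1) hx, of "fst p"] C(2) p(2,3) by (metis prod.collapse)
    then have "x \<notin> C" using abscissa_vertex[OF C(1)] by force
    then obtain c where c: "c \<in> C" "incomparable D x c" using ex_incomparable_in_mchain C(1) x by blast
    have "west x c"
      using west_right_chain[of x c C] c C(1) g mchainD(1)[OF C(1) c(1)] x by blast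
    then show ?thesis ..
  qed
  moreover have "\<exists>p\<in>drawing D. snd p = H x \<and> X x < fst p" if w: "west x y" for y
  proof -
    note y = westD[OF w]
    obtain C where C: "mchain C" "y \<in> C" using ex_mchain1 y by blast
    have "X x < abscissa C (H x)"
      using west_right_chain[OF y(1,2) _ C] w y by (simp add: incomparable_def)
    moreover have "(abscissa C (H x), H x) \<in> drawing D"
      using abscissa_iff[OF C(1) hx] curve_drawing[OF C(1)] by blast
    ultimately show ?thesis by (intro bexI[of _ "(abscissa C (H x), H x)"]) auto
  qed
  ultimately show ?thesis
    unfolding left_of_west right_boundary_def using x by (fastforce simp: not_le)
qed (simp add: right_boundary_def)

end

section \<open>Point configurations\<close>

text \<open>General position together with a dominating point. The latter is the top of the diagram
  and lies in every quadrant with a tight corner, so intersections of such quadrants are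
  nonempty.\<close>

definition config :: "(real \<times> real) set \<Rightarrow> bool" where
  "config P \<longleftrightarrow> finite P \<and> inj_on fst P \<and> inj_on snd P \<and> (\<exists>w\<in>P. \<forall>z\<in>P. z \<le> w)"

text \<open>The corners of quadrants that cannot be pushed to the right or upwards without losing a
  point of \<open>P\<close>: the bounding column and the bounding row each carry a point of the
  quadrant.\<close>

definition tight :: "(real \<times> real) set \<Rightarrow> (real \<times> real) set" where
  "tight P = {(a, b). (\<exists>z\<in>P. fst z = a \<and> b \<le> snd z) \<and> (\<exists>z\<in>P. snd z = b \<and> a \<le> fst z)}"

definition quad :: "(real \<times> real) set \<Rightarrow> real \<times> real \<Rightarrow> (real \<times> real) set" where
  "quad P p = {z \<in> P. p \<le> z}"

lemma quad_mono: "p \<le> q \<Longrightarrow> quad P q \<subseteq> quad P p"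
  by (auto simp: quad_def)

lemma tightD:
  assumes "p \<in> tight P"
  shows "\<exists>z\<in>quad P p. fst z = fst p" "\<exists>z\<in>quad P p. snd z = snd p"
  using assms by (auto simp: tight_def quad_def less_eq_prod_def)

lemma tightI:
  assumes "z \<in> P" "fst z = fst p" "snd p \<le> snd z" "w \<in> P" "snd w = snd p" "fst p \<le> fst w"
  shows "p \<in> tight P"
  using assms by (cases p) (auto simp: tight_def)

lemma tight_le_iff:
  assumes "p \<in> tight P" "q \<in> tight P"
  shows "p \<le> q \<longleftrightarrow> quad P q \<subseteq> quad P p"
proof
  assume "quad P q \<subseteq> quad P p"
  then show "p \<le> q"
    using tightD[OF assms(2)] by (auto simp: quad_def less_eq_prod_def)
qed (rule quad_mono)

lemma point_tight: "z \<in> P \<Longrightarrow> z \<in> tight P"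
  by (rule tightI) auto

lemma tight_inf:
  assumes "p \<in> tight P" "q \<in> tight P"
  shows "inf p q \<in> tight P"
proof -
  obtain z1 where z1: "z1 \<in> P" "fst z1 = fst p" "snd p \<le> snd z1"
    using tightD(1)[OF assms(1)] by (auto simp: quad_def less_eq_prod_def)
  obtain z2 where z2: "z2 \<in> P" "snd z2 = snd p" "fst p \<le> fst z2"
    using tightD(2)[OF assms(1)] by (auto simp: quad_def less_eq_prod_def)
  obtain w1 where w1: "w1 \<in> P" "fst w1 = fst q" "snd q \<le> snd w1"
    using tightD(1)[OF assms(2)] by (auto simp: quad_def less_eq_prod_def)
  obtain w2 where w2: "w2 \<in> P" "snd w2 = snd q" "fst q \<le> fst w2"
    using tightD(2)[OF assms(2)] by (auto simp: quad_def less_eq_prod_def)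
  have i: "inf p q = (min (fst p) (fst q), min (snd p) (snd q))"
    by (simp add: inf_prod_def inf_min)
  have "\<exists>z\<in>P. fst z = min (fst p) (fst q) \<and> min (snd p) (snd q) \<le> snd z"
    using z1 w1 by (cases "fst p \<le> fst q") (force simp: min_def)+
  moreover have "\<exists>z\<in>P. snd z = min (snd p) (snd q) \<and> min (fst p) (fst q) \<le> fst z"
    using z2 w2 by (cases "snd p \<le> snd q") (force simp: min_def)+
  ultimately show ?thesis unfolding i tight_def by simp
qed

text \<open>By the closure condition \<open>S\<close> contains every point of \<open>P\<close> above
  the corner formed by its least abscissa and its least ordinate, and that corner is tight. This is
  how elements of a diagram are obtained from sets of points.\<close>

lemma ex_tight:
  assumes "finite P" "S \<subseteq> P" "S \<noteq> {}"
    and cl: "\<And>z u v. z \<in> P \<Longrightarrow> u \<in> S \<Longrightarrow> v \<in> S \<Longrightarrow> fst u \<le> fst z \<Longrightarrow> snd v \<le> snd z \<Longrightarrow> z \<in> S"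
  shows "\<exists>p\<in>tight P. quad P p = S"
proof -
  have fS: "finite S" using assms(1,2) finite_subset by blast
  define p where "p = (Min (fst ` S), Min (snd ` S))"
  have "Min (fst ` S) \<in> fst ` S" using fS assms(3) by (intro Min_in) auto
  then obtain u where u: "u \<in> S" "fst p = fst u" by (auto simp: p_def)
  have "Min (snd ` S) \<in> snd ` S" using fS assms(3) by (intro Min_in) auto
  then obtain v where v: "v \<in> S" "snd p = snd v" by (auto simp: p_def)
  have le: "p \<le> z" if "z \<in> S" for z
    using that fS by (auto simp: p_def less_eq_prod_def)
  have "p \<in> tight P"
    using le[OF u(1)] le[OF v(1)] u v assms(2)
    by (intro tightI[of u P p v]) (auto simp: less_eq_prod_def)
  moreover have "quad P p = S"
    using le cl[OF _ u(1) v(1)] u(2) v(2) assms(2) by (auto simp: quad_def less_eq_prod_def)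
  ultimately show ?thesis by blast
qed

lemma finite_tight:
  assumes "finite P"
  shows "finite (tight P)"
proof -
  note assms
  moreover have "tight P \<subseteq> fst ` P \<times> snd ` P" by (auto simp: tight_def)
  ultimately show ?thesis by (meson finite_SigmaI finite_imageI finite_subset)
qed

definition represents ::
    "('a, 'b) diagram_scheme \<Rightarrow> ('a \<Rightarrow> real \<times> real) \<Rightarrow> (real \<times> real) set \<Rightarrow> bool" where
  "represents D \<kappa> P \<longleftrightarrow> planar_diagram D \<and> config P \<and> bij_betw \<kappa> (carrier D) (tight P) \<and>
     (\<forall>x\<in>carrier D. \<forall>y\<in>carrier D. x \<sqsubseteq>\<^bsub>D\<^esub> y \<longleftrightarrow> \<kappa> x \<le> \<kappa> y) \<and>
     (\<forall>x\<in>carrier D. \<forall>y\<in>carrier D.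
        left_of D x y \<longleftrightarrow> fst (\<kappa> y) < fst (\<kappa> x) \<and> snd (\<kappa> x) < snd (\<kappa> y))"

text \<open>Meets are componentwise. Joins are not, since the componentwise supremum of two tight
  corners need not be tight; they come from the intersection of the two quadrants.\<close>

lemma lattice_from_tight:
  assumes eq: "eq D = (=)" and P: "finite P" "\<exists>w\<in>P. \<forall>z\<in>P. z \<le> w"
    and bij: "bij_betw \<kappa> (carrier D) (tight P)"
    and le: "\<And>x y. x \<in> carrier D \<Longrightarrow> y \<in> carrier D \<Longrightarrow> x \<sqsubseteq>\<^bsub>D\<^esub> y \<longleftrightarrow> \<kappa> x \<le> \<kappa> y"
  shows "lattice D"
proof -
  have mem: "\<kappa> x \<in> tight P" if "x \<in> carrier D" for x using that bij bij_betwE by blast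
  have inj: "x = y" if "x \<in> carrier D" "y \<in> carrier D" "\<kappa> x = \<kappa> y" for x y
    using that bij by (auto simp: bij_betw_def inj_on_def)
  have ex: "\<exists>x\<in>carrier D. \<kappa> x = p" if "p \<in> tight P" for p
    using that bij by (metis bij_betw_def imageE)
  interpret partial_order D
  proof
    show "x .=\<^bsub>D\<^esub> y" if "x \<sqsubseteq>\<^bsub>D\<^esub> y" "y \<sqsubseteq>\<^bsub>D\<^esub> x" "x \<in> carrier D" "y \<in> carrier D" for x y
      using that inj le unfolding eq by (meson order_antisym)
    show "x \<sqsubseteq>\<^bsub>D\<^esub> z" if "x \<sqsubseteq>\<^bsub>D\<^esub> y" "y \<sqsubseteq>\<^bsub>D\<^esub> z" "x \<in> carrier D" "y \<in> carrier D" "z \<in> carrier D" for x y z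
      using that le by (meson order_trans)
  qed (auto simp: eq le)
  obtain w where w: "w \<in> P" "\<And>z. z \<in> P \<Longrightarrow> z \<le> w" using P(2) by blast
  have wq: "w \<in> quad P (\<kappa> x)" if x: "x \<in> carrier D" for x
    using tightD(1)[OF mem[OF x]] w order_trans unfolding quad_def by blast
  have sup: "\<exists>s. least D s (Upper D {x, y})" if x: "x \<in> carrier D" and y: "y \<in> carrier D" for x y
  proof -
    obtain p where p: "p \<in> tight P" "quad P p = quad P (\<kappa> x) \<inter> quad P (\<kappa> y)"
      using ex_tight[OF P(1), of "quad P (\<kappa> x) \<inter> quad P (\<kappa> y)"] wq[OF x] wq[OF y]
      by (force simp: quad_def less_eq_prod_def)
    obtain s where s: "s \<in> carrier D" "\<kappa> s = p" using ex[OF p(1)] by blast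
    have "s \<sqsubseteq>\<^bsub>D\<^esub> u \<longleftrightarrow> x \<sqsubseteq>\<^bsub>D\<^esub> u \<and> y \<sqsubseteq>\<^bsub>D\<^esub> u" if u: "u \<in> carrier D" for u
      using tight_le_iff[OF p(1) mem[OF u]] tight_le_iff[OF mem[OF x] mem[OF u]]
        tight_le_iff[OF mem[OF y] mem[OF u]] p(2) s le u x y by auto
    then show ?thesis
      using s(1) x y by (intro exI[of _ s]) (auto simp: least_def Upper_def)
  qed
  have inf: "\<exists>s. greatest D s (Lower D {x, y})" if x: "x \<in> carrier D" and y: "y \<in> carrier D" for x y
  proof -
    obtain s where s: "s \<in> carrier D" "\<kappa> s = inf (\<kappa> x) (\<kappa> y)"
      using ex[OF tight_inf[OF mem[OF x] mem[OF y]]] by blast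
    have "u \<sqsubseteq>\<^bsub>D\<^esub> s \<longleftrightarrow> u \<sqsubseteq>\<^bsub>D\<^esub> x \<and> u \<sqsubseteq>\<^bsub>D\<^esub> y" if u: "u \<in> carrier D" for u
      using s le u x y by auto
    then show ?thesis
      using s(1) x y by (intro exI[of _ s]) (auto simp: greatest_def Lower_def)
  qed
  show ?thesis
    by unfold_locales (auto intro: sup inf)
qed

text \<open>
  If positions are such that the order of the lattice is dominance, then crossing edges
  \<open>a \<prec> b\<close> and \<open>c \<prec> d\<close> satisfy \<open>a \<squnion> c \<le> p \<le> b \<sqinter> d\<close> at the crossing point \<open>p\<close>,
  so \<open>a \<squnion> c\<close> is an end point of both.
\<close>

lemma represents_drawn:
  assumes eq: "eq D = (=)" and P: "config P"
    and bij: "bij_betw \<kappa> (carrier D) (tight P)"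
    and le: "\<And>x y. x \<in> carrier D \<Longrightarrow> y \<in> carrier D \<Longrightarrow> x \<sqsubseteq>\<^bsub>D\<^esub> y \<longleftrightarrow> \<kappa> x \<le> \<kappa> y"
    and pos: "\<And>x. x \<in> carrier D \<Longrightarrow> pos D x = (snd (\<kappa> x) - fst (\<kappa> x), fst (\<kappa> x) + snd (\<kappa> x))"
  shows "represents D \<kappa> P"
proof -
  have finP: "finite P" and ne: "P \<noteq> {}" using P by (auto simp: config_def)
  have inj: "x = y" if "x \<in> carrier D" "y \<in> carrier D" "\<kappa> x = \<kappa> y" for x y
    using that bij by (auto simp: bij_betw_def inj_on_def)
  have lat: "lattice D"
    using lattice_from_tight[OF eq finP _ bij le] P by (auto simp: config_def)
  interpret lattice D by (rule lat)
  define R :: "real \<times> real \<Rightarrow> real \<times> real" where "R p = (snd p - fst p, fst p + snd p)" for p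
  have R_inj: "R p = R q \<Longrightarrow> p = q" for p q by (auto simp: R_def prod_eq_iff)
  have R_lin: "R ((1 - u) *\<^sub>R p + u *\<^sub>R q) = (1 - u) *\<^sub>R R p + u *\<^sub>R R q" for u p q
    by (simp add: R_def algebra_simps)
  have posR: "pos D x = R (\<kappa> x)" if "x \<in> carrier D" for x
    using pos[OF that] by (simp add: R_def)
  have edgeE: "\<exists>p. q = R p \<and> \<kappa> a \<le> p \<and> p \<le> \<kappa> b \<and> (\<exists>u. 0 \<le> u \<and> u \<le> 1 \<and> p = (1 - u) *\<^sub>R \<kappa> a + u *\<^sub>R \<kappa> b)"
    if ab: "covers D a b" "q \<in> edge D a b" for a b q
  proof -
    have c: "a \<in> carrier D" "b \<in> carrier D" "a \<sqsubseteq>\<^bsub>D\<^esub> b" using ab(1) by (auto simp: covers_def)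
    obtain u where u: "0 \<le> u" "u \<le> 1" "q = (1 - u) *\<^sub>R pos D a + u *\<^sub>R pos D b"
      using ab(2) unfolding edge_def closed_segment_def by blast
    have l: "fst (\<kappa> a) \<le> fst (\<kappa> b)" "snd (\<kappa> a) \<le> snd (\<kappa> b)"
      using le[OF c(1,2)] c(3) by (auto simp: less_eq_prod_def)
    have between: "s \<le> (1 - u) * s + u * t \<and> (1 - u) * s + u * t \<le> t" if "s \<le> t" for s t :: real
    proof -
      have "0 \<le> u * (t - s)" "0 \<le> (1 - u) * (t - s)" using u that by auto
      then show ?thesis by (auto simp: algebra_simps)
    qed
    show ?thesis
      using u R_lin posR[OF c(1)] posR[OF c(2)] between[OF l(1)] between[OF l(2)]
      by (intro exI[of _ "(1 - u) *\<^sub>R \<kappa> a + u *\<^sub>R \<kappa> b"]) (auto simp: less_eq_prod_def)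
  qed
  have pl: "planar_diagram D"
    unfolding planar_diagram_def
  proof (intro conjI allI impI)
    show "lattice D" by (rule lat)
    show "finite (carrier D)" using bij_betw_finite[OF bij] finite_tight[OF finP] by simp
    show "carrier D \<noteq> {}"
      using bij ne point_tight by (fastforce simp: bij_betw_def)
    show "inj_on (pos D) (carrier D)"
      by (intro inj_onI) (metis R_inj inj posR)
  next
    fix a b assume ab: "covers D a b"
    then have c: "a \<in> carrier D" "b \<in> carrier D" "a \<sqsubseteq>\<^bsub>D\<^esub> b" "a \<noteq> b" by (auto simp: covers_def)
    then have "\<kappa> a \<le> \<kappa> b" "\<kappa> a \<noteq> \<kappa> b" using le inj by blast+
    then show "snd (pos D a) < snd (pos D b)"
      using posR c by (auto simp: R_def less_eq_prod_def prod_eq_iff)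
  next
    fix a b c d assume as: "covers D a b \<and> covers D c d \<and> (a, b) \<noteq> (c, d)"
    then have ab: "covers D a b" and cd: "covers D c d" and neq: "(a, b) \<noteq> (c, d)" by auto
    have car: "a \<in> carrier D" "b \<in> carrier D" "c \<in> carrier D" "d \<in> carrier D"
      using ab cd by (auto simp: covers_def)
    have lts: "a \<sqsubseteq>\<^bsub>D\<^esub> b" "a \<noteq> b" "c \<sqsubseteq>\<^bsub>D\<^esub> d" "c \<noteq> d" using ab cd by (auto simp: covers_def)
    show "edge D a b \<inter> edge D c d \<subseteq> pos D ` ({a, b} \<inter> {c, d})"
    proof
      fix q assume q: "q \<in> edge D a b \<inter> edge D c d"
      obtain p u where p: "q = R p" "\<kappa> a \<le> p" "p \<le> \<kappa> b" and
        u: "0 \<le> u" "u \<le> 1" "p = (1 - u) *\<^sub>R \<kappa> a + u *\<^sub>R \<kappa> b"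
        using edgeE[OF ab] q by blast
      obtain p' v where p': "q = R p'" "\<kappa> c \<le> p'" "p' \<le> \<kappa> d" and
        v: "0 \<le> v" "v \<le> 1" "p' = (1 - v) *\<^sub>R \<kappa> c + v *\<^sub>R \<kappa> d"
        using edgeE[OF cd] q by blast
      have [simp]: "p' = p" using R_inj p p' by metis
      have "a \<sqsubseteq>\<^bsub>D\<^esub> d" "c \<sqsubseteq>\<^bsub>D\<^esub> b"
        using le car order_trans[OF p(2) p'(3)[simplified]] order_trans[OF p'(2)[simplified] p(3)] by auto
      then have jn: "a \<squnion>\<^bsub>D\<^esub> c \<sqsubseteq>\<^bsub>D\<^esub> b" "a \<squnion>\<^bsub>D\<^esub> c \<sqsubseteq>\<^bsub>D\<^esub> d"
        using car lts by (auto intro: join_le)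
      have j: "a \<squnion>\<^bsub>D\<^esub> c \<in> carrier D" "a \<sqsubseteq>\<^bsub>D\<^esub> a \<squnion>\<^bsub>D\<^esub> c" "c \<sqsubseteq>\<^bsub>D\<^esub> a \<squnion>\<^bsub>D\<^esub> c"
        using car join_left join_right by auto
      have j1: "a \<squnion>\<^bsub>D\<^esub> c = a \<or> a \<squnion>\<^bsub>D\<^esub> c = b" and j2: "a \<squnion>\<^bsub>D\<^esub> c = c \<or> a \<squnion>\<^bsub>D\<^esub> c = d"
        using ab cd j jn unfolding covers_def by blast+
      have end_pt: "p = \<kappa> z \<Longrightarrow> z \<in> {a, b} \<inter> {c, d} \<Longrightarrow> q \<in> pos D ` ({a, b} \<inter> {c, d})" for z
        using p(1) posR car by (intro image_eqI[of _ _ z]) auto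
      \<comment> \<open>Two edges from the same lower end that meet again have the same direction.
        The shorter one, to \<open>t'\<close>, then ends below \<open>t\<close> in the order,
        against \<open>t\<close> covering \<open>s\<close>.\<close>
      have diag: "p = \<kappa> s"
        if s: "covers D s t" "covers D s t'" "t \<noteq> t'"
          and w: "0 \<le> \<mu>" "p = (1 - \<mu>) *\<^sub>R \<kappa> s + \<mu> *\<^sub>R \<kappa> t" "0 \<le> \<nu>" "p = (1 - \<nu>) *\<^sub>R \<kappa> s + \<nu> *\<^sub>R \<kappa> t'"
          and lq: "\<mu> \<le> \<nu>"
        for s t t' \<mu> \<nu>
      proof (rule ccontr)
        assume "p \<noteq> \<kappa> s"
        then have mn: "0 < \<mu>" "0 < \<nu>" using w by (auto simp: less_le)
        have cs: "s \<in> carrier D" "t \<in> carrier D" "t' \<in> carrier D" "s \<sqsubseteq>\<^bsub>D\<^esub> t" "s \<sqsubseteq>\<^bsub>D\<^esub> t'"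
          using s by (auto simp: covers_def)
        have "\<kappa> s \<le> \<kappa> t'" using cs le by blast
        have e: "\<mu> * (fst (\<kappa> t) - fst (\<kappa> s)) = \<nu> * (fst (\<kappa> t') - fst (\<kappa> s))"
          "\<mu> * (snd (\<kappa> t) - snd (\<kappa> s)) = \<nu> * (snd (\<kappa> t') - snd (\<kappa> s))"
          using w(2,4) by (auto simp: prod_eq_iff algebra_simps)
        have "\<mu> * (fst (\<kappa> t') - fst (\<kappa> s)) \<le> \<mu> * (fst (\<kappa> t) - fst (\<kappa> s))"
          "\<mu> * (snd (\<kappa> t') - snd (\<kappa> s)) \<le> \<mu> * (snd (\<kappa> t) - snd (\<kappa> s))"
          unfolding e using \<open>\<kappa> s \<le> \<kappa> t'\<close> lq by (auto simp: less_eq_prod_def intro!: mult_right_mono)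
        then have "\<kappa> t' \<le> \<kappa> t" using mn by (auto simp: less_eq_prod_def)
        then have "t' \<sqsubseteq>\<^bsub>D\<^esub> t" using le cs by blast
        then show False using s cs unfolding covers_def by blast
      qed
      have diag': "p = \<kappa> t"
        if s: "covers D s t" "covers D s' t" "s \<noteq> s'"
          and w: "\<mu> \<le> 1" "p = (1 - \<mu>) *\<^sub>R \<kappa> s + \<mu> *\<^sub>R \<kappa> t" "\<nu> \<le> 1" "p = (1 - \<nu>) *\<^sub>R \<kappa> s' + \<nu> *\<^sub>R \<kappa> t"
          and lq: "\<mu> \<le> \<nu>"
        for s s' t \<mu> \<nu>
      proof (rule ccontr)
        assume "p \<noteq> \<kappa> t"
        then have mn: "0 < 1 - \<mu>" "0 < 1 - \<nu>" using w by (auto simp: less_le)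
        have cs: "s \<in> carrier D" "t \<in> carrier D" "s' \<in> carrier D" "s \<sqsubseteq>\<^bsub>D\<^esub> t" "s' \<sqsubseteq>\<^bsub>D\<^esub> t"
          using s by (auto simp: covers_def)
        have "\<kappa> s \<le> \<kappa> t" using cs le by blast
        have e: "(1 - \<nu>) * (fst (\<kappa> t) - fst (\<kappa> s')) = (1 - \<mu>) * (fst (\<kappa> t) - fst (\<kappa> s))"
          "(1 - \<nu>) * (snd (\<kappa> t) - snd (\<kappa> s')) = (1 - \<mu>) * (snd (\<kappa> t) - snd (\<kappa> s))"
          using w(2,4) by (auto simp: prod_eq_iff algebra_simps)
        have "(1 - \<nu>) * (fst (\<kappa> t) - fst (\<kappa> s)) \<le> (1 - \<nu>) * (fst (\<kappa> t) - fst (\<kappa> s'))"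
          "(1 - \<nu>) * (snd (\<kappa> t) - snd (\<kappa> s)) \<le> (1 - \<nu>) * (snd (\<kappa> t) - snd (\<kappa> s'))"
          unfolding e using \<open>\<kappa> s \<le> \<kappa> t\<close> lq by (auto simp: less_eq_prod_def intro!: mult_right_mono)
        then have "\<kappa> s' \<le> \<kappa> s" using mn by (auto simp: less_eq_prod_def)
        then have "s' \<sqsubseteq>\<^bsub>D\<^esub> s" using le cs by blast
        then show False using s cs unfolding covers_def by blast
      qed
      consider "a = c" | "a = d" | "b = c" | "b = d" using j1 j2 by metis
      then show "q \<in> pos D ` ({a, b} \<inter> {c, d})"
      proof cases
        case 1
        then have "b \<noteq> d" using neq by auto
        have "p = \<kappa> a"
        proof (cases "u \<le> v")
          case True
          then show ?thesis using diag[of a b d u v] ab cd 1 \<open>b \<noteq> d\<close> u v by simp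
        next
          case False
          then show ?thesis using diag[of a d b v u] ab cd 1 \<open>b \<noteq> d\<close> u v by simp
        qed
        then show ?thesis using end_pt[of a] 1 by blast
      next
        case 2
        then have "p = \<kappa> a" using p(2) p'(3) by simp
        then show ?thesis using end_pt[of a] 2 by blast
      next
        case 3
        then have "p = \<kappa> b" using p(3) p'(2) by simp
        then show ?thesis using end_pt[of b] 3 by blast
      next
        case 4
        then have "a \<noteq> c" using neq by auto
        have "p = \<kappa> b"
        proof (cases "u \<le> v")
          case True
          then show ?thesis using diag'[of a b c u v] ab cd 4 \<open>a \<noteq> c\<close> u v by simp
        next
          case False
          then show ?thesis using diag'[of c b a v u] ab cd 4 \<open>a \<noteq> c\<close> u v by simp
        qed
        then show ?thesis using end_pt[of b] 4 by blast
      qed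
    qed
  qed
  interpret planar D by unfold_locales (rule pl)
  have left: "left_of D x y" if x: "x \<in> carrier D" and y: "y \<in> carrier D"
    and k: "fst (\<kappa> y) < fst (\<kappa> x)" "snd (\<kappa> x) < snd (\<kappa> y)" for x y
  proof -
    have nle: "\<not> x \<sqsubseteq>\<^bsub>D\<^esub> y" "\<not> y \<sqsubseteq>\<^bsub>D\<^esub> x" using le x y k by (auto simp: less_eq_prod_def)
    have m: "x \<sqinter>\<^bsub>D\<^esub> y \<in> carrier D" "x \<sqinter>\<^bsub>D\<^esub> y \<sqsubseteq>\<^bsub>D\<^esub> x" "x \<sqinter>\<^bsub>D\<^esub> y \<sqsubseteq>\<^bsub>D\<^esub> y"
      using meet_left[OF x y] meet_right[OF x y] x y by auto
    obtain b where b: "covers D (x \<sqinter>\<^bsub>D\<^esub> y) b" "b \<sqsubseteq>\<^bsub>D\<^esub> x"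
      using ex_upper_cover[OF m(1) x m(2)] m nle by metis
    obtain c where c: "covers D (x \<sqinter>\<^bsub>D\<^esub> y) c" "c \<sqsubseteq>\<^bsub>D\<^esub> y"
      using ex_upper_cover[OF m(1) y m(3)] m nle by metis
    note bb = coversD[OF b(1)] and cc = coversD[OF c(1)]
    have nb: "\<not> b \<sqsubseteq>\<^bsub>D\<^esub> y" using meet_le[OF b(2) _ x y bb(2)] bb le_antisym by blast
    then have "b \<noteq> c" using c(2) by blast
    then have inc: "incomparable D b c" using upper_covers_incomparable b(1) c(1) by blast
    have kbc: "fst (\<kappa> c) \<le> fst (\<kappa> y)" "snd (\<kappa> b) \<le> snd (\<kappa> x)" "\<not> \<kappa> b \<le> \<kappa> c" "\<not> \<kappa> c \<le> \<kappa> b"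
      "\<kappa> (x \<sqinter>\<^bsub>D\<^esub> y) \<le> \<kappa> b" "\<kappa> (x \<sqinter>\<^bsub>D\<^esub> y) \<le> \<kappa> c"
      using le[OF cc(2) y] le[OF bb(2) x] c(2) b(2) le[OF bb(2) cc(2)] le[OF cc(2) bb(2)]
        le[OF m(1) bb(2)] le[OF m(1) cc(2)] bb cc inc
      by (auto simp: less_eq_prod_def incomparable_def)
    \<comment> \<open>The branches at the meet inherit the order of \<open>x\<close> and
      \<open>y\<close>; otherwise \<open>b\<close> would lie below \<open>y\<close>.\<close>
    have "\<not> (fst (\<kappa> b) \<le> fst (\<kappa> c) \<and> snd (\<kappa> c) \<le> snd (\<kappa> b))"
    proof
      assume "fst (\<kappa> b) \<le> fst (\<kappa> c) \<and> snd (\<kappa> c) \<le> snd (\<kappa> b)"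
      then have "\<kappa> b \<le> \<kappa> y" using kbc k by (auto simp: less_eq_prod_def)
      then show False using le[OF bb(2) y] nb by blast
    qed
    then have bc: "fst (\<kappa> c) < fst (\<kappa> b)" "snd (\<kappa> b) < snd (\<kappa> c)"
      using kbc(3,4) by (auto simp: less_eq_prod_def)
    define m1 m2 where "m1 = fst (\<kappa> (x \<sqinter>\<^bsub>D\<^esub> y))" and "m2 = snd (\<kappa> (x \<sqinter>\<^bsub>D\<^esub> y))"
    have mb: "m1 \<le> fst (\<kappa> b)" "m2 \<le> snd (\<kappa> b)" "m1 \<le> fst (\<kappa> c)" "m2 \<le> snd (\<kappa> c)"
      using kbc(5,6) by (auto simp: less_eq_prod_def m1_def m2_def)
    \<comment> \<open>Seen from the meet, a vector with components \<open>p1\<close>,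
      \<open>p2\<close> has drift (p2 - p1) / (p1 + p2), which grows with its slope.\<close>
    define p1 p2 q1 q2 where "p1 = fst (\<kappa> b) - m1" and "p2 = snd (\<kappa> b) - m2"
      and "q1 = fst (\<kappa> c) - m1" and "q2 = snd (\<kappa> c) - m2"
    have pq: "0 \<le> p2" "0 \<le> q1" "q1 < p1" "p2 < q2" using mb bc by (auto simp: p1_def p2_def q1_def q2_def)
    have "drift D (x \<sqinter>\<^bsub>D\<^esub> y) b = (p2 - p1) / (p1 + p2)" "drift D (x \<sqinter>\<^bsub>D\<^esub> y) c = (q2 - q1) / (q1 + q2)"
      using pq mb by (simp_all add: drift_def pos[OF m(1)] pos[OF bb(2)] pos[OF cc(2)]
          p1_def p2_def q1_def q2_def m1_def[symmetric] m2_def[symmetric] algebra_simps)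
    moreover have "(p2 - p1) / (p1 + p2) < (q2 - q1) / (q1 + q2)"
    proof -
      have "p2 * q1 < p1 * q2"
        using mult_left_mono[of q1 p1 p2] mult_strict_right_mono[of p2 q2 p1] pq
        by (smt (verit) mult.commute)
      then show ?thesis using pq by (simp add: divide_simps algebra_simps)
    qed
    ultimately have "left_upper D (x \<sqinter>\<^bsub>D\<^esub> y) b c" using b(1) c(1) by (simp add: left_upper_def)
    then show ?thesis
      unfolding left_of_def incomparable_def using x y nle b(2) c(2) by blast
  qed
  have "left_of D x y \<longleftrightarrow> fst (\<kappa> y) < fst (\<kappa> x) \<and> snd (\<kappa> x) < snd (\<kappa> y)"
    if x: "x \<in> carrier D" and y: "y \<in> carrier D" for x y
  proof
    assume l: "left_of D x y"
    then have "\<not> \<kappa> x \<le> \<kappa> y" "\<not> \<kappa> y \<le> \<kappa> x" using left_ofD[OF l] le by auto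
    moreover have "\<not> (fst (\<kappa> x) < fst (\<kappa> y) \<and> snd (\<kappa> y) < snd (\<kappa> x))"
      using left[OF y x] left_of_asym[OF l] by blast
    ultimately show "fst (\<kappa> y) < fst (\<kappa> x) \<and> snd (\<kappa> x) < snd (\<kappa> y)"
      by (auto simp: less_eq_prod_def)
  qed (use left[OF x y] in blast)
  then show ?thesis
    unfolding represents_def using pl P bij le by blast
qed

section \<open>Elements of a represented diagram as quadrants\<close>

locale represented =
  fixes D :: "('a, 'b) diagram_scheme" (structure) and \<kappa> :: "'a \<Rightarrow> real \<times> real" and P
  assumes rep: "represents D \<kappa> P"
begin

sublocale planar D
  using rep by unfold_locales (simp add: represents_def)

lemma finite_P [simp]: "finite P" and fst_inj: "inj_on fst P" and snd_inj: "inj_on snd P"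
  using rep by (auto simp: represents_def config_def)

lemma fst_eqD: "u \<in> P \<Longrightarrow> v \<in> P \<Longrightarrow> fst u = fst v \<Longrightarrow> u = v"
  using fst_inj by (auto simp: inj_on_def)

lemma snd_eqD: "u \<in> P \<Longrightarrow> v \<in> P \<Longrightarrow> snd u = snd v \<Longrightarrow> u = v"
  using snd_inj by (auto simp: inj_on_def)

lemma ex_max: "\<exists>w\<in>P. \<forall>z\<in>P. z \<le> w"
  using rep by (auto simp: represents_def config_def)

lemma kappa_tight: "x \<in> carrier D \<Longrightarrow> \<kappa> x \<in> tight P"
  using rep bij_betwE unfolding represents_def by blast

lemma ex_kappa: "p \<in> tight P \<Longrightarrow> \<exists>x\<in>carrier D. \<kappa> x = p"
  using rep unfolding represents_def bij_betw_def by (metis imageE)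

lemma kappa_inj: "x \<in> carrier D \<Longrightarrow> y \<in> carrier D \<Longrightarrow> \<kappa> x = \<kappa> y \<Longrightarrow> x = y"
  using rep unfolding represents_def bij_betw_def inj_on_def by blast

lemma le_iff: "x \<in> carrier D \<Longrightarrow> y \<in> carrier D \<Longrightarrow> x \<sqsubseteq> y \<longleftrightarrow> \<kappa> x \<le> \<kappa> y"
  using rep unfolding represents_def by blast

lemma left_iff:
  "x \<in> carrier D \<Longrightarrow> y \<in> carrier D \<Longrightarrow>
    left_of D x y \<longleftrightarrow> fst (\<kappa> y) < fst (\<kappa> x) \<and> snd (\<kappa> x) < snd (\<kappa> y)"
  using rep unfolding represents_def by blast

definition Q :: "'a \<Rightarrow> (real \<times> real) set" where
  "Q x = quad P (\<kappa> x)"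

lemma Q_iff: "z \<in> Q x \<longleftrightarrow> z \<in> P \<and> fst (\<kappa> x) \<le> fst z \<and> snd (\<kappa> x) \<le> snd z"
  by (auto simp: Q_def quad_def less_eq_prod_def)

lemma Q_sub: "Q x \<subseteq> P"
  by (auto simp: Q_iff)

lemma finite_Q [simp]: "finite (Q x)"
  using Q_sub finite_P by (rule finite_subset)

lemma le_iff_Q: "x \<in> carrier D \<Longrightarrow> y \<in> carrier D \<Longrightarrow> x \<sqsubseteq> y \<longleftrightarrow> Q y \<subseteq> Q x"
  unfolding Q_def using le_iff tight_le_iff kappa_tight by blast

lemma Q_inj: "x \<in> carrier D \<Longrightarrow> y \<in> carrier D \<Longrightarrow> Q x = Q y \<Longrightarrow> x = y"
  by (intro le_antisym) (simp_all add: le_iff_Q)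

lemma ex_leftmost: "x \<in> carrier D \<Longrightarrow> \<exists>z\<in>Q x. fst z = fst (\<kappa> x)"
  unfolding Q_def using tightD(1) kappa_tight by blast

lemma ex_lowest: "x \<in> carrier D \<Longrightarrow> \<exists>z\<in>Q x. snd z = snd (\<kappa> x)"
  unfolding Q_def using tightD(2) kappa_tight by blast

lemma max_in_Q: "w \<in> P \<Longrightarrow> (\<And>z. z \<in> P \<Longrightarrow> z \<le> w) \<Longrightarrow> x \<in> carrier D \<Longrightarrow> w \<in> Q x"
  using ex_leftmost[of x] by (force simp: Q_iff less_eq_prod_def)

lemma ex_elem:
  assumes "S \<subseteq> P" "S \<noteq> {}"
    and "\<And>z u v. z \<in> P \<Longrightarrow> u \<in> S \<Longrightarrow> v \<in> S \<Longrightarrow> fst u \<le> fst z \<Longrightarrow> snd v \<le> snd z \<Longrightarrow> z \<in> S"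
  shows "\<exists>x\<in>carrier D. Q x = S"
proof -
  have "\<exists>p\<in>tight P. quad P p = S"
    by (rule ex_tight[OF finite_P assms(1,2)]) (erule (4) assms(3))
  then obtain p where p: "p \<in> tight P" "quad P p = S" by blast
  obtain x where "x \<in> carrier D" "\<kappa> x = p" using ex_kappa[OF p(1)] by blast
  with p(2) show ?thesis by (auto simp: Q_def)
qed

lemma ex_point: "z \<in> P \<Longrightarrow> \<exists>x\<in>carrier D. \<kappa> x = z"
  using ex_kappa point_tight by blast

lemma Q_join:
  assumes "x \<in> carrier D" "y \<in> carrier D"
  shows "Q (x \<squnion> y) = Q x \<inter> Q y"
proof
  show "Q (x \<squnion> y) \<subseteq> Q x \<inter> Q y"
    using le_iff_Q join_left[OF assms] join_right[OF assms] assms by simp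
  obtain w where "w \<in> P" "\<And>z. z \<in> P \<Longrightarrow> z \<le> w" using ex_max by blast
  then have "w \<in> Q x \<inter> Q y" using max_in_Q assms by simp
  then have "Q x \<inter> Q y \<noteq> {}" by blast
  then obtain s where s: "s \<in> carrier D" "Q s = Q x \<inter> Q y"
    using ex_elem[of "Q x \<inter> Q y"] by (fastforce simp: Q_iff)
  then have "x \<squnion> y \<sqsubseteq> s"
    using assms by (intro join_le) (auto simp: le_iff_Q)
  then show "Q x \<inter> Q y \<subseteq> Q (x \<squnion> y)" using s le_iff_Q assms by simp
qed

lemma kappa_meet:
  assumes "x \<in> carrier D" "y \<in> carrier D"
  shows "\<kappa> (x \<sqinter> y) = inf (\<kappa> x) (\<kappa> y)"
proof -
  obtain s where s: "s \<in> carrier D" "\<kappa> s = inf (\<kappa> x) (\<kappa> y)"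
    using ex_kappa[OF tight_inf[OF kappa_tight[OF assms(1)] kappa_tight[OF assms(2)]]] by blast
  have "s \<sqsubseteq> x \<sqinter> y"
    using s assms by (intro meet_le) (auto simp: le_iff)
  moreover have "x \<sqinter> y \<sqsubseteq> s"
    using s assms meet_left[OF assms] meet_right[OF assms] by (simp add: le_iff)
  ultimately show ?thesis using s assms le_antisym by fastforce
qed

text \<open>By general position the remaining points lie strictly to the right of \<open>z\<close>,
  so the corner that they determine excludes \<open>z\<close>. At least one point has to
  remain.\<close>

lemma remove_leftmost:
  assumes x: "x \<in> carrier D" and z: "z \<in> Q x" "fst z = fst (\<kappa> x)" and ne: "Q x \<noteq> {z}"
  shows "\<exists>y\<in>carrier D. Q y = Q x - {z}"
proof (rule ex_elem)
  show "Q x - {z} \<subseteq> P" "Q x - {z} \<noteq> {}" using Q_sub ne z by auto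
  fix t u v assume t: "t \<in> P" "u \<in> Q x - {z}" "v \<in> Q x - {z}" "fst u \<le> fst t" "snd v \<le> snd t"
  then have "fst z < fst u" using z fst_eqD[of u z] by (force simp: Q_iff)
  then show "t \<in> Q x - {z}" using t by (auto simp: Q_iff)
qed

lemma remove_lowest:
  assumes x: "x \<in> carrier D" and z: "z \<in> Q x" "snd z = snd (\<kappa> x)" and ne: "Q x \<noteq> {z}"
  shows "\<exists>y\<in>carrier D. Q y = Q x - {z}"
proof (rule ex_elem)
  show "Q x - {z} \<subseteq> P" "Q x - {z} \<noteq> {}" using Q_sub ne z by auto
  fix t u v assume t: "t \<in> P" "u \<in> Q x - {z}" "v \<in> Q x - {z}" "fst u \<le> fst t" "snd v \<le> snd t"
  then have "snd z < snd v" using z snd_eqD[of v z] by (force simp: Q_iff)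
  then show "t \<in> Q x - {z}" using t by (auto simp: Q_iff)
qed

text \<open>If neither the leftmost nor the lowest point is deleted, the corner stays, and with it
  the whole quadrant.\<close>

lemma removed_extremal:
  assumes x: "x \<in> carrier D" and y: "y \<in> carrier D" "z \<in> Q x" "Q y = Q x - {z}"
  shows "fst z = fst (\<kappa> x) \<or> snd z = snd (\<kappa> x)"
proof (rule ccontr)
  assume n: "\<not> ?thesis"
  obtain a where a: "a \<in> Q x" "fst a = fst (\<kappa> x)" using ex_leftmost[OF x] by blast
  obtain b where b: "b \<in> Q x" "snd b = snd (\<kappa> x)" using ex_lowest[OF x] by blast
  have "a \<in> Q y" "b \<in> Q y" using y a b n by auto
  then have "z \<in> Q y" using y(2) a b by (auto simp: Q_iff)
  with y show False by blast
qed

lemma coversI: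
  assumes "x \<in> carrier D" "y \<in> carrier D" "z \<in> Q x" "Q y = Q x - {z}"
  shows "covers D x y"
  unfolding covers_def
proof (intro conjI ballI impI)
  show "x \<sqsubseteq> y" "x \<noteq> y" using assms le_iff_Q by auto
  fix t assume t: "t \<in> carrier D" "x \<sqsubseteq> t \<and> t \<sqsubseteq> y"
  then have "Q t \<subseteq> Q x" "Q x - {z} \<subseteq> Q t" using assms le_iff_Q by auto
  then have "Q t = Q x \<or> Q t = Q y" using assms(3,4) by blast
  then show "t = x \<or> t = y" using Q_inj assms t by blast
qed (use assms in auto)

text \<open>An element strictly above \<open>x\<close> has lost the leftmost or the lowest point of
  \<open>Q x\<close>; deleting just this point gives an element in between.\<close>

lemma covers_removal:
  assumes "covers D x y"
  shows "\<exists>z\<in>Q x. Q y = Q x - {z}"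
proof -
  note xy = coversD[OF assms]
  have sub: "Q y \<subseteq> Q x" using le_iff_Q xy by blast
  have "Q x \<noteq> Q y" using Q_inj xy by blast
  obtain a where a: "a \<in> Q x" "fst a = fst (\<kappa> x)" using ex_leftmost[OF xy(1)] by blast
  obtain b where b: "b \<in> Q x" "snd b = snd (\<kappa> x)" using ex_lowest[OF xy(1)] by blast
  have "a \<notin> Q y \<or> b \<notin> Q y"
  proof (rule ccontr)
    assume "\<not> ?thesis"
    then have "Q x \<subseteq> Q y" using a b by (auto simp: Q_iff)
    then show False using sub \<open>Q x \<noteq> Q y\<close> by blast
  qed
  then have ab: "a \<in> Q y \<Longrightarrow> b \<notin> Q y" by blast
  have ne: "Q y \<noteq> {}" using ex_leftmost[OF xy(2)] by blast
  obtain z t where z: "z \<in> Q x" "z \<notin> Q y" "t \<in> carrier D" "Q t = Q x - {z}"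
  proof (cases "a \<in> Q y")
    case False
    then have "Q x \<noteq> {a}" using ne sub by auto
    then show ?thesis using remove_leftmost[OF xy(1) a] that[OF a(1) False] by blast
  next
    case True
    then have "Q x \<noteq> {b}" using ne sub ab by auto
    then show ?thesis using remove_lowest[OF xy(1) b] that[OF b(1) ab[OF True]] by blast
  qed
  then have "x \<sqsubseteq> t" "t \<sqsubseteq> y" "t \<noteq> x" using le_iff_Q xy(1,2) sub by auto
  then have "t = y" using covers_between[OF assms z(3)] by blast
  then show ?thesis using z by blast
qed

lemma covers_iff:
  assumes "x \<in> carrier D" "y \<in> carrier D"
  shows "covers D x y \<longleftrightarrow> (\<exists>z\<in>Q x. Q y = Q x - {z})"
  using coversI covers_removal assms by blast

text \<open>Only the leftmost and the lowest point of a quadrant can be deleted, so there are at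
  most two upper covers.\<close>

lemma upper_cover_cases:
  assumes a: "covers D x a" and b: "covers D x b" and c: "covers D x c" and ab: "a \<noteq> b"
  shows "c = a \<or> c = b"
proof -
  note ca = coversD[OF a] and cb = coversD[OF b] and cc = coversD[OF c]
  obtain u where u: "u \<in> Q x" "Q a = Q x - {u}" using covers_removal[OF a] by blast
  obtain v where v: "v \<in> Q x" "Q b = Q x - {v}" using covers_removal[OF b] by blast
  obtain w where w: "w \<in> Q x" "Q c = Q x - {w}" using covers_removal[OF c] by blast
  have uv: "u \<noteq> v" using u v Q_inj ca cb ab by auto
  have "w = u \<or> w = v"
    using removed_extremal[OF ca(1,2) u] removed_extremal[OF ca(1) cb(2) v]
      removed_extremal[OF ca(1) cc(2) w] fst_eqD snd_eqD u(1) v(1) w(1) Q_sub uv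
    by (smt (verit) subsetD)
  then show ?thesis using u v w Q_inj ca cb cc by auto
qed

text \<open>Larger abscissas and smaller ordinates are further to the left in the diagram. So a
  point beyond the column of the corner but below its row is an element to the left of
  \<open>x\<close>; without such points the quadrant is a half-plane.\<close>

lemma left_boundary_Q:
  assumes x: "x \<in> carrier D"
  shows "x \<in> left_boundary D \<longleftrightarrow> (\<forall>z\<in>P. fst (\<kappa> x) \<le> fst z \<longrightarrow> snd (\<kappa> x) \<le> snd z)"
proof
  assume l: "x \<in> left_boundary D"
  show "\<forall>z\<in>P. fst (\<kappa> x) \<le> fst z \<longrightarrow> snd (\<kappa> x) \<le> snd z"
  proof (intro ballI impI, rule ccontr)
    fix z assume z: "z \<in> P" "fst (\<kappa> x) \<le> fst z" "\<not> snd (\<kappa> x) \<le> snd z"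
    obtain a where a: "a \<in> Q x" "fst a = fst (\<kappa> x)" using ex_leftmost[OF x] by blast
    then have "fst z \<noteq> fst (\<kappa> x)" using fst_eqD[of z a] z by (auto simp: Q_iff)
    obtain y where "y \<in> carrier D" "\<kappa> y = z" using ex_point[OF z(1)] by blast
    then have "left_of D y x" using left_iff[of y x] x z \<open>fst z \<noteq> fst (\<kappa> x)\<close> by simp
    then show False using l left_boundary_iff by blast
  qed
next
  assume r: "\<forall>z\<in>P. fst (\<kappa> x) \<le> fst z \<longrightarrow> snd (\<kappa> x) \<le> snd z"
  have False if "left_of D y x" for y
  proof -
    have y: "y \<in> carrier D" using left_ofD that by blast
    then have "fst (\<kappa> x) < fst (\<kappa> y)" "snd (\<kappa> y) < snd (\<kappa> x)" using left_iff[of y x] that x by auto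
    moreover obtain b where "b \<in> Q y" "snd b = snd (\<kappa> y)" using ex_lowest[OF y] by blast
    ultimately show False using r by (force simp: Q_iff)
  qed
  then show "x \<in> left_boundary D" using left_boundary_iff x by blast
qed

end

section \<open>Reflection in a vertical line\<close>

definition mirror :: "('a, 'b) diagram_scheme \<Rightarrow> ('a, 'b) diagram_scheme" where
  "mirror D = D\<lparr>pos := \<lambda>x. (- fst (pos D x), snd (pos D x))\<rparr>"

lemma mirror_simps [simp]:
  "carrier (mirror D) = carrier D" "le (mirror D) = le D" "eq (mirror D) = eq D"
  "pos (mirror D) x = (- fst (pos D x), snd (pos D x))"
  by (simp_all add: mirror_def)

lemma mirror_mirror [simp]: "mirror (mirror D) = D"
  by (simp add: mirror_def)

lemma mirror_lattice_ops [simp]: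
  "join (mirror D) = join D" "meet (mirror D) = meet D"
  "least (mirror D) = least D" "greatest (mirror D) = greatest D"
  by (simp_all add: join_def meet_def Lattice.sup_def Lattice.inf_def least_def greatest_def Upper_def Lower_def fun_eq_iff)

lemma mirror_defs [simp]:
  "covers (mirror D) = covers D" "incomparable (mirror D) = incomparable D"
  "join_irreducible (mirror D) = join_irreducible D" "meet_irreducible (mirror D) = meet_irreducible D"
  "cover_preserving_grid (mirror D) = cover_preserving_grid D"
  "consecutive (mirror D) = consecutive D"
  by (auto simp: covers_def incomparable_def join_irreducible_def meet_irreducible_def
      cover_preserving_grid_def consecutive_def fun_eq_iff)

lemma lattice_mirror [simp]: "lattice (mirror D) \<longleftrightarrow> lattice D"
proof -
  have "lattice (mirror D)" if "lattice D" for D :: "('a, 'b) diagram_scheme"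
  proof -
    interpret lattice D by (rule that)
    interpret m: partial_order "mirror D"
    proof
      show "x .=\<^bsub>mirror D\<^esub> y" if "x \<sqsubseteq>\<^bsub>mirror D\<^esub> y" "y \<sqsubseteq>\<^bsub>mirror D\<^esub> x"
        "x \<in> carrier (mirror D)" "y \<in> carrier (mirror D)" for x y
        using that le_antisym[of x y] by (simp add: eq_is_equal)
      show "x \<sqsubseteq>\<^bsub>mirror D\<^esub> z" if "x \<sqsubseteq>\<^bsub>mirror D\<^esub> y" "y \<sqsubseteq>\<^bsub>mirror D\<^esub> z"
        "x \<in> carrier (mirror D)" "y \<in> carrier (mirror D)" "z \<in> carrier (mirror D)" for x y z
        using that le_trans[of x y z] by simp
    qed (simp_all add: eq_is_equal)
    show ?thesis
    proof
      show "\<exists>s. least (mirror D) s (Upper (mirror D) {x, y})"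
        if "x \<in> carrier (mirror D)" "y \<in> carrier (mirror D)" for x y
        using sup_of_two_exists[of x y] that by (simp add: Upper_def)
      show "\<exists>s. greatest (mirror D) s (Lower (mirror D) {x, y})"
        if "x \<in> carrier (mirror D)" "y \<in> carrier (mirror D)" for x y
        using inf_of_two_exists[of x y] that by (simp add: Lower_def)
    qed
  qed
  from this[of D] this[of "mirror D"] show ?thesis by auto
qed

lemma mirror_edge: "edge (mirror D) a b = (\<lambda>p. (- fst p, snd p)) ` edge D a b"
proof -
  have "linear (\<lambda>p::real \<times> real. (- fst p, snd p))" by (intro linearI) auto
  from closed_segment_linear_image[OF this, of "pos D a" "pos D b"] show ?thesis
    by (simp add: edge_def)
qed

lemma drift_mirror [simp]: "drift (mirror D) x y = - drift D x y"
  by (simp add: drift_def minus_divide_left)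

lemma left_upper_mirror [simp]: "left_upper (mirror D) x b c \<longleftrightarrow> left_upper D x c b"
  by (auto simp: left_upper_def)

lemma left_of_mirror: "lattice D \<Longrightarrow> left_of (mirror D) x y \<longleftrightarrow> left_of D y x"
  by (auto simp: left_of_def meet_def incomparable_def insert_commute)

lemma planar_mirror: "planar_diagram D \<Longrightarrow> planar_diagram (mirror D)"
proof -
  assume p: "planar_diagram D"
  let ?f = "\<lambda>p::real \<times> real. (- fst p, snd p)"
  have inj: "inj ?f" by (auto simp: inj_def prod_eq_iff)
  have pos: "pos (mirror D) = ?f \<circ> pos D" by (auto simp: fun_eq_iff)
  show ?thesis
    unfolding planar_diagram_def
  proof (intro conjI allI impI)
    show "inj_on (pos (mirror D)) (carrier (mirror D))"
      using p inj unfolding pos by (auto simp: planar_diagram_def intro!: comp_inj_on inj_on_subset[OF inj])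
    fix a b c d assume "covers (mirror D) a b \<and> covers (mirror D) c d \<and> (a, b) \<noteq> (c, d)"
    then have "edge D a b \<inter> edge D c d \<subseteq> pos D ` ({a, b} \<inter> {c, d})"
      using p by (simp add: planar_diagram_def)
    then have "?f ` (edge D a b \<inter> edge D c d) \<subseteq> ?f ` pos D ` ({a, b} \<inter> {c, d})" by (rule image_mono)
    then show "edge (mirror D) a b \<inter> edge (mirror D) c d \<subseteq> pos (mirror D) ` ({a, b} \<inter> {c, d})"
      unfolding mirror_edge pos image_Int[OF inj] image_comp[symmetric] .
  qed (use p in \<open>auto simp: planar_diagram_def\<close>)
qed

lemma boundary_mirror:
  assumes "planar_diagram D"
  shows "left_boundary (mirror D) = right_boundary D" "right_boundary (mirror D) = left_boundary D"
    "boundary (mirror D) = boundary D"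
proof -
  interpret planar D using assms by unfold_locales
  interpret m: planar "mirror D" using planar_mirror[OF assms] by unfold_locales
  have [simp]: "left_of (mirror D) x y \<longleftrightarrow> left_of D y x" for x y
    by (rule left_of_mirror) (rule lattice_axioms)
  show "left_boundary (mirror D) = right_boundary D" "right_boundary (mirror D) = left_boundary D"
    by (auto simp: left_boundary_iff right_boundary_iff m.left_boundary_iff m.right_boundary_iff)
  then show "boundary (mirror D) = boundary D" by (auto simp: boundary_def)
qed

lemma swap_le [simp]: "prod.swap p \<le> prod.swap q \<longleftrightarrow> p \<le> (q :: real \<times> real)"
  by (auto simp: less_eq_prod_def)

lemma tight_swap: "tight (prod.swap ` P) = prod.swap ` tight P"
  by (force simp: tight_def)

lemma config_swap: "config P \<Longrightarrow> config (prod.swap ` P)"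
  unfolding config_def by (auto simp: inj_on_def)

text \<open>Reflection exchanges the two coordinates. Statements about left boundaries, left corners
  and left wings thereby yield their right-hand counterparts.\<close>

lemma represents_mirror:
  assumes "represents D \<kappa> P"
  shows "represents (mirror D) (prod.swap \<circ> \<kappa>) (prod.swap ` P)"
proof -
  have l: "lattice D" using assms by (simp add: represents_def planar_diagram_def)
  have "bij_betw (prod.swap \<circ> \<kappa>) (carrier D) (prod.swap ` tight P)"
    using assms by (intro bij_betw_trans[of \<kappa> _ "tight P"] inj_on_imp_bij_betw)
      (auto simp: represents_def inj_on_def)
  then show ?thesis
    using assms planar_mirror config_swap left_of_mirror[OF l]
    by (auto simp: represents_def tight_swap)
qed

context represented
begin

lemma right_boundary_Q:
  assumes "x \<in> carrier D"
  shows "x \<in> right_boundary D \<longleftrightarrow> (\<forall>z\<in>P. snd (\<kappa> x) \<le> snd z \<longrightarrow> fst (\<kappa> x) \<le> fst z)"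
proof -
  interpret m: represented "mirror D" "prod.swap \<circ> \<kappa>" "prod.swap ` P"
    by unfold_locales (rule represents_mirror[OF rep])
  show ?thesis
    using m.left_boundary_Q[of x] boundary_mirror(1)[OF planar] assms by simp
qed

end

section \<open>Slim rectangular diagrams and rectangular configurations\<close>

definition rect_at :: "(real \<times> real) set \<Rightarrow> real \<times> real \<Rightarrow> real \<times> real \<Rightarrow> bool" where
  "rect_at P u v \<longleftrightarrow> u \<in> P \<and> v \<in> P \<and> u \<noteq> v \<and>
     (\<forall>z\<in>P. snd u \<le> snd z) \<and> (\<forall>z\<in>P. fst v \<le> fst z) \<and>
     (\<forall>z\<in>P. \<forall>t\<in>P. fst u \<le> fst z \<longrightarrow> fst z < fst t \<longrightarrow> snd z < snd t) \<and>
     (\<forall>z\<in>P. \<forall>t\<in>P. snd v \<le> snd z \<longrightarrow> snd z < snd t \<longrightarrow> fst z < fst t) \<and>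
     (\<forall>z\<in>P. fst u \<le> fst z \<longrightarrow> snd v \<le> snd z \<longrightarrow> (\<forall>w\<in>P. w \<le> z))"

lemma rect_atD:
  assumes "rect_at P u v"
  shows "u \<in> P" "v \<in> P" "u \<noteq> v" "\<And>z. z \<in> P \<Longrightarrow> snd u \<le> snd z" "\<And>z. z \<in> P \<Longrightarrow> fst v \<le> fst z"
    "\<And>z t. z \<in> P \<Longrightarrow> t \<in> P \<Longrightarrow> fst u \<le> fst z \<Longrightarrow> fst z < fst t \<Longrightarrow> snd z < snd t"
    "\<And>z t. z \<in> P \<Longrightarrow> t \<in> P \<Longrightarrow> snd v \<le> snd z \<Longrightarrow> snd z < snd t \<Longrightarrow> fst z < fst t"
    "\<And>z w. z \<in> P \<Longrightarrow> fst u \<le> fst z \<Longrightarrow> snd v \<le> snd z \<Longrightarrow> w \<in> P \<Longrightarrow> w \<le> z"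
  using assms unfolding rect_at_def by blast+

lemma rect_at_swap: "rect_at P u v \<Longrightarrow> rect_at (prod.swap ` P) (prod.swap v) (prod.swap u)"
  unfolding rect_at_def by (auto simp: inj_eq[OF inj_swap])

lemma ex_maximizer:
  fixes f :: "'a \<Rightarrow> real"
  assumes "finite S" "a \<in> S"
  shows "\<exists>z\<in>S. \<forall>w\<in>S. f w \<le> f z"
proof -
  have "Max (f ` S) \<in> f ` S" using assms by (intro Max_in) auto
  then obtain z where "z \<in> S" "f z = Max (f ` S)" by auto
  then show ?thesis using assms(1) by (intro bexI[of _ z]) auto
qed

lemma ex_minimizer:
  fixes f :: "'a \<Rightarrow> real"
  assumes "finite S" "a \<in> S"
  shows "\<exists>z\<in>S. \<forall>w\<in>S. f z \<le> f w"
  using ex_maximizer[OF assms, of "\<lambda>x. - f x"] by simp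

context represented
begin

section \<open>Half-planes, irreducible elements and boundary chains\<close>

lemma ex_left_elem:
  assumes "a \<in> P" "c \<le> fst a"
  shows "\<exists>y\<in>carrier D. Q y = {w\<in>P. c \<le> fst w}"
  by (rule ex_elem) (use assms in blast, use assms in blast, auto)

lemma ex_right_elem:
  assumes "a \<in> P" "c \<le> snd a"
  shows "\<exists>y\<in>carrier D. Q y = {w\<in>P. c \<le> snd w}"
  by (rule ex_elem) (use assms in blast, use assms in blast, auto)

lemma kappa_lower_bound:
  assumes x: "x \<in> carrier D" and "\<And>z. z \<in> P \<Longrightarrow> c \<le> fst z" "\<And>z. z \<in> P \<Longrightarrow> d \<le> snd z"
  shows "c \<le> fst (\<kappa> x)" "d \<le> snd (\<kappa> x)"
proof -
  obtain a where "a \<in> Q x" "fst a = fst (\<kappa> x)" using ex_leftmost[OF x] by blast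
  then show "c \<le> fst (\<kappa> x)" using assms(2)[of a] Q_sub by auto
  obtain b where "b \<in> Q x" "snd b = snd (\<kappa> x)" using ex_lowest[OF x] by blast
  then show "d \<le> snd (\<kappa> x)" using assms(3)[of b] Q_sub by auto
qed

lemma rep_mirror: "represented (mirror D) (prod.swap \<circ> \<kappa>) (prod.swap ` P)"
  by unfold_locales (rule represents_mirror[OF rep])

lemma greatest_iff:
  assumes "x \<in> carrier D"
  shows "greatest D x (carrier D) \<longleftrightarrow> (\<forall>w\<in>P. w \<le> \<kappa> x)"
proof
  assume g: "greatest D x (carrier D)"
  show "\<forall>w\<in>P. w \<le> \<kappa> x"
  proof
    fix w assume "w \<in> P"
    then obtain y where "y \<in> carrier D" "\<kappa> y = w" using ex_point by blast
    then show "w \<le> \<kappa> x" using g le_iff[OF _ assms] by (auto simp: greatest_def)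
  qed
next
  assume a: "\<forall>w\<in>P. w \<le> \<kappa> x"
  have "y \<sqsubseteq> x" if y: "y \<in> carrier D" for y
  proof -
    obtain w where "w \<in> Q y" using ex_leftmost[OF y] by blast
    then have "\<kappa> y \<le> w" "w \<le> \<kappa> x" using a by (auto simp: Q_def quad_def)
    then show ?thesis using le_iff[OF y assms] by simp
  qed
  then show "greatest D x (carrier D)" using assms by (simp add: greatest_def)
qed

text \<open>If the corner is not a point of \<open>P\<close>, the leftmost and the lowest point of
  the quadrant differ, and deleting either one gives two upper covers with meet
  \<open>x\<close>.\<close>

lemma meet_irreducible_point:
  assumes "meet_irreducible D x"
  shows "\<kappa> x \<in> P"
proof (rule ccontr)
  assume n: "\<kappa> x \<notin> P"
  have x: "x \<in> carrier D" using assms by (simp add: meet_irreducible_def)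
  obtain a where a: "a \<in> Q x" "fst a = fst (\<kappa> x)" using ex_leftmost[OF x] by blast
  obtain b where b: "b \<in> Q x" "snd b = snd (\<kappa> x)" using ex_lowest[OF x] by blast
  have "a \<noteq> b" using a b n Q_sub by (metis prod.collapse subsetD)
  then have ne: "Q x \<noteq> {a}" "Q x \<noteq> {b}" using a b by auto
  obtain y where y: "y \<in> carrier D" "Q y = Q x - {a}" using remove_leftmost[OF x a ne(1)] by blast
  obtain z where z: "z \<in> carrier D" "Q z = Q x - {b}" using remove_lowest[OF x b ne(2)] by blast
  have cov: "covers D x y" "covers D x z" using coversI[OF x] y z a b by blast+
  have m: "y \<sqinter> z \<in> carrier D" "y \<sqinter> z \<sqsubseteq> y" "y \<sqinter> z \<sqsubseteq> z" "x \<sqsubseteq> y \<sqinter> z"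
    using meet_left[OF y(1) z(1)] meet_right[OF y(1) z(1)] meet_le[of x y z] coversD[OF cov(1)]
      coversD[OF cov(2)] by auto
  have "\<not> y \<sqsubseteq> z" using le_iff_Q[OF y(1) z(1)] y z a b \<open>a \<noteq> b\<close> by auto
  then have "x = y \<sqinter> z" using covers_between[OF cov(1) m(1) m(4) m(2)] m(3) by metis
  then have "x = y \<or> x = z" using assms y(1) z(1) unfolding meet_irreducible_def by blast
  then show False using cov by (auto simp: covers_def)
qed

text \<open>If \<open>x\<close> is the meet of \<open>a\<close> and \<open>b\<close>, one of the
  two, say \<open>a\<close>, has its corner in the column of \<open>\<kappa> x\<close>. By general
  position \<open>\<kappa> x\<close> is then the leftmost point of \<open>Q a\<close>, which leaves
  no room for \<open>a\<close> above \<open>x\<close>.\<close>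

lemma meet_irreducibleI:
  assumes x: "x \<in> carrier D" and p: "\<kappa> x \<in> P" and w: "w \<in> P" "\<not> w \<le> \<kappa> x"
  shows "meet_irreducible D x"
  unfolding meet_irreducible_def
proof (intro conjI ballI impI)
  show "\<not> greatest D x (carrier D)" using greatest_iff[OF x] w by blast
  fix a b assume ab: "a \<in> carrier D" "b \<in> carrier D" "x = a \<sqinter> b"
  have k: "\<kappa> x = inf (\<kappa> a) (\<kappa> b)" using kappa_meet ab by simp
  show "x = a \<or> x = b"
  proof (rule ccontr)
    assume n: "\<not> ?thesis"
    then have ne: "\<kappa> x \<noteq> \<kappa> a" "\<kappa> x \<noteq> \<kappa> b" using kappa_inj x ab by auto
    obtain la where la: "la \<in> Q a" "fst la = fst (\<kappa> a)" using ex_leftmost[OF ab(1)] by blast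
    obtain lb where lb: "lb \<in> Q b" "fst lb = fst (\<kappa> b)" using ex_leftmost[OF ab(2)] by blast
    have "fst (\<kappa> x) = min (fst (\<kappa> a)) (fst (\<kappa> b))" "snd (\<kappa> x) = min (snd (\<kappa> a)) (snd (\<kappa> b))"
      using k by (simp_all add: inf_min)
    then show False
      using ne la lb fst_eqD[OF p, of la] fst_eqD[OF p, of lb] unfolding Q_iff prod_eq_iff
      by (smt (verit))
  qed
qed (use x in simp)

text \<open>Every quadrant is the intersection of two half-planes, so every element is a join of an
  element of the left and one of the right boundary chain.\<close>

lemma join_irreducible_boundary:
  assumes "join_irreducible D x"
  shows "x \<in> left_boundary D \<or> x \<in> right_boundary D"
proof -
  have x: "x \<in> carrier D" using assms by (simp add: join_irreducible_def)
  obtain a where a: "a \<in> Q x" using ex_leftmost[OF x] by blast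
  then have aP: "a \<in> P" "fst (\<kappa> x) \<le> fst a" "snd (\<kappa> x) \<le> snd a" by (auto simp: Q_iff)
  obtain y where y: "y \<in> carrier D" "Q y = {w\<in>P. fst (\<kappa> x) \<le> fst w}"
    using ex_left_elem[OF aP(1,2)] by blast
  obtain z where z: "z \<in> carrier D" "Q z = {w\<in>P. snd (\<kappa> x) \<le> snd w}"
    using ex_right_elem[OF aP(1,3)] by blast
  have "Q (y \<squnion> z) = Q x" using Q_join[OF y(1) z(1)] y z by (auto simp: Q_iff)
  then have "x = y \<squnion> z" using Q_inj x y z by simp
  then consider "x = y" | "x = z" using assms y z unfolding join_irreducible_def by blast
  then show ?thesis
  proof cases
    case 1
    then show ?thesis using y left_boundary_Q[OF x] Q_iff by blast
  next
    case 2
    then show ?thesis using z right_boundary_Q[OF x] Q_iff by blast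
  qed
qed

lemma left_boundary_Q_eq: "x \<in> left_boundary D \<Longrightarrow> Q x = {w\<in>P. fst (\<kappa> x) \<le> fst w}"
  using left_boundary_Q[of x] by (auto simp: Q_iff left_boundary_def)

lemma right_boundary_Q_eq: "x \<in> right_boundary D \<Longrightarrow> Q x = {w\<in>P. snd (\<kappa> x) \<le> snd w}"
  using right_boundary_Q[of x] by (auto simp: Q_iff right_boundary_def)

lemma left_boundary_chain:
  assumes "x \<in> left_boundary D" "y \<in> left_boundary D"
  shows "\<not> incomparable D x y"
  using assms left_boundary_Q_eq le_iff_Q unfolding incomparable_def
  by (smt (verit) Collect_mono_iff left_boundary_def mem_Collect_eq)

lemma right_boundary_chain:
  assumes "x \<in> right_boundary D" "y \<in> right_boundary D"
  shows "\<not> incomparable D x y"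
  using assms right_boundary_Q_eq le_iff_Q unfolding incomparable_def
  by (smt (verit) Collect_mono_iff right_boundary_def mem_Collect_eq)

lemma slim: "slim D"
  unfolding slim_def
proof (intro notI, elim exE conjE)
  fix x y z assume j: "join_irreducible D x" "join_irreducible D y" "join_irreducible D z"
    and i: "incomparable D x y" "incomparable D x z" "incomparable D y z"
  show False
    using join_irreducible_boundary[OF j(1)] join_irreducible_boundary[OF j(2)]
      join_irreducible_boundary[OF j(3)] i left_boundary_chain right_boundary_chain by blast
qed

text \<open>Deleting one point from \<open>Q a\<close> deletes at most that point from the
  intersection with \<open>Q c\<close>.\<close>

lemma semimodular: "semimodular D"
  unfolding semimodular_def
proof (intro allI ballI impI)
  fix a b c assume c: "c \<in> carrier D" and ab: "covers D a b"
  note abc = coversD(1,2)[OF ab]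
  obtain z where z: "z \<in> Q a" "Q b = Q a - {z}" using covers_removal[OF ab] by blast
  have j: "Q (a \<squnion> c) = Q a \<inter> Q c" "Q (b \<squnion> c) = Q b \<inter> Q c" using Q_join abc c by auto
  show "a \<squnion> c = b \<squnion> c \<or> covers D (a \<squnion> c) (b \<squnion> c)"
  proof (cases "z \<in> Q c")
    case True
    then show ?thesis using j z abc c by (intro disjI2 coversI[of _ _ z]) auto
  next
    case False
    then have "Q (a \<squnion> c) = Q (b \<squnion> c)" using j z by auto
    then show ?thesis using Q_inj abc c by simp
  qed
qed

lemma slim_semimodular: "slim_semimodular_diagram D"
  using planar slim semimodular by (simp add: slim_semimodular_diagram_def)

section \<open>Weak corners of a represented diagram\<close>

lemma ex_previous_column:
  assumes "v \<in> P" "fst v < fst t"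
  shows "\<exists>z\<in>P. fst z < fst t \<and> (\<forall>w\<in>P. fst w < fst t \<longrightarrow> fst w \<le> fst z)"
proof -
  have "\<exists>z\<in>{z\<in>P. fst z < fst t}. \<forall>w\<in>{z\<in>P. fst z < fst t}. fst w \<le> fst z"
    by (rule ex_maximizer[of _ v]) (use assms in auto)
  then show ?thesis by blast
qed

text \<open>A left weak corner is a descent of the sequence of points: \<open>z\<close>, in the
  column just before \<open>t\<close>, is higher than \<open>t\<close>. An element strictly below
  \<open>x\<close> has a point left of \<open>t\<close> in its quadrant, hence also
  \<open>z\<close>, so two such elements cannot have the join \<open>x\<close>.\<close>

lemma descent_weak_corner:
  assumes x: "x \<in> carrier D" "\<kappa> x = t" and t: "t \<in> P" and z: "z \<in> P" "fst z < fst t" "snd t < snd z"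
    and prev: "\<And>w. w \<in> P \<Longrightarrow> fst w < fst t \<Longrightarrow> fst w \<le> fst z"
    and low: "\<And>w. w \<in> P \<Longrightarrow> fst t \<le> fst w \<Longrightarrow> snd t \<le> snd w"
  shows "x \<in> left_boundary D" "weak_corner D x"
proof -
  show lb: "x \<in> left_boundary D" using left_boundary_Q[OF x(1)] x(2) low by simp
  have Qx: "Q x = {w\<in>P. fst t \<le> fst w}" using left_boundary_Q_eq[OF lb] x(2) by simp
  obtain y where y: "y \<in> carrier D" "\<kappa> y = z" using ex_point z(1) by blast
  have inc: "incomparable D x y"
    using le_iff[OF x(1) y(1)] le_iff[OF y(1) x(1)] x y z by (auto simp: incomparable_def less_eq_prod_def)
  have above: "z \<in> Q a" if a: "a \<in> carrier D" "a \<sqsubseteq> x" "a \<noteq> x" for a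
  proof -
    have "Q x \<subseteq> Q a" "Q a \<noteq> Q x" using le_iff_Q a x Q_inj by auto
    then obtain w where w: "w \<in> Q a" "w \<notin> Q x" by blast
    then have "fst (\<kappa> a) \<le> fst w" "fst w < fst t" "w \<in> P" by (auto simp: Q_iff Qx)
    moreover have "t \<in> Q a" using \<open>Q x \<subseteq> Q a\<close> t Qx by auto
    ultimately show ?thesis using prev[of w] z by (auto simp: Q_iff)
  qed
  have "join_irreducible D x"
    unfolding join_irreducible_def
  proof (intro conjI ballI impI)
    show "\<not> least D x (carrier D)" using inc y by (auto simp: least_def incomparable_def)
    fix a b assume ab: "a \<in> carrier D" "b \<in> carrier D" "x = a \<squnion> b"
    show "x = a \<or> x = b"
    proof (rule ccontr)
      assume "\<not> ?thesis"
      then have "z \<in> Q a \<inter> Q b"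
        using above ab join_left[OF ab(1,2)] join_right[OF ab(1,2)] by auto
      then have "z \<in> Q x" using Q_join ab by auto
      then show False using z Qx by auto
    qed
  qed (rule x)
  moreover have "meet_irreducible D x"
    using meet_irreducibleI[OF x(1) _ z(1)] x t z by (auto simp: less_eq_prod_def)
  ultimately show "weak_corner D x"
    using lb inc y unfolding weak_corner_def boundary_def by blast
qed

text \<open>Any other candidate \<open>y\<close> has its point in a column beyond \<open>u\<close>,
  where the points increase. So \<open>y\<close> is the join of the half-plane starting one column
  earlier and the half-plane above its own row. Being join-irreducible it equals the latter; then
  its point is above \<open>v\<close> as well as to the right of \<open>u\<close>, so it is the
  top.\<close>

lemma left_weak_corners:
  assumes r: "rect_at P u v" and x: "x \<in> carrier D" "\<kappa> x = u"
  shows "{x \<in> left_boundary D. weak_corner D x} = {x}"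
proof -
  note r = rect_atD[OF r]
  have vu: "fst v < fst u" using r(5)[OF r(1)] fst_eqD[OF r(1,2)] r(3) by force
  obtain z where z: "z \<in> P" "fst z < fst u" "\<And>w. w \<in> P \<Longrightarrow> fst w < fst u \<Longrightarrow> fst w \<le> fst z"
    using ex_previous_column[OF r(2) vu] by blast
  have "snd u < snd z" using r(4)[OF z(1)] snd_eqD[OF r(1) z(1)] z(2) by force
  then have "x \<in> left_boundary D" "weak_corner D x"
    using descent_weak_corner[OF x r(1) z(1,2) _ z(3)] r(4) by auto
  moreover have "y = x" if y: "y \<in> left_boundary D" "weak_corner D y" for y
  proof (rule ccontr)
    assume "y \<noteq> x"
    have yc: "y \<in> carrier D" using y by (simp add: left_boundary_def)
    have mi: "meet_irreducible D y" and ji: "join_irreducible D y" using y by (auto simp: weak_corner_def)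
    define t where "t = \<kappa> y"
    have t: "t \<in> P" using meet_irreducible_point[OF mi] by (simp add: t_def)
    have tu: "t \<noteq> u" using kappa_inj[OF yc x(1)] \<open>y \<noteq> x\<close> x by (auto simp: t_def)
    have low: "snd t \<le> snd w" if "w \<in> P" "fst t \<le> fst w" for w
      using left_boundary_Q[OF yc] y(1) that by (auto simp: t_def)
    have "\<not> fst t \<le> fst u" using low[OF r(1)] r(4)[OF t] snd_eqD[OF t r(1)] tu by force
    then have ut: "fst u < fst t" by simp
    obtain s where s: "s \<in> P" "fst s < fst t" "\<And>w. w \<in> P \<Longrightarrow> fst w < fst t \<Longrightarrow> fst w \<le> fst s"
      using ex_previous_column[OF r(1) ut] by blast
    have st: "snd s < snd t" using r(6)[OF s(1) t s(3)[OF r(1) ut] s(2)] .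
    obtain a where a: "a \<in> carrier D" "Q a = {w\<in>P. fst s \<le> fst w}"
      using ex_left_elem[OF s(1) order_refl] by blast
    obtain b where b: "b \<in> carrier D" "Q b = {w\<in>P. snd t \<le> snd w}"
      using ex_right_elem[OF t order_refl] by blast
    have Qy: "Q y = {w\<in>P. fst t \<le> fst w}" using left_boundary_Q_eq[OF y(1)] by (simp add: t_def)
    have "Q (a \<squnion> b) = Q y"
      unfolding Q_join[OF a(1) b(1)] a b Qy
    proof (intro equalityI subsetI)
      fix w assume w: "w \<in> {w \<in> P. fst s \<le> fst w} \<inter> {w \<in> P. snd t \<le> snd w}"
      then have "w \<noteq> s" using st by auto
      then have "fst s < fst w" using w fst_eqD[of w s] s(1) by force
      then have "\<not> fst w < fst t" using s(3)[of w] w by force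
      then show "w \<in> {w \<in> P. fst t \<le> fst w}" using w by simp
    qed (use low s in auto)
    then have "y = a \<squnion> b" using Q_inj yc a b by simp
    moreover have "s \<in> Q a" "s \<notin> Q y" using Qy a(2) s by auto
    then have "y \<noteq> a" by blast
    moreover have "y \<noteq> b"
    proof
      assume "y = b"
      have "v \<notin> Q b" using \<open>y = b\<close> Qy vu ut by auto
      then have "\<not> snd t \<le> snd v" using b r(2) by auto
      then have "\<forall>w\<in>P. w \<le> t" using r(8)[OF t] ut by auto
      then have "greatest D y (carrier D)" using greatest_iff[OF yc] by (simp add: t_def)
      then show False using mi by (simp add: meet_irreducible_def)
    qed
    ultimately show False using ji a b unfolding join_irreducible_def by blast
  qed
  ultimately show ?thesis by blast
qed

end

lemma weak_corner_mirror: "planar_diagram D \<Longrightarrow> weak_corner (mirror D) = weak_corner D"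
  by (simp add: weak_corner_def fun_eq_iff boundary_mirror(3))

context represented
begin

lemma rect_at_rectangular:
  assumes "rect_at P u v"
  shows "slim_rectangular_diagram D"
proof -
  note r = rect_atD[OF assms]
  interpret m: represented "mirror D" "prod.swap \<circ> \<kappa>" "prod.swap ` P" by (rule rep_mirror)
  obtain x where x: "x \<in> carrier D" "\<kappa> x = u" using ex_point r(1) by blast
  obtain y where y: "y \<in> carrier D" "\<kappa> y = v" using ex_point r(2) by blast
  have "{x \<in> left_boundary D. weak_corner D x} = {x}" using left_weak_corners[OF assms x] .
  moreover have "{x \<in> right_boundary D. weak_corner D x} = {y}"
    using m.left_weak_corners[OF rect_at_swap[OF assms], of y] y boundary_mirror(1)[OF planar]
      weak_corner_mirror[OF planar] by simp
  moreover have "complementary D x y"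
    unfolding complementary_def
  proof
    have k: "\<kappa> (x \<sqinter> y) = inf u v" using kappa_meet x y by simp
    have "x \<sqinter> y \<sqsubseteq> z" if z: "z \<in> carrier D" for z
    proof -
      have "fst v \<le> fst (\<kappa> z)" "snd u \<le> snd (\<kappa> z)" using kappa_lower_bound[OF z] r(4,5) by blast+
      then have "\<kappa> (x \<sqinter> y) \<le> \<kappa> z" unfolding k by (simp add: less_eq_prod_def inf_min min_le_iff_disj)
      then show ?thesis using le_iff x y z by simp
    qed
    then show "least D (x \<sqinter> y) (carrier D)" using x y by (simp add: least_def)
    have "Q (x \<squnion> y) = Q x \<inter> Q y" using Q_join x y by simp
    moreover obtain a where a: "a \<in> Q (x \<squnion> y)" "fst a = fst (\<kappa> (x \<squnion> y))" using ex_leftmost[of "x \<squnion> y"] x y by auto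
    moreover obtain b where b: "b \<in> Q (x \<squnion> y)" "snd b = snd (\<kappa> (x \<squnion> y))" using ex_lowest[of "x \<squnion> y"] x y by auto
    ultimately have "\<forall>w\<in>P. w \<le> a" "\<forall>w\<in>P. w \<le> b" using r(8) x y by (auto simp: Q_iff)
    then have "\<forall>w\<in>P. w \<le> \<kappa> (x \<squnion> y)" using a(2) b(2) by (auto simp: less_eq_prod_def)
    then show "greatest D (x \<squnion> y) (carrier D)" using greatest_iff x y by simp
  qed
  ultimately show ?thesis
    unfolding slim_rectangular_diagram_def rectangular_def using slim_semimodular by blast
qed

text \<open>A descent to the right of \<open>u\<close> would produce a second left weak corner.
  Consider the points that are lowest in their half-plane and have a higher point between
  \<open>u\<close> and themselves: the leftmost of them is directly preceded by a higher
  point.\<close>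

lemma increasing_right_of_corner:
  assumes u: "u \<in> P" "\<And>z. z \<in> P \<Longrightarrow> snd u \<le> snd z"
    and unique: "\<And>x y. x \<in> left_boundary D \<Longrightarrow> y \<in> left_boundary D \<Longrightarrow> weak_corner D x \<Longrightarrow> weak_corner D y \<Longrightarrow> x = y"
    and x: "x \<in> left_boundary D" "weak_corner D x" "\<kappa> x = u"
    and zt: "z \<in> P" "t \<in> P" "fst u \<le> fst z" "fst z < fst t"
  shows "snd z < snd t"
proof (rule ccontr)
  assume n: "\<not> snd z < snd t"
  define I where "I = {t\<in>P. (\<exists>z\<in>P. fst u \<le> fst z \<and> fst z < fst t \<and> snd t < snd z) \<and>
    (\<forall>w\<in>P. fst t \<le> fst w \<longrightarrow> snd t \<le> snd w)}"
  let ?T = "{w\<in>P. fst z < fst w}"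
  obtain t0 where t0: "t0 \<in> ?T" and t0min: "\<And>w. w \<in> ?T \<Longrightarrow> snd t0 \<le> snd w"
    using ex_minimizer[of ?T t snd] zt by auto
  have "snd t < snd z" using n snd_eqD[OF zt(1,2)] zt(4) by force
  then have "snd t0 < snd z" using t0min[of t] zt by auto
  then have "t0 \<in> I" using t0 t0min zt unfolding I_def by fastforce
  moreover have "finite I" by (simp add: I_def)
  ultimately obtain s where s: "s \<in> I" and smin: "\<And>w. w \<in> I \<Longrightarrow> fst s \<le> fst w"
    using ex_minimizer[of I t0 fst] by auto
  obtain a where a: "a \<in> P" "fst u \<le> fst a" "fst a < fst s" "snd s < snd a"
    and sP: "s \<in> P" and slow: "\<And>w. w \<in> P \<Longrightarrow> fst s \<le> fst w \<Longrightarrow> snd s \<le> snd w"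
    using s unfolding I_def by blast
  obtain b where b: "b \<in> P" "fst b < fst s" "\<And>w. w \<in> P \<Longrightarrow> fst w < fst s \<Longrightarrow> fst w \<le> fst b"
    using ex_previous_column[OF a(1,3)] by blast
  \<comment> \<open>Otherwise \<open>b\<close> would have both properties of \<open>s\<close>, in an
    earlier column.\<close>
  have "snd s < snd b"
  proof (rule ccontr)
    assume nb: "\<not> snd s < snd b"
    have ab: "fst a \<le> fst b" using b(3) a by blast
    moreover have "a \<noteq> b" using nb a by auto
    ultimately have "fst a < fst b" using fst_eqD[OF a(1) b(1)] by force
    moreover have "snd b \<le> snd w" if w: "w \<in> P" "fst b \<le> fst w" for w
    proof (cases "w = b")
      case False
      then have "fst b < fst w" using w fst_eqD[OF b(1) w(1)] by force
      then have "fst s \<le> fst w" using b(3)[OF w(1)] by force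
      then show ?thesis using slow[OF w(1)] nb by simp
    qed simp
    ultimately have "b \<in> I" unfolding I_def using a b nb by fastforce
    then show False using smin[of b] b(2) by simp
  qed
  obtain y where y: "y \<in> carrier D" "\<kappa> y = s" using ex_point sP by blast
  have "y \<in> left_boundary D" "weak_corner D y"
    using descent_weak_corner[OF y sP b(1,2) \<open>snd s < snd b\<close> b(3) slow] by auto
  then have "x = y" using unique x by blast
  then show False using x(3) y(2) a by auto
qed

lemma rectangular_rect_at:
  assumes "rectangular D"
  shows "\<exists>u v. rect_at P u v"
proof -
  interpret m: represented "mirror D" "prod.swap \<circ> \<kappa>" "prod.swap ` P" by (rule rep_mirror)
  obtain cl cr where cl: "{x \<in> left_boundary D. weak_corner D x} = {cl}"
    and cr: "{x \<in> right_boundary D. weak_corner D x} = {cr}" and cm: "complementary D cl cr"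
    using assms unfolding rectangular_def by blast
  have clu: "\<And>a. a \<in> left_boundary D \<Longrightarrow> weak_corner D a \<Longrightarrow> a = cl"
    and cru: "\<And>a. a \<in> right_boundary D \<Longrightarrow> weak_corner D a \<Longrightarrow> a = cr"
    using cl cr by blast+
  have cl': "cl \<in> carrier D" "weak_corner D cl" and cr': "cr \<in> carrier D" "weak_corner D cr"
    using cl cr by (auto simp: left_boundary_def right_boundary_def)
  obtain w0 where w0: "w0 \<in> P" using ex_max by blast
  obtain u where u: "u \<in> P" and umin: "\<And>z. z \<in> P \<Longrightarrow> snd u \<le> snd z"
    using ex_minimizer[OF finite_P w0, of snd] by auto
  obtain v where v: "v \<in> P" and vmin: "\<And>z. z \<in> P \<Longrightarrow> fst v \<le> fst z"
    using ex_minimizer[OF finite_P w0, of fst] by auto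
  \<comment> \<open>If the lowest point were also the leftmost, its element would be the bottom,
    hence the top or meet-irreducible. But the bottom is the meet of the two corners, and these
    differ from it, being incomparable to some element.\<close>
  have uv: "u \<noteq> v"
  proof
    assume "u = v"
    obtain b where b: "b \<in> carrier D" "\<kappa> b = u" using ex_point u by blast
    have bot: "b \<sqsubseteq> x" if x: "x \<in> carrier D" for x
    proof -
      have "\<kappa> b \<le> \<kappa> x"
        using kappa_lower_bound[OF x vmin umin] b \<open>u = v\<close> by (simp add: less_eq_prod_def)
      then show ?thesis using le_iff b x by simp
    qed
    have "cl \<sqinter> cr \<sqsubseteq> b" using cm b by (simp add: complementary_def least_def)
    then have bm: "b = cl \<sqinter> cr" using bot[of "cl \<sqinter> cr"] b cl'(1) cr'(1) le_antisym by simp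
    have ncl: "b \<noteq> cl" using cl' bot by (auto simp: weak_corner_def incomparable_def)
    have ncr: "b \<noteq> cr" using cr' bot by (auto simp: weak_corner_def incomparable_def)
    obtain w where "w \<in> P" "\<not> w \<le> \<kappa> b"
    proof (rule ccontr)
      assume "\<not> thesis"
      then have "greatest D b (carrier D)" using greatest_iff[OF b(1)] that by blast
      then have "b = cl" using bot[OF cl'(1)] cl'(1) b le_antisym by (auto simp: greatest_def)
      then show False using ncl by simp
    qed
    then have "meet_irreducible D b" using meet_irreducibleI[OF b(1)] b(2) u by blast
    then show False using bm ncl ncr cl'(1) cr'(1) unfolding meet_irreducible_def by blast
  qed
  have lt1: "fst v < fst u" using vmin[OF u] fst_eqD[OF u v] uv by force
  have lt2: "snd u < snd v" using umin[OF v] snd_eqD[OF u v] uv by force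
  obtain x where x: "x \<in> carrier D" "\<kappa> x = u" using ex_point u by blast
  obtain y where y: "y \<in> carrier D" "\<kappa> y = v" using ex_point v by blast
  obtain z where z: "z \<in> P" "fst z < fst u" "\<And>w. w \<in> P \<Longrightarrow> fst w < fst u \<Longrightarrow> fst w \<le> fst z"
    using ex_previous_column[OF v lt1] by blast
  have "snd u < snd z" using umin[OF z(1)] snd_eqD[OF u z(1)] z(2) by force
  then have xw: "x \<in> left_boundary D" "weak_corner D x"
    using descent_weak_corner[OF x u z(1,2) _ z(3)] umin by auto
  have "\<exists>z\<in>prod.swap ` P. fst z < fst (prod.swap v) \<and> (\<forall>w\<in>prod.swap ` P. fst w < fst (prod.swap v) \<longrightarrow> fst w \<le> fst z)"
    by (rule m.ex_previous_column[of "prod.swap u"]) (use u lt2 in auto)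
  then obtain z' where z': "z' \<in> P" "snd z' < snd v" "\<And>w. w \<in> P \<Longrightarrow> snd w < snd v \<Longrightarrow> snd w \<le> snd z'"
    by auto
  have "fst v < fst z'" using vmin[OF z'(1)] fst_eqD[OF v z'(1)] z'(2) by force
  then have yw: "y \<in> left_boundary (mirror D)" "weak_corner (mirror D) y"
    using m.descent_weak_corner[of y "prod.swap v" "prod.swap z'"] y v z' vmin by auto
  have yw': "y \<in> right_boundary D" "weak_corner D y"
    using yw boundary_mirror(1)[OF planar] weak_corner_mirror[OF planar] by auto
  have eqs: "cl = x" "cr = y" using cl cr xw yw' by auto
  have inc1: "snd z < snd t" if "z \<in> P" "t \<in> P" "fst u \<le> fst z" "fst z < fst t" for z t
  proof (rule increasing_right_of_corner[of u x])
    fix a b assume "a \<in> left_boundary D" "b \<in> left_boundary D" "weak_corner D a" "weak_corner D b"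
    then show "a = b" using clu by metis
  qed (use that u umin x xw in auto)
  have inc2: "fst z < fst t" if "z \<in> P" "t \<in> P" "snd v \<le> snd z" "snd z < snd t" for z t
  proof -
    have "snd (prod.swap z) < snd (prod.swap t)"
    proof (rule m.increasing_right_of_corner[of "prod.swap v" y])
      fix a b assume "a \<in> left_boundary (mirror D)" "b \<in> left_boundary (mirror D)"
        "weak_corner (mirror D) a" "weak_corner (mirror D) b"
      then show "a = b" using cru boundary_mirror(1)[OF planar] weak_corner_mirror[OF planar] by metis
    qed (use that v vmin y yw in auto)
    then show ?thesis by simp
  qed
  \<comment> \<open>The join of the two corners has as its quadrant the points to the right of
    \<open>u\<close> and above \<open>v\<close>. As the corners are complementary, this join is the
    top.\<close>
  have ne: "w \<le> z" if z: "z \<in> P" "fst u \<le> fst z" "snd v \<le> snd z" and w: "w \<in> P" for z w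
  proof -
    have "Q (x \<squnion> y) = {z\<in>P. fst u \<le> fst z \<and> snd v \<le> snd z}"
      using Q_join[OF x(1) y(1)] left_boundary_Q_eq[OF xw(1)] right_boundary_Q_eq[OF yw'(1)] x y by auto
    then have zq: "z \<in> Q (x \<squnion> y)" using z by simp
    have "greatest D (x \<squnion> y) (carrier D)" using cm eqs by (simp add: complementary_def)
    then have "w \<le> \<kappa> (x \<squnion> y)" using greatest_iff x y w by simp
    then show ?thesis using zq by (auto simp: Q_def quad_def)
  qed
  have "rect_at P u v"
    unfolding rect_at_def using u v uv umin vmin inc1 inc2 ne by blast
  then show ?thesis by blast
qed

end

section \<open>The representation theorem\<close>

lemma slim_mirror [simp]: "slim (mirror D) = slim D"
  by (simp add: slim_def)

lemma semimodular_mirror [simp]: "semimodular (mirror D) = semimodular D"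
  by (simp add: semimodular_def)

text \<open>Real-valued so that ranks can serve as coordinates. The left boundary is a chain, hence
  comparing these cardinalities amounts to comparing lower segments.\<close>

definition lrank :: "('a, 'b) diagram_scheme \<Rightarrow> 'a \<Rightarrow> real" where
  "lrank D x = real (card {c \<in> left_boundary D. c \<sqsubseteq>\<^bsub>D\<^esub> x})"

context planar
begin

lemma ex_minimal_with:
  assumes "x \<in> carrier D" "R x"
  obtains m where "m \<in> carrier D" "R m" "\<And>z. z \<in> carrier D \<Longrightarrow> R z \<Longrightarrow> z \<sqsubseteq> m \<Longrightarrow> z = m"
proof -
  have "{z \<in> carrier D. R z} \<subseteq> carrier D" "{z \<in> carrier D. R z} \<noteq> {}" using assms by auto
  from ex_minimal[OF this] show ?thesis using that by auto
qed

lemma ex_maximal_with: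
  assumes "x \<in> carrier D" "R x"
  obtains m where "m \<in> carrier D" "R m" "\<And>z. z \<in> carrier D \<Longrightarrow> R z \<Longrightarrow> m \<sqsubseteq> z \<Longrightarrow> z = m"
proof -
  have "{z \<in> carrier D. R z} \<subseteq> carrier D" "{z \<in> carrier D. R z} \<noteq> {}" using assms by auto
  from ex_maximal[OF this] show ?thesis using that by auto
qed

section \<open>Ranks along the left boundary chain\<close>

lemma left_boundary_carrier: "c \<in> left_boundary D \<Longrightarrow> c \<in> carrier D"
  by (simp add: left_boundary_def)

lemma finite_left_boundary [simp]: "finite (left_boundary D)"
  by (rule finite_subset[of _ "carrier D"]) (auto simp: left_boundary_def)

lemma left_boundary_comparable:
  assumes "c \<in> left_boundary D" "d \<in> left_boundary D"
  shows "c \<sqsubseteq> d \<or> d \<sqsubseteq> c"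
  using assms left_of_total[of c d] left_boundary_iff unfolding incomparable_def by blast

lemma lower_segments_nested:
  assumes "x \<in> carrier D" "y \<in> carrier D"
  shows "{c \<in> left_boundary D. c \<sqsubseteq> x} \<subseteq> {c \<in> left_boundary D. c \<sqsubseteq> y} \<or>
    {c \<in> left_boundary D. c \<sqsubseteq> y} \<subseteq> {c \<in> left_boundary D. c \<sqsubseteq> x}"
proof (rule ccontr)
  assume "\<not> ?thesis"
  then obtain c d where "c \<in> left_boundary D" "c \<sqsubseteq> x" "\<not> c \<sqsubseteq> y"
    "d \<in> left_boundary D" "d \<sqsubseteq> y" "\<not> d \<sqsubseteq> x" by blast
  then show False
    using left_boundary_comparable[of c d] le_trans[of c d y] le_trans[of d c x]
      left_boundary_carrier assms by blast
qed

lemma lrank_le_iff: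
  assumes "x \<in> carrier D" "y \<in> carrier D"
  shows "lrank D x \<le> lrank D y \<longleftrightarrow> (\<forall>c\<in>left_boundary D. c \<sqsubseteq> x \<longrightarrow> c \<sqsubseteq> y)"
proof
  assume le: "lrank D x \<le> lrank D y"
  have "{c \<in> left_boundary D. c \<sqsubseteq> x} \<subseteq> {c \<in> left_boundary D. c \<sqsubseteq> y}"
    using lower_segments_nested[OF assms]
  proof
    assume s: "{c \<in> left_boundary D. c \<sqsubseteq> y} \<subseteq> {c \<in> left_boundary D. c \<sqsubseteq> x}"
    have "{c \<in> left_boundary D. c \<sqsubseteq> y} = {c \<in> left_boundary D. c \<sqsubseteq> x}"
      by (rule card_seteq[OF _ s]) (use le in \<open>auto simp: lrank_def\<close>)
    then show ?thesis by blast
  qed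
  then show "\<forall>c\<in>left_boundary D. c \<sqsubseteq> x \<longrightarrow> c \<sqsubseteq> y" by blast
next
  assume "\<forall>c\<in>left_boundary D. c \<sqsubseteq> x \<longrightarrow> c \<sqsubseteq> y"
  then show "lrank D x \<le> lrank D y"
    unfolding lrank_def by (auto intro!: card_mono)
qed

lemma lrank_mono:
  assumes "x \<in> carrier D" "y \<in> carrier D" "x \<sqsubseteq> y"
  shows "lrank D x \<le> lrank D y"
  unfolding lrank_le_iff[OF assms(1,2)]
proof (intro ballI impI)
  fix c assume "c \<in> left_boundary D" "c \<sqsubseteq> x"
  then show "c \<sqsubseteq> y"
    using le_trans[OF _ assms(3) _ assms(1,2)] left_boundary_carrier by simp
qed

text \<open>A left boundary element below \<open>y\<close> but not below \<open>x\<close> would have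
  \<open>x\<close> on its left.\<close>

lemma lrank_left_of:
  assumes "left_of D x y"
  shows "lrank D y \<le> lrank D x"
proof -
  note xy = left_ofD[OF assms]
  have "c \<sqsubseteq> x" if c: "c \<in> left_boundary D" "c \<sqsubseteq> y" for c
    using left_of_antimono_right[OF assms left_boundary_carrier[OF c(1)] c(2)] c(1) left_boundary_iff by blast
  then show ?thesis using lrank_le_iff[OF xy(2,1)] by blast
qed

lemma lrank_meet:
  assumes "x \<in> carrier D" "y \<in> carrier D"
  shows "lrank D (x \<sqinter> y) = min (lrank D x) (lrank D y)"
proof -
  have m: "x \<sqinter> y \<in> carrier D" "x \<sqinter> y \<sqsubseteq> x" "x \<sqinter> y \<sqsubseteq> y"
    using meet_left[OF assms] meet_right[OF assms] assms by auto
  have "c \<sqsubseteq> x \<sqinter> y" if "c \<in> left_boundary D" "c \<sqsubseteq> x" "c \<sqsubseteq> y" for c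
    using meet_le[OF that(2,3) assms] left_boundary_carrier[OF that(1)] by simp
  then have "lrank D x \<le> lrank D (x \<sqinter> y) \<or> lrank D y \<le> lrank D (x \<sqinter> y)"
    using lower_segments_nested[OF assms]
    unfolding lrank_le_iff[OF assms(1) m(1)] lrank_le_iff[OF assms(2) m(1)] by blast
  then show ?thesis using lrank_mono[OF m(1) assms(1) m(2)] lrank_mono[OF m(1) assms(2) m(3)] by linarith
qed

lemma ex_join_irreducible:
  assumes "x \<in> carrier D" "y \<in> carrier D" "\<not> x \<sqsubseteq> y"
  shows "\<exists>j. join_irreducible D j \<and> j \<sqsubseteq> x \<and> \<not> j \<sqsubseteq> y"
proof -
  obtain j where j: "j \<in> carrier D" "j \<sqsubseteq> x \<and> \<not> j \<sqsubseteq> y"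
    and min: "\<And>z. z \<in> carrier D \<Longrightarrow> z \<sqsubseteq> x \<and> \<not> z \<sqsubseteq> y \<Longrightarrow> z \<sqsubseteq> j \<Longrightarrow> z = j"
    using ex_minimal_with[of x "\<lambda>z. z \<sqsubseteq> x \<and> \<not> z \<sqsubseteq> y"] assms by (metis le_refl)
  have "join_irreducible D j"
    unfolding join_irreducible_def
  proof (intro conjI ballI impI)
    show "\<not> least D j (carrier D)" using j assms by (auto simp: least_def)
    fix a b assume ab: "a \<in> carrier D" "b \<in> carrier D" "j = a \<squnion> b"
    have l: "a \<sqsubseteq> j" "b \<sqsubseteq> j" using join_left[OF ab(1,2)] join_right[OF ab(1,2)] ab(3) by auto
    have "\<not> (a \<sqsubseteq> y \<and> b \<sqsubseteq> y)"
    proof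
      assume "a \<sqsubseteq> y \<and> b \<sqsubseteq> y"
      then have "a \<squnion> b \<sqsubseteq> y" using join_le[of a y b] ab assms(2) by auto
      then show False using ab(3) j(2) by simp
    qed
    moreover have "a \<sqsubseteq> x" "b \<sqsubseteq> x"
      using le_trans[OF l(1), of x] le_trans[OF l(2), of x] ab(1,2) j assms(1) by simp_all
    ultimately show "j = a \<or> j = b"
      using min[OF ab(1) _ l(1)] min[OF ab(2) _ l(2)] by auto
  qed (rule j)
  with j show ?thesis by blast
qed

text \<open>If there are elements on both sides of \<open>x\<close>, then there are join-irreducible
  ones on both sides, and together with \<open>x\<close> these form an antichain.\<close>

lemma slim_join_irreducible:
  assumes "slim D" "join_irreducible D x"
  shows "x \<in> left_boundary D \<or> x \<in> right_boundary D"
proof (rule ccontr)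
  assume n: "\<not> ?thesis"
  have x: "x \<in> carrier D" using assms by (simp add: join_irreducible_def)
  obtain y z where y: "left_of D y x" and z: "left_of D x z"
    using n x left_boundary_iff right_boundary_iff by blast
  obtain j where j: "join_irreducible D j" "j \<sqsubseteq> y" "\<not> j \<sqsubseteq> x"
    using ex_join_irreducible[OF left_ofD(1)[OF y] x left_ofD(3)[OF y]] by blast
  obtain k where k: "join_irreducible D k" "k \<sqsubseteq> z" "\<not> k \<sqsubseteq> x"
    using ex_join_irreducible[OF left_ofD(2)[OF z] x left_ofD(4)[OF z]] by blast
  have jx: "left_of D j x"
    using left_of_antimono_left[OF y _ j(2,3)] j(1) by (simp add: join_irreducible_def)
  have xk: "left_of D x k"
    using left_of_antimono_right[OF z _ k(2,3)] k(1) by (simp add: join_irreducible_def)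
  have "incomparable D j x" "incomparable D x k" "incomparable D j k"
    using jx xk left_of_trans[OF jx xk] left_ofD by (auto simp: incomparable_def)
  then show False using assms j(1) k(1) unfolding slim_def by blast
qed

lemma meet_irreducible_cover:
  assumes "meet_irreducible D m" "covers D m a" "covers D m b"
  shows "a = b"
proof (rule ccontr)
  assume ab: "a \<noteq> b"
  note a = coversD[OF assms(2)] and b = coversD[OF assms(3)]
  have m: "a \<sqinter> b \<in> carrier D" "a \<sqinter> b \<sqsubseteq> a" "a \<sqinter> b \<sqsubseteq> b" "m \<sqsubseteq> a \<sqinter> b"
    using meet_left[OF a(2) b(2)] meet_right[OF a(2) b(2)] meet_le[OF a(3) b(3) a(2) b(2)] a b by auto
  have "\<not> a \<sqsubseteq> b" using upper_covers_incomparable[OF assms(2,3) ab] by (simp add: incomparable_def)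
  then have "m = a \<sqinter> b" using covers_between[OF assms(2) m(1,4,2)] m(3) by metis
  then show False using assms a b unfolding meet_irreducible_def by blast
qed

text \<open>Among the elements to the left of \<open>z\<close>, one with the fewest elements on its
  own left has none there.\<close>

lemma ex_left_boundary_left_of:
  assumes "left_of D y z"
  shows "\<exists>w\<in>left_boundary D. left_of D w z"
proof -
  have fin': "finite {w. left_of D w x}" for x
    by (rule finite_subset[of _ "carrier D"]) (use left_ofD in auto)
  have "\<exists>w\<in>{w. left_of D w z}. \<forall>v\<in>{w. left_of D w z}. real (card {u. left_of D u w}) \<le> real (card {u. left_of D u v})"
    by (rule ex_minimizer[OF fin', of y]) (use assms in simp)
  then obtain w where w: "left_of D w z"
    and min: "\<And>v. left_of D v z \<Longrightarrow> card {u. left_of D u w} \<le> card {u. left_of D u v}" by auto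
  have "\<not> left_of D v w" for v
  proof
    assume v: "left_of D v w"
    then have "{u. left_of D u v} \<subset> {u. left_of D u w}"
      using left_of_trans left_of_asym by blast
    then have "card {u. left_of D u v} < card {u. left_of D u w}"
      by (rule psubset_card_mono[OF fin'])
    then show False using min[OF left_of_trans[OF v w]] by simp
  qed
  then have "w \<in> left_boundary D" using left_boundary_iff left_ofD(1)[OF w] by blast
  with w show ?thesis by blast
qed

lemma top_left_boundary:
  assumes "t \<in> carrier D" "\<And>x. x \<in> carrier D \<Longrightarrow> x \<sqsubseteq> t"
  shows "t \<in> left_boundary D"
  using left_boundary_iff assms left_ofD by blast

lemma bottom_left_boundary:
  assumes "t \<in> carrier D" "\<And>x. x \<in> carrier D \<Longrightarrow> t \<sqsubseteq> x"
  shows "t \<in> left_boundary D"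
  using left_boundary_iff assms left_ofD by blast

lemma first_not_below:
  assumes x: "x \<in> carrier D" and n: "\<exists>c\<in>left_boundary D. \<not> c \<sqsubseteq> x"
  obtains c where "c \<in> left_boundary D" "\<not> c \<sqsubseteq> x"
    "\<And>d. d \<in> left_boundary D \<Longrightarrow> \<not> d \<sqsubseteq> x \<Longrightarrow> c \<sqsubseteq> d"
proof -
  obtain c0 where "c0 \<in> left_boundary D" "\<not> c0 \<sqsubseteq> x" using n by blast
  then obtain c where c: "c \<in> left_boundary D" "\<not> c \<sqsubseteq> x"
    "\<And>z. z \<in> left_boundary D \<Longrightarrow> \<not> z \<sqsubseteq> x \<Longrightarrow> z \<sqsubseteq> c \<Longrightarrow> z = c"
    using ex_minimal_with[of c0 "\<lambda>c. c \<in> left_boundary D \<and> \<not> c \<sqsubseteq> x"] left_boundary_carrier by metis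
  have "c \<sqsubseteq> d" if "d \<in> left_boundary D" "\<not> d \<sqsubseteq> x" for d
    using left_boundary_comparable[OF c(1) that(1)] c(3)[OF that] left_boundary_carrier[OF c(1)] by auto
  with c(1,2) show ?thesis by (rule that)
qed

text \<open>Let \<open>b\<close> be the last boundary element before \<open>c\<close>. An element
  between \<open>b\<close> and \<open>c\<close> that is off the boundary has a boundary element on
  its left. This one is comparable to both \<open>b\<close> and \<open>c\<close>, so it would lie
  strictly between them. Hence \<open>b\<close> is covered by \<open>c\<close>.\<close>

lemma left_boundary_step:
  assumes m: "m \<in> carrier D" and c: "c \<in> left_boundary D" "\<not> c \<sqsubseteq> m"
    and min: "\<And>d. d \<in> left_boundary D \<Longrightarrow> \<not> d \<sqsubseteq> m \<Longrightarrow> c \<sqsubseteq> d"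
  shows "\<exists>b. covers D b c \<and> b \<sqsubseteq> m"
proof -
  obtain z where z: "z \<in> carrier D" "\<And>x. x \<in> carrier D \<Longrightarrow> z \<sqsubseteq> x" using ex_bottom by blast
  obtain b where b: "b \<in> left_boundary D" "b \<sqsubseteq> m"
    and max: "\<And>d. d \<in> left_boundary D \<Longrightarrow> d \<sqsubseteq> m \<Longrightarrow> b \<sqsubseteq> d \<Longrightarrow> d = b"
    using ex_maximal_with[of z "\<lambda>b. b \<in> left_boundary D \<and> b \<sqsubseteq> m"] z m bottom_left_boundary[OF z]
      left_boundary_carrier by metis
  note cc = left_boundary_carrier[OF c(1)] and bc = left_boundary_carrier[OF b(1)]
  have le: "b \<sqsubseteq> c" "b \<noteq> c"
    using left_boundary_comparable[OF b(1) c(1)] le_trans[of c b m] cc bc m c(2) b(2) by auto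
  have "covers D b c"
    unfolding covers_def
  proof (intro conjI ballI impI)
    fix z assume z: "z \<in> carrier D" "b \<sqsubseteq> z \<and> z \<sqsubseteq> c"
    have "z \<in> left_boundary D"
    proof (rule ccontr)
      assume "z \<notin> left_boundary D"
      then obtain y where y: "y \<in> left_boundary D" "left_of D y z"
        using left_boundary_iff z(1) ex_left_boundary_left_of by blast
      note yc = left_boundary_carrier[OF y(1)]
      have "\<not> y \<sqsubseteq> b" "\<not> c \<sqsubseteq> y"
        using left_ofD[OF y(2)] z le_trans[of y b z] le_trans[of z c y] yc bc cc by blast+
      then have "b \<sqsubseteq> y" "y \<sqsubseteq> c" "y \<noteq> b" "y \<noteq> c"
        using left_boundary_comparable[OF y(1) b(1)] left_boundary_comparable[OF y(1) c(1)] yc by auto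
      then show False using max[OF y(1)] min[OF y(1)] \<open>\<not> c \<sqsubseteq> y\<close> by blast
    qed
    then show "z = b \<or> z = c"
      using max[of z] min[of z] z le_antisym[of z c] cc by blast
  qed (use le bc cc in auto)
  with b(2) show ?thesis by blast
qed

text \<open>Semimodularity lifts the covering below \<open>c\<close> to a covering of
  \<open>m\<close> by its join with \<open>c\<close>. A meet-irreducible \<open>m\<close> has no
  other upper cover, so everything strictly above \<open>m\<close> is above \<open>c\<close> and has
  larger rank. This will give the points distinct coordinates.\<close>

lemma lrank_inj_meet_irreducible:
  assumes sm: "semimodular D" and m: "meet_irreducible D m" and m': "m' \<in> carrier D"
    and le: "m \<sqsubseteq> m'" and r: "lrank D m' \<le> lrank D m"
  shows "m = m'"
proof (rule ccontr)
  assume ne: "m \<noteq> m'"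
  have mc: "m \<in> carrier D" using m by (simp add: meet_irreducible_def)
  obtain t where t: "t \<in> carrier D" "\<And>x. x \<in> carrier D \<Longrightarrow> x \<sqsubseteq> t" using ex_top by blast
  have "\<not> t \<sqsubseteq> m" using t m le_antisym[OF _ t(2)] unfolding meet_irreducible_def greatest_def by blast
  then have "\<exists>c\<in>left_boundary D. \<not> c \<sqsubseteq> m" using top_left_boundary[OF t] by blast
  then obtain c where c: "c \<in> left_boundary D" "\<not> c \<sqsubseteq> m"
    "\<And>d. d \<in> left_boundary D \<Longrightarrow> \<not> d \<sqsubseteq> m \<Longrightarrow> c \<sqsubseteq> d"
    using first_not_below[OF mc] by metis
  note cc = left_boundary_carrier[OF c(1)]
  obtain b where b: "covers D b c" "b \<sqsubseteq> m" using left_boundary_step[OF mc c] by blast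
  note bc = coversD(1)[OF b(1)]
  have "b \<squnion> m = m"
    using le_antisym[of "b \<squnion> m" m] join_le[OF b(2) le_refl[OF mc] bc mc mc] join_right[OF bc mc] bc mc by simp
  moreover have "c \<squnion> m \<noteq> m" using join_left[OF cc mc] c(2) by auto
  ultimately have cov: "covers D m (c \<squnion> m)"
    using sm b(1) mc unfolding semimodular_def by metis
  obtain e where e: "covers D m e" "e \<sqsubseteq> m'" using ex_upper_cover[OF mc m' le ne] by blast
  have "e = c \<squnion> m" using meet_irreducible_cover[OF m e(1) cov] .
  then have "c \<sqsubseteq> m'" using join_left[OF cc mc] e(2) le_trans[of c "c \<squnion> m" m'] cc mc m' by simp
  then show False using r lrank_le_iff[OF m' mc] c(1,2) by blast
qed

text \<open>Let \<open>c\<close> be the first boundary element not below \<open>x\<close>. An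
  element that is maximal among those above \<open>x\<close> but not above \<open>c\<close> is
  meet-irreducible, and it has no new boundary element below it.\<close>

lemma ex_meet_irreducible_lrank:
  assumes x: "x \<in> carrier D"
  shows "\<exists>m. (meet_irreducible D m \<or> greatest D m (carrier D)) \<and> x \<sqsubseteq> m \<and> lrank D m = lrank D x"
proof (cases "\<exists>c\<in>left_boundary D. \<not> c \<sqsubseteq> x")
  case False
  obtain t where t: "t \<in> carrier D" "\<And>x. x \<in> carrier D \<Longrightarrow> x \<sqsubseteq> t" using ex_top by blast
  have "t \<sqsubseteq> x" using False top_left_boundary[OF t] by blast
  then have "x = t" using t x le_antisym by blast
  then show ?thesis using t x by (intro exI[of _ x]) (auto simp: greatest_def)
next
  case True
  then obtain c where c: "c \<in> left_boundary D" "\<not> c \<sqsubseteq> x"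
    "\<And>d. d \<in> left_boundary D \<Longrightarrow> \<not> d \<sqsubseteq> x \<Longrightarrow> c \<sqsubseteq> d"
    using first_not_below[OF x] by metis
  note cc = left_boundary_carrier[OF c(1)]
  obtain m where m: "m \<in> carrier D" "x \<sqsubseteq> m" "\<not> c \<sqsubseteq> m"
    and max: "\<And>z. z \<in> carrier D \<Longrightarrow> x \<sqsubseteq> z \<Longrightarrow> \<not> c \<sqsubseteq> z \<Longrightarrow> m \<sqsubseteq> z \<Longrightarrow> z = m"
    using ex_maximal_with[of x "\<lambda>z. x \<sqsubseteq> z \<and> \<not> c \<sqsubseteq> z"] x c(2) by (metis le_refl)
  have "meet_irreducible D m"
    unfolding meet_irreducible_def
  proof (intro conjI ballI impI)
    show "\<not> greatest D m (carrier D)" using m(3) cc by (auto simp: greatest_def)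
    fix a b assume ab: "a \<in> carrier D" "b \<in> carrier D" "m = a \<sqinter> b"
    have l: "m \<sqsubseteq> a" "m \<sqsubseteq> b" using meet_left[OF ab(1,2)] meet_right[OF ab(1,2)] ab(3) by auto
    have "\<not> (c \<sqsubseteq> a \<and> c \<sqsubseteq> b)"
    proof
      assume "c \<sqsubseteq> a \<and> c \<sqsubseteq> b"
      then have "c \<sqsubseteq> a \<sqinter> b" using meet_le[of c a b] ab cc by auto
      then show False using ab(3) m(3) by simp
    qed
    moreover have "x \<sqsubseteq> a" "x \<sqsubseteq> b"
      using le_trans[OF m(2) l(1)] le_trans[OF m(2) l(2)] ab(1,2) x m(1) by simp_all
    ultimately show "m = a \<or> m = b"
      using max[OF ab(1) _ _ l(1)] max[OF ab(2) _ _ l(2)] by auto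
  qed (rule m)
  moreover have "lrank D m = lrank D x"
  proof (rule antisym)
    have "d \<sqsubseteq> x" if d: "d \<in> left_boundary D" "d \<sqsubseteq> m" for d
      using c(3)[OF d(1)] le_trans[of c d m] d cc left_boundary_carrier[OF d(1)] m(1,3) by blast
    then show "lrank D m \<le> lrank D x" using lrank_le_iff[OF m(1) x] by blast
  qed (rule lrank_mono[OF x m(1,2)])
  ultimately show ?thesis using m(2) by blast
qed

end

text \<open>Slimness makes the two ranks determine the order, since every join-irreducible element
  lies on a boundary chain. Semimodularity puts the points into general position.\<close>

theorem ex_representation:
  assumes "slim_semimodular_diagram D"
  shows "\<exists>\<kappa> P. represents D \<kappa> P"
proof -
  interpret planar D using assms by unfold_locales (simp add: slim_semimodular_diagram_def)
  interpret m: planar "mirror D" using planar_mirror[OF planar] by unfold_locales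
  have sl: "slim D" and sm: "semimodular D" using assms by (auto simp: slim_semimodular_diagram_def)
  have rb: "left_boundary (mirror D) = right_boundary D" by (rule boundary_mirror(1)[OF planar])
  have lm: "left_of (mirror D) x y \<longleftrightarrow> left_of D y x" for x y
    by (rule left_of_mirror) (rule lattice_axioms)
  define \<kappa> where "\<kappa> x = (lrank D x, lrank (mirror D) x)" for x
  define M where "M = {m. meet_irreducible D m \<or> greatest D m (carrier D)}"
  define P where "P = \<kappa> ` M"
  have M: "M \<subseteq> carrier D" by (auto simp: M_def meet_irreducible_def greatest_def)
  have le: "x \<sqsubseteq>\<^bsub>D\<^esub> y \<longleftrightarrow> \<kappa> x \<le> \<kappa> y" if xy: "x \<in> carrier D" "y \<in> carrier D" for x y
  proof
    assume "x \<sqsubseteq>\<^bsub>D\<^esub> y"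
    then show "\<kappa> x \<le> \<kappa> y"
      using lrank_mono[of x y] m.lrank_mono[of x y] xy by (simp add: \<kappa>_def less_eq_prod_def)
  next
    assume k: "\<kappa> x \<le> \<kappa> y"
    show "x \<sqsubseteq>\<^bsub>D\<^esub> y"
    proof (rule ccontr)
      assume "\<not> x \<sqsubseteq>\<^bsub>D\<^esub> y"
      then obtain j where j: "join_irreducible D j" "j \<sqsubseteq>\<^bsub>D\<^esub> x" "\<not> j \<sqsubseteq>\<^bsub>D\<^esub> y"
        using ex_join_irreducible xy by blast
      then have "j \<in> left_boundary D \<or> j \<in> left_boundary (mirror D)"
        using slim_join_irreducible[OF sl] rb by blast
      then show False
        using k lrank_le_iff[OF xy] m.lrank_le_iff[of x y] xy j by (auto simp: \<kappa>_def less_eq_prod_def)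
    qed
  qed
  have inj: "x = y" if "x \<in> carrier D" "y \<in> carrier D" "\<kappa> x = \<kappa> y" for x y
    using le that le_antisym by simp
  have left: "fst (\<kappa> y) < fst (\<kappa> x) \<and> snd (\<kappa> x) < snd (\<kappa> y)" if l: "left_of D x y" for x y
  proof -
    note xy = left_ofD[OF l]
    have "fst (\<kappa> y) \<le> fst (\<kappa> x)" "snd (\<kappa> x) \<le> snd (\<kappa> y)"
      using lrank_left_of[OF l] m.lrank_left_of[of y x] lm l by (auto simp: \<kappa>_def)
    moreover have "\<not> \<kappa> x \<le> \<kappa> y" "\<not> \<kappa> y \<le> \<kappa> x" using le xy by auto
    ultimately show ?thesis by (auto simp: less_eq_prod_def)
  qed
  have left_iff: "left_of D x y \<longleftrightarrow> fst (\<kappa> y) < fst (\<kappa> x) \<and> snd (\<kappa> x) < snd (\<kappa> y)"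
    if xy: "x \<in> carrier D" "y \<in> carrier D" for x y
  proof
    assume r: "fst (\<kappa> y) < fst (\<kappa> x) \<and> snd (\<kappa> x) < snd (\<kappa> y)"
    then have "incomparable D x y" using le xy by (auto simp: incomparable_def less_eq_prod_def)
    then show "left_of D x y" using left_of_total[OF xy] left[of y x] r by auto
  qed (rule left)
  have kmeet: "\<kappa> (x \<sqinter>\<^bsub>D\<^esub> y) = inf (\<kappa> x) (\<kappa> y)" if "x \<in> carrier D" "y \<in> carrier D" for x y
    using lrank_meet[OF that] m.lrank_meet[of x y] that by (simp add: \<kappa>_def inf_prod_def inf_min)
  have ex1: "\<exists>n\<in>M. x \<sqsubseteq>\<^bsub>D\<^esub> n \<and> fst (\<kappa> n) = fst (\<kappa> x)" if "x \<in> carrier D" for x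
    using ex_meet_irreducible_lrank[OF that] by (auto simp: M_def \<kappa>_def)
  have ex2: "\<exists>n\<in>M. x \<sqsubseteq>\<^bsub>D\<^esub> n \<and> snd (\<kappa> n) = snd (\<kappa> x)" if "x \<in> carrier D" for x
    using m.ex_meet_irreducible_lrank[of x] that by (auto simp: M_def \<kappa>_def)
  have uniq1: "x = y" if "x \<in> M" "y \<in> M" "x \<sqsubseteq>\<^bsub>D\<^esub> y" "fst (\<kappa> x) = fst (\<kappa> y)" for x y
  proof (cases "meet_irreducible D x")
    case True
    then show ?thesis using lrank_inj_meet_irreducible[OF sm] that M by (auto simp: \<kappa>_def)
  next
    case False
    then show ?thesis using that M le_antisym by (auto simp: M_def greatest_def)
  qed
  have uniq2: "x = y" if "x \<in> M" "y \<in> M" "x \<sqsubseteq>\<^bsub>D\<^esub> y" "snd (\<kappa> x) = snd (\<kappa> y)" for x y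
  proof (cases "meet_irreducible D x")
    case True
    then show ?thesis using m.lrank_inj_meet_irreducible[of x y] sm that M by (auto simp: \<kappa>_def)
  next
    case False
    then show ?thesis using that M le_antisym by (auto simp: M_def greatest_def)
  qed
  obtain t where t: "t \<in> carrier D" "\<And>x. x \<in> carrier D \<Longrightarrow> x \<sqsubseteq>\<^bsub>D\<^esub> t" using ex_top by blast
  have cmp: "x \<sqsubseteq>\<^bsub>D\<^esub> y \<or> y \<sqsubseteq>\<^bsub>D\<^esub> x"
    if "x \<in> carrier D" "y \<in> carrier D" "fst (\<kappa> x) = fst (\<kappa> y) \<or> snd (\<kappa> x) = snd (\<kappa> y)" for x y
    using le[of x y] le[of y x] that by (auto simp: less_eq_prod_def)
  have "config P"
    unfolding config_def
  proof (intro conjI)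
    show "finite P" unfolding P_def using M fin finite_subset by blast
    show "inj_on fst P"
    proof (rule inj_onI)
      fix z w assume zw: "z \<in> P" "w \<in> P" "fst z = fst w"
      obtain x y where xy: "x \<in> M" "z = \<kappa> x" "y \<in> M" "w = \<kappa> y" using zw unfolding P_def by blast
      then have "x \<in> carrier D" "y \<in> carrier D" using M by auto
      then have "x = y"
        using cmp[of x y] uniq1[of x y] uniq1[of y x] xy zw(3) by auto
      then show "z = w" using xy by simp
    qed
    show "inj_on snd P"
    proof (rule inj_onI)
      fix z w assume zw: "z \<in> P" "w \<in> P" "snd z = snd w"
      obtain x y where xy: "x \<in> M" "z = \<kappa> x" "y \<in> M" "w = \<kappa> y" using zw unfolding P_def by blast
      then have "x \<in> carrier D" "y \<in> carrier D" using M by auto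
      then have "x = y"
        using cmp[of x y] uniq2[of x y] uniq2[of y x] xy zw(3) by auto
      then show "z = w" using xy by simp
    qed
    have "t \<in> M" using t by (simp add: M_def greatest_def)
    moreover have "\<kappa> x \<le> \<kappa> t" if "x \<in> M" for x using t le that M by auto
    ultimately show "\<exists>w\<in>P. \<forall>z\<in>P. z \<le> w" unfolding P_def by blast
  qed
  moreover have "\<kappa> ` carrier D = tight P"
  proof (intro equalityI subsetI)
    fix p assume "p \<in> \<kappa> ` carrier D"
    then obtain x where x: "x \<in> carrier D" "p = \<kappa> x" by blast
    obtain n1 where n1: "n1 \<in> M" "x \<sqsubseteq>\<^bsub>D\<^esub> n1" "fst (\<kappa> n1) = fst (\<kappa> x)" using ex1[OF x(1)] by blast
    obtain n2 where n2: "n2 \<in> M" "x \<sqsubseteq>\<^bsub>D\<^esub> n2" "snd (\<kappa> n2) = snd (\<kappa> x)" using ex2[OF x(1)] by blast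
    have "\<kappa> x \<le> \<kappa> n1" "\<kappa> x \<le> \<kappa> n2" using le x(1) n1 n2 M by auto
    then show "p \<in> tight P"
      using n1 n2 x(2) by (intro tightI[of "\<kappa> n1" P p "\<kappa> n2"]) (auto simp: P_def less_eq_prod_def)
  next
    fix p assume p: "p \<in> tight P"
    obtain z w where z: "z \<in> quad P p" "fst z = fst p" and w: "w \<in> quad P p" "snd w = snd p"
      using tightD[OF p] by blast
    then have zw: "z \<in> P" "snd p \<le> snd z" "w \<in> P" "fst p \<le> fst w" by (auto simp: quad_def less_eq_prod_def)
    obtain x y where xy: "x \<in> M" "z = \<kappa> x" "y \<in> M" "w = \<kappa> y" using zw unfolding P_def by blast
    \<comment> \<open>A tight corner is the meet of the point in its column and the point in its
      row.\<close>
    have "p = inf z w" using z w zw by (simp add: prod_eq_iff inf_min)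
    moreover have xyc: "x \<in> carrier D" "y \<in> carrier D" using xy M by auto
    ultimately have "p = \<kappa> (x \<sqinter>\<^bsub>D\<^esub> y)" using kmeet xy by simp
    then show "p \<in> \<kappa> ` carrier D" using xyc by auto
  qed
  then have "bij_betw \<kappa> (carrier D) (tight P)"
    by (auto simp: bij_betw_def inj_on_def intro: inj)
  ultimately have "represents D \<kappa> P"
    unfolding represents_def using planar le left_iff by blast
  then show ?thesis by blast
qed

section \<open>Schemes in coordinates\<close>

lemma next_left_consecutive: "next_left D A B \<Longrightarrow> consecutive D A B"
  by (cases A; cases B) auto

lemma left_wing_eq: "left_wing D A = {B. (next_left D)\<^sup>*\<^sup>* A B}"
proof -
  have "(consecutive D)\<^sup>*\<^sup>* A B" if "(next_left D)\<^sup>*\<^sup>* A B" for B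
    using that by (rule rtranclp_mono[THEN predicate2D, rotated]) (auto intro: next_left_consecutive)
  then show ?thesis by (auto simp: left_wing_def C3_trajectory_def)
qed

lemma consecutive_sym: "consecutive D A B \<longleftrightarrow> consecutive D B A"
  by (simp add: consecutive_def insert_commute)

lemma next_right_mirror: "next_right D = next_left (mirror D)"
proof (intro ext)
  fix A B
  show "next_right D A B = next_left (mirror D) A B"
    using consecutive_sym[of D A B] by (cases A; cases B) (auto simp: next_right_def)
qed

lemma right_wing_mirror: "right_wing D A = left_wing (mirror D) A"
  by (simp add: right_wing_def left_wing_def C3_trajectory_def next_right_mirror)

context represented
begin

text \<open>The point \<open>p\<close> serves as a label of the covering. Parallel coverings will
  have equal labels, and this makes trajectories computable.\<close>

definition lab :: "'a \<Rightarrow> 'a \<Rightarrow> real \<times> real \<Rightarrow> bool" where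
  "lab x y p \<longleftrightarrow> x \<in> carrier D \<and> y \<in> carrier D \<and> p \<in> Q x \<and> Q y = Q x - {p}"

lemma labD: "lab x y p \<Longrightarrow> x \<in> carrier D" "lab x y p \<Longrightarrow> y \<in> carrier D" "lab x y p \<Longrightarrow> p \<in> Q x"
  "lab x y p \<Longrightarrow> p \<notin> Q y" "lab x y p \<Longrightarrow> Q y = Q x - {p}" "lab x y p \<Longrightarrow> p \<in> P"
  using Q_sub by (auto simp: lab_def)

lemma lab_covers: "lab x y p \<Longrightarrow> covers D x y"
  unfolding lab_def using coversI by blast

lemma covers_lab:
  assumes "covers D x y"
  shows "\<exists>p. lab x y p"
  using covers_removal[OF assms] coversD[OF assms] by (auto simp: lab_def)

lemma lab_unique: "lab x y p \<Longrightarrow> lab x y q \<Longrightarrow> p = q"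
  unfolding lab_def by blast

lemma lab_extremal: "lab x y p \<Longrightarrow> fst p = fst (\<kappa> x) \<or> snd p = snd (\<kappa> x)"
  using removed_extremal[of x y p] by (simp add: lab_def)

text \<open>Joining with \<open>x'\<close> intersects quadrants with \<open>Q x'\<close>. Since the
  covering of \<open>x'\<close> by \<open>y'\<close> must still delete a point, it deletes the same
  one.\<close>

lemma parallel_lab:
  assumes "covers D x y" "covers D x' y'" "x \<sqsubseteq> x'" "y \<squnion> x' = y'"
  shows "lab x y p \<longleftrightarrow> lab x' y' p"
proof -
  note c = coversD[OF assms(1)] and c' = coversD[OF assms(2)]
  obtain p0 where p0: "lab x y p0" using covers_lab assms(1) by blast
  have "Q y' = Q y \<inter> Q x'" using Q_join[OF c(2) c'(1)] assms(4) by simp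
  also have "\<dots> = Q x' - {p0}" using labD[OF p0] le_iff_Q[OF c(1) c'(1)] assms(3) by auto
  finally have e: "Q y' = Q x' - {p0}" .
  have "Q y' \<noteq> Q x'" using Q_inj c' by blast
  then have "lab x' y' p0" using e c' by (auto simp: lab_def)
  then show ?thesis using p0 lab_unique by metis
qed

text \<open>\<open>Q (f i j)\<close> arises from \<open>S\<close> by deleting the first
  \<open>i\<close> points of \<open>p\<close> and the first \<open>j\<close> points of
  \<open>t\<close>. Joins are then immediate, being intersections. Meets need an argument, because a
  union of quadrants need not be a quadrant.\<close>

lemma labelled_grid:
  assumes f: "\<And>i j. i < m \<Longrightarrow> j < n \<Longrightarrow> f i j \<in> carrier D"
    and Qf: "\<And>i j. i < m \<Longrightarrow> j < n \<Longrightarrow> Q (f i j) = S - p ` {..<i} - t ` {..<j}"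
    and p: "\<And>i. Suc i < m \<Longrightarrow> p i \<in> S" "inj_on p {i. Suc i < m}"
    and t: "\<And>j. Suc j < n \<Longrightarrow> t j \<in> S" "inj_on t {j. Suc j < n}"
    and pt: "\<And>i j. Suc i < m \<Longrightarrow> Suc j < n \<Longrightarrow> p i \<noteq> t j"
  shows "cover_preserving_grid D m n f"
proof -
  have pn: "p k \<notin> p ` {..<i}" if "i \<le> k" "Suc k < m" for i k
  proof
    assume "p k \<in> p ` {..<i}"
    then obtain h where "h < i" "p k = p h" by auto
    moreover then have "k = h" using inj_onD[OF p(2), of k h] that by simp
    ultimately show False using that by simp
  qed
  have tn: "t k \<notin> t ` {..<j}" if "j \<le> k" "Suc k < n" for j k
  proof
    assume "t k \<in> t ` {..<j}"
    then obtain h where "h < j" "t k = t h" by auto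
    moreover then have "k = h" using inj_onD[OF t(2), of k h] that by simp
    ultimately show False using that by simp
  qed
  have pt1: "p i \<notin> t ` {..<j}" if "Suc i < m" "j < n" for i j
  proof
    assume "p i \<in> t ` {..<j}"
    then obtain h where "h < j" "p i = t h" by auto
    then show False using pt[of i h] that by simp
  qed
  have tp1: "t j \<notin> p ` {..<i}" if "Suc j < n" "i < m" for i j
  proof
    assume "t j \<in> p ` {..<i}"
    then obtain h where "h < i" "t j = p h" by auto
    then show False using pt[of h j] that by simp
  qed
  have cov1: "covers D (f i j) (f (Suc i) j)" if ij: "Suc i < m" "j < n" for i j
  proof (rule coversI[of _ _ "p i"])
    show "p i \<in> Q (f i j)"
      using Qf[of i j] p(1)[OF ij(1)] pn[of i i] pt1[of i j] ij by simp
    show "Q (f (Suc i) j) = Q (f i j) - {p i}"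
      using Qf[of i j] Qf[of "Suc i" j] ij by (auto simp: lessThan_Suc)
  qed (use f ij in auto)
  have cov2: "covers D (f i j) (f i (Suc j))" if ij: "i < m" "Suc j < n" for i j
  proof (rule coversI[of _ _ "t j"])
    show "t j \<in> Q (f i j)"
      using Qf[of i j] t(1)[OF ij(2)] tn[of j j] tp1[of j i] ij by simp
    show "Q (f i (Suc j)) = Q (f i j) - {t j}"
      using Qf[of i j] Qf[of i "Suc j"] ij by (auto simp: lessThan_Suc)
  qed (use f ij in auto)
  have mono: "f i j \<sqsubseteq> f k l" if "i \<le> k" "j \<le> l" "k < m" "l < n" for i j k l
    using le_iff_Q[OF f f, of i j k l] Qf[of i j] Qf[of k l] that by auto
  have anti: "i \<le> k \<and> j \<le> l" if le: "f i j \<sqsubseteq> f k l" and b: "i < m" "j < n" "k < m" "l < n" for i j k l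
  proof -
    have sub: "Q (f k l) \<subseteq> Q (f i j)" using le_iff_Q[OF f f, of i j k l] le b by auto
    have "i \<le> k"
    proof (rule ccontr)
      assume "\<not> i \<le> k"
      then have "p k \<in> Q (f k l)" "p k \<notin> Q (f i j)"
        using Qf[of k l] Qf[of i j] p(1)[of k] pn[of k k] pt1[of k l] b by simp_all
      then show False using sub by blast
    qed
    moreover have "j \<le> l"
    proof (rule ccontr)
      assume "\<not> j \<le> l"
      then have "t l \<in> Q (f k l)" "t l \<notin> Q (f i j)"
        using Qf[of k l] Qf[of i j] t(1)[of l] tn[of l l] tp1[of l k] b by simp_all
      then show False using sub by blast
    qed
    ultimately show ?thesis ..
  qed
  have joins: "f i j \<squnion> f k l = f (max i k) (max j l)"
    if b: "i < m" "j < n" "k < m" "l < n" for i j k l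
  proof (rule Q_inj)
    have un: "{..<a} \<union> {..<b} = {..<max a b}" for a b :: nat by auto
    have "Q (f i j \<squnion> f k l) = Q (f i j) \<inter> Q (f k l)" using Q_join f b by simp
    also have "\<dots> = S - p ` ({..<i} \<union> {..<k}) - t ` ({..<j} \<union> {..<l})"
      using Qf b by auto
    also have "\<dots> = Q (f (max i k) (max j l))"
      using Qf[of "max i k" "max j l"] b by (simp add: un)
    finally show "Q (f i j \<squnion> f k l) = Q (f (max i k) (max j l))" .
  qed (use f b in auto)
  have meet_aux: "f i j \<sqinter> f k l = f (min i k) (min j l)"
    if b: "i < m" "j < n" "k < m" "l < n" for i j k l
  proof (rule ccontr)
    let ?z = "f (min i k) (min j l)" and ?w = "f i j \<sqinter> f k l"
    assume ne: "?w \<noteq> ?z"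
    have z: "?z \<in> carrier D" "?w \<in> carrier D" "f i j \<in> carrier D" "f k l \<in> carrier D" using f b by auto
    have zw: "?z \<sqsubseteq> ?w" using z mono b by (intro meet_le) auto
    have w: "?w \<sqsubseteq> f i j" "?w \<sqsubseteq> f k l" using meet_left[OF z(3,4)] meet_right[OF z(3,4)] by auto
    \<comment> \<open>An upper cover of the expected meet, towards the actual one. The two grid
      neighbours exhaust the upper covers, and neither of them lies below both elements.\<close>
    obtain e where e: "covers D ?z e" "e \<sqsubseteq> ?w" using ex_upper_cover[OF z(1,2) zw] ne by metis
    note ec = coversD[OF e(1)]
    have e': "e \<sqsubseteq> f i j" "e \<sqsubseteq> f k l"
      using le_trans[OF e(2) w(1)] le_trans[OF e(2) w(2)] ec z by auto
    have nz: "?z \<noteq> f i j" "?z \<noteq> f k l" using e' ec le_antisym z by metis+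
    have excl: False if b: "i < m" "j < n" "k < m" "l < n" and o: "k < i" "j < l"
      and e: "covers D (f k j) e" "e \<sqsubseteq> f i j" "e \<sqsubseteq> f k l" for i j k l
    proof -
      have c: "covers D (f k j) (f (Suc k) j)" "covers D (f k j) (f k (Suc j))"
        using cov1 cov2 b o by auto
      have "f (Suc k) j \<noteq> f k (Suc j)"
        using anti[of "Suc k" j k "Suc j"] f[of "Suc k" j] b o by force
      then have "e = f (Suc k) j \<or> e = f k (Suc j)" using upper_cover_cases[OF c e(1)] by blast
      then show False
        using anti[of "Suc k" j k l] anti[of k "Suc j" i j] e b o by auto
    qed
    show False
    proof (cases "k < i")
      case True
      then have "min i k = k" by simp
      then have "min j l \<noteq> l" using nz(2) by metis
      then have "j < l" by (simp add: min_def split: if_splits)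
      then show False using excl[OF b(1-4) True] True e(1) e' by (simp add: min_def)
    next
      case False
      then have i: "min i k = i" by simp
      then have "min j l \<noteq> j" using nz(1) by metis
      then have l: "l < j" by (simp add: min_def split: if_splits)
      then have "i \<noteq> k" using nz(2) i by (auto simp: min_def)
      then have "i < k" using False by simp
      then show False using excl[OF b(3,4,1,2)] l e(1) e' by (simp add: min_def)
    qed
  qed
  have inj: "inj_on (\<lambda>(i, j). f i j) ({..<m} \<times> {..<n})"
  proof (rule inj_onI)
    fix a b assume a: "a \<in> {..<m} \<times> {..<n}" and b: "b \<in> {..<m} \<times> {..<n}"
      and e: "(case a of (i, j) \<Rightarrow> f i j) = (case b of (i, j) \<Rightarrow> f i j)"
    obtain i j where ij: "a = (i, j)" "i < m" "j < n" using a by auto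
    obtain k l where kl: "b = (k, l)" "k < m" "l < n" using b by auto
    have "f i j \<sqsubseteq> f k l" "f k l \<sqsubseteq> f i j" using e ij kl f by auto
    then have "i = k" "j = l" using anti[of i j k l] anti[of k l i j] ij kl by auto
    then show "a = b" using ij kl by simp
  qed
  show ?thesis
    unfolding cover_preserving_grid_def
    using f inj joins meet_aux cov1 cov2 by blast
qed

lemma left_ofI:
  assumes "covers D x y" "covers D x z" "fst (\<kappa> z) < fst (\<kappa> y)"
  shows "left_upper D x y z"
proof -
  note c = coversD[OF assms(1)] coversD[OF assms(2)]
  have "incomparable D y z" using upper_covers_incomparable[OF assms(1,2)] assms(3) by auto
  then have "\<not> \<kappa> z \<le> \<kappa> y" using le_iff c by (auto simp: incomparable_def)
  then show ?thesis
    using left_upper_iff left_iff[of y z] c assms by (auto simp: less_eq_prod_def)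
qed

lemma consecutive_lab:
  assumes cs: "consecutive D (a0, a1, a2) (b0, b1, b2)" and p: "lab a0 a1 p" and q: "lab a1 a2 q"
  shows "lab b0 b1 p \<and> lab b1 b2 q"
proof -
  obtain g where g: "cover_preserving_grid D 3 2 g"
    and e: "{(a0, a1, a2), (b0, b1, b2)} = {(g 0 0, g 1 0, g 2 0), (g 0 1, g 1 1, g 2 1)}"
    using cs unfolding consecutive_def by blast
  have c: "covers D (g i j) (g (Suc i) j)" if "i < 2" "j < 2" for i j
    using g that unfolding cover_preserving_grid_def by simp
  have c': "covers D (g i 0) (g i 1)" if "i < 3" for i
    using g that unfolding cover_preserving_grid_def by (metis One_nat_def one_less_numeral_iff semiring_norm(76))
  have j: "g (Suc i) 0 \<squnion> g i 1 = g (Suc i) 1" if "i < 2" for i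
  proof -
    have "g (Suc i) 0 \<squnion> g i 1 = g (max (Suc i) i) (max 0 1)"
      using g that unfolding cover_preserving_grid_def by simp
    then show ?thesis by simp
  qed
  have l: "lab (g i 0) (g (Suc i) 0) p \<longleftrightarrow> lab (g i 1) (g (Suc i) 1) p" if "i < 2" for i p
    using parallel_lab[OF c c _ j] c' coversD that by simp
  have l0: "lab (g 0 0) (g 1 0) p \<longleftrightarrow> lab (g 0 1) (g 1 1) p"
    and l1: "lab (g 1 0) (g 2 0) p \<longleftrightarrow> lab (g 1 1) (g 2 1) p" for p
    using l[of 0 p] l[of 1 p] by (simp_all add: numeral_2_eq_2)
  show ?thesis
    using e p q l0[of p] l1[of q] by (auto simp: doubleton_eq_iff)
qed

text \<open>The chains with labels \<open>p\<close> and \<open>q\<close> whose bottom has an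
  abscissa beyond \<open>m\<close>. In the situation of \<open>left_scheme\<close> these are
  precisely the chains of the left wing.\<close>

definition wing_inv :: "real \<Rightarrow> real \<times> real \<Rightarrow> real \<times> real \<Rightarrow> 'a chain3 \<Rightarrow> bool" where
  "wing_inv m p q = (\<lambda>(z0, z1, z2). lab z0 z1 p \<and> lab z1 z2 q \<and> m < fst (\<kappa> z0))"

lemma kappa_mono: "covers D x y \<Longrightarrow> \<kappa> x \<le> \<kappa> y"
  using coversD le_iff by blast

text \<open>In an upward step the abscissa of the bottom grows. In a downward step the leftmost
  point of \<open>Q b0\<close> is lost at the first covering of the new chain; hence this point is
  the label \<open>p\<close>, which lies beyond \<open>m\<close>.\<close>

lemma wing_inv_step:
  assumes "next_left D A B" "wing_inv m p q A" "m < fst p"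
  shows "wing_inv m p q B"
proof -
  obtain a0 a1 a2 where A: "A = (a0, a1, a2)" by (cases A)
  obtain b0 b1 b2 where B: "B = (b0, b1, b2)" by (cases B)
  have n: "consecutive D (a0, a1, a2) (b0, b1, b2)" "left_upper D a0 b0 a1 \<or> left_upper D b0 b1 a0"
    using assms(1) unfolding A B by auto
  have i: "lab a0 a1 p" "lab a1 a2 q" "m < fst (\<kappa> a0)" using assms(2) by (auto simp: A wing_inv_def)
  have l: "lab b0 b1 p" "lab b1 b2 q" using consecutive_lab[OF n(1) i(1,2)] by auto
  have "m < fst (\<kappa> b0)"
    using n(2)
  proof
    assume "left_upper D a0 b0 a1"
    then have "left_of D b0 a1" using left_upper_iff by blast
    then have "fst (\<kappa> a1) < fst (\<kappa> b0)" using left_iff left_ofD by blast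
    moreover have "\<kappa> a0 \<le> \<kappa> a1" using kappa_mono[OF lab_covers[OF i(1)]] .
    ultimately show ?thesis using i(3) by (auto simp: less_eq_prod_def)
  next
    assume lu: "left_upper D b0 b1 a0"
    then have c: "covers D b0 a0" "left_of D b1 a0" using left_upper_iff by auto
    have "fst (\<kappa> a0) < fst (\<kappa> b1)" using c(2) left_iff left_ofD by blast
    then have lt: "fst (\<kappa> b0) < fst (\<kappa> b1)" using kappa_mono[OF c(1)] by (auto simp: less_eq_prod_def)
    obtain w where w: "w \<in> Q b0" "fst w = fst (\<kappa> b0)" using ex_leftmost labD(1)[OF l(1)] by blast
    then have "w \<notin> Q b1" using lt by (auto simp: Q_iff)
    then have "w = p" using w labD(5)[OF l(1)] by auto
    then show ?thesis using w(2) assms(3) by simp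
  qed
  then show ?thesis using l by (simp add: B wing_inv_def)
qed

lemma wing_inv_reach:
  assumes "(next_left D)\<^sup>*\<^sup>* A B" "wing_inv m p q A" "m < fst p"
  shows "wing_inv m p q B"
  using assms by (induction rule: rtranclp_induct) (auto intro: wing_inv_step)

lemma left_boundaryI:
  assumes x: "x \<in> carrier D" and cl: "\<And>z w. z \<in> P \<Longrightarrow> w \<in> Q x \<Longrightarrow> fst w \<le> fst z \<Longrightarrow> z \<in> Q x"
  shows "x \<in> left_boundary D"
proof -
  obtain w where "w \<in> Q x" "fst w = fst (\<kappa> x)" using ex_leftmost[OF x] by blast
  then show ?thesis using left_boundary_Q[OF x] cl by (metis Q_iff)
qed

end

text \<open>The situation at the upper left side \<open>c0\<close>, \<open>c1\<close>,
  \<open>c2\<close> of the square of a scheme, with labels \<open>p\<close> and \<open>q\<close>;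
  the quadrants there begin strictly beyond \<open>m\<close>. The labels lie in adjacent columns
  and, beyond \<open>m\<close>, also in adjacent rows. Right wings are treated in the reflected
  diagram.\<close>

locale left_scheme = represented +
  fixes m :: real and p q c0 c1 c2
  assumes c: "c0 \<in> carrier D" "c1 \<in> carrier D" "c2 \<in> carrier D"
    and pq: "p \<in> P" "q \<in> P" "m < fst p" "fst p < fst q" "snd p < snd q"
    and no_column: "\<And>z. z \<in> P \<Longrightarrow> fst p < fst z \<Longrightarrow> fst z < fst q \<Longrightarrow> False"
    and no_row: "\<And>z. z \<in> P \<Longrightarrow> m < fst z \<Longrightarrow> snd p < snd z \<Longrightarrow> snd z < snd q \<Longrightarrow> False"
    and Qc: "Q c0 = {z \<in> P. m < fst z \<and> snd p \<le> snd z}" "Q c1 = {z \<in> P. m < fst z \<and> snd q \<le> snd z}"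
      "Q c2 = {z \<in> P. m < fst z \<and> snd q < snd z}"
begin

lemma row_cases:
  assumes "z \<in> P" "m < fst z" "snd p \<le> snd z"
  shows "z = p \<or> snd q \<le> snd z"
  using no_row[OF assms(1,2)] snd_eqD[OF assms(1) pq(1)] assms(3) by force

lemma column_cases:
  assumes "z \<in> P" "fst p \<le> fst z"
  shows "z = p \<or> fst q \<le> fst z"
  using no_column[OF assms(1)] fst_eqD[OF assms(1) pq(1)] assms(2) by force

lemma start_lab: "lab c0 c1 p" "lab c1 c2 q"
proof -
  have "z \<in> Q c1 \<longleftrightarrow> z \<in> Q c0 \<and> z \<noteq> p" for z using row_cases[of z] pq Qc by auto
  then have "Q c1 = Q c0 - {p}" by blast
  then show "lab c0 c1 p" unfolding lab_def using c pq Qc by simp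
  have "z \<in> Q c2 \<longleftrightarrow> z \<in> Q c1 \<and> z \<noteq> q" for z
    using snd_eqD[of z q] pq Qc by (auto simp: less_le)
  then have "Q c2 = Q c1 - {q}" by blast
  then show "lab c1 c2 q" unfolding lab_def using c pq Qc by simp
qed

text \<open>The greatest point belongs to every quadrant, and it is not \<open>q\<close> because
  \<open>Q c2\<close> has a point higher than \<open>q\<close>. So deleting \<open>q\<close> always
  leaves an element.\<close>

lemma Q_not_q: "x \<in> carrier D \<Longrightarrow> Q x \<noteq> {q}"
proof
  assume x: "x \<in> carrier D" "Q x = {q}"
  obtain w where w: "w \<in> P" "\<And>z. z \<in> P \<Longrightarrow> z \<le> w" using ex_max by blast
  then have "w = q" using max_in_Q[OF w x(1)] x by blast
  moreover obtain v where "v \<in> Q c2" using ex_leftmost[OF c(3)] by blast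
  ultimately show False using w(2)[of v] Qc(3) by (auto simp: less_eq_prod_def)
qed

lemma start_inv: "wing_inv m p q (c0, c1, c2)"
proof -
  obtain w where "w \<in> Q c0" "fst w = fst (\<kappa> c0)" using ex_leftmost[OF c(1)] by blast
  then show ?thesis using start_lab Qc(1) by (auto simp: wing_inv_def)
qed

lemma middle_coordinates:
  assumes "wing_inv m p q (z0, z1, z2)"
  shows "snd (\<kappa> z1) = snd q \<and> m < fst (\<kappa> z1) \<or> fst (\<kappa> z1) = fst q"
proof -
  have i: "lab z0 z1 p" "lab z1 z2 q" "m < fst (\<kappa> z0)" using assms by (auto simp: wing_inv_def)
  have "\<kappa> z0 \<le> \<kappa> z1" using kappa_mono[OF lab_covers[OF i(1)]] .
  then show ?thesis using lab_extremal[OF i(2)] i(3) by (auto simp: less_eq_prod_def)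
qed

text \<open>On these lines \<open>q\<close> is the lowest or the leftmost point of
  \<open>Q e\<close>, so it can be deleted. Adding \<open>p\<close> to \<open>Q e\<close> forces no
  further point in, because \<open>p\<close> and \<open>q\<close> are adjacent.\<close>

lemma chain_at_middle:
  assumes e: "e \<in> carrier D" and k: "snd (\<kappa> e) = snd q \<and> m < fst (\<kappa> e) \<or> fst (\<kappa> e) = fst q"
  shows "\<exists>z0 z2. wing_inv m p q (z0, e, z2)"
proof -
  have me: "m < fst (\<kappa> e)" using k pq by auto
  obtain a where a: "a \<in> Q e" "fst a = fst (\<kappa> e)" using ex_leftmost[OF e] by blast
  obtain b where b: "b \<in> Q e" "snd b = snd (\<kappa> e)" using ex_lowest[OF e] by blast
  have q: "q \<in> Q e" using k a b fst_eqD[of a q] snd_eqD[of b q] pq(2) by (auto simp: Q_iff)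
  then have kq: "fst (\<kappa> e) \<le> fst q" "snd (\<kappa> e) \<le> snd q" by (auto simp: Q_iff)
  have pe: "p \<notin> Q e" using k pq by (auto simp: Q_iff)
  obtain z2 where z2: "lab e z2 q"
    using remove_leftmost[OF e q] remove_lowest[OF e q] Q_not_q[OF e] k e q unfolding lab_def by force
  have "\<exists>z0\<in>carrier D. Q z0 = insert p (Q e)"
  proof (rule ex_elem)
    fix z u v assume z: "z \<in> P" "u \<in> insert p (Q e)" "v \<in> insert p (Q e)" "fst u \<le> fst z" "snd v \<le> snd z"
    show "z \<in> insert p (Q e)"
    proof (cases "z = p")
      case False
      have fz: "fst (\<kappa> e) \<le> fst z"
        using z(2,4) column_cases[OF z(1)] False kq by (auto simp: Q_iff)
      have "snd (\<kappa> e) \<le> snd z"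
      proof (cases "v = p")
        case True
        then have "snd q \<le> snd z" using row_cases[OF z(1)] False z(5) fz me by auto
        then show ?thesis using kq by simp
      next
        case False
        then show ?thesis using z(3,5) by (auto simp: Q_iff)
      qed
      then show ?thesis using fz z(1) by (auto simp: Q_iff)
    qed simp
  qed (use Q_sub pq in auto)
  then obtain z0 where z0: "z0 \<in> carrier D" "Q z0 = insert p (Q e)" by blast
  have "lab z0 e p" using z0 e pe by (auto simp: lab_def)
  moreover have "m < fst (\<kappa> z0)"
  proof -
    obtain w where "w \<in> Q z0" "fst w = fst (\<kappa> z0)" using ex_leftmost[OF z0(1)] by blast
    then show ?thesis using z0(2) pq me by (auto simp: Q_iff)
  qed
  ultimately show ?thesis using z2 by (auto simp: wing_inv_def)
qed

lemma consecutive_removal: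
  assumes a: "lab a0 a1 p" "lab a1 a2 q" and b: "lab a0 b0 t" "lab a1 b1 t" "lab a2 b2 t"
  shows "consecutive D (a0, a1, a2) (b0, b1, b2)"
proof -
  define g where "g i j = (if i = 0 then (if j = 0 then a0 else b0) else
    if i = 1 then (if j = 0 then a1 else b1) else (if j = 0 then a2 else b2))" for i j :: nat
  define s where "s i = (if i = 0 then p else q)" for i :: nat
  have im: "s ` {..<i} = (if i = 0 then {} else if i = 1 then {p} else {p, q})" if "i < 3" for i
  proof -
    have "i = 0 \<or> i = 1 \<or> i = 2" using that by auto
    moreover have "{..<1} = {0::nat}" "{..<2} = {0, 1::nat}" by auto
    ultimately show ?thesis by (auto simp: s_def)
  qed
  have tim: "(\<lambda>_. t) ` {..<j} = (if j = 0 then {} else {t})" for j :: nat by auto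
  have "cover_preserving_grid D 3 2 g"
  proof (rule labelled_grid[where S = "Q a0" and p = s and t = "\<lambda>_. t"])
    fix i j :: nat assume ij: "i < 3" "j < 2"
    show "g i j \<in> carrier D" using labD a b by (auto simp: g_def)
    show "Q (g i j) = Q a0 - s ` {..<i} - (\<lambda>_. t) ` {..<j}"
      unfolding im[OF ij(1)] tim using ij labD(5)[OF a(1)] labD(5)[OF a(2)] labD(5)[OF b(1)]
        labD(5)[OF b(2)] labD(5)[OF b(3)] by (auto simp: g_def)
  next
    fix i :: nat
    show "s i \<in> Q a0" using labD(3)[OF a(1)] labD(3)[OF a(2)] labD(5)[OF a(1)] by (auto simp: s_def)
    show "s i \<noteq> t" using labD(3)[OF b(2)] labD(3)[OF b(3)] labD(4)[OF a(1)] labD(4)[OF a(2)]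
      by (auto simp: s_def)
  next
    show "inj_on s {i. Suc i < 3}"
      using pq(4) by (auto simp: inj_on_def s_def)
  qed (use labD(3)[OF b(1)] in \<open>auto simp: inj_on_def\<close>)
  then show ?thesis
    unfolding consecutive_def by (intro exI[of _ g]) (simp add: g_def)
qed

text \<open>The climbing part of the wing, where the bottom stays in the row of \<open>p\<close>.
  The points of \<open>Q c0\<close> missing from \<open>Q z0\<close> lie to its left; restoring the
  rightmost of them to all three quadrants undoes one step.\<close>

lemma reach_up:
  assumes "wing_inv m p q (z0, z1, z2)" "snd (\<kappa> z0) = snd p"
  shows "(next_left D)\<^sup>*\<^sup>* (c0, c1, c2) (z0, z1, z2)"
  using assms
proof (induction "card (Q c0 - Q z0)" arbitrary: z0 z1 z2 rule: less_induct)
  case less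
  have z: "lab z0 z1 p" "lab z1 z2 q" "m < fst (\<kappa> z0)" using less.prems by (auto simp: wing_inv_def)
  have sub: "Q z0 \<subseteq> Q c0"
    unfolding Qc(1) using z(3) less.prems(2) by (auto simp: Q_iff)
  show ?case
  proof (cases "Q z0 = Q c0")
    case True
    have "z0 = c0" using Q_inj[OF labD(1)[OF z(1)] c(1) True] .
    moreover have "Q z1 = Q c1" using labD(5)[OF z(1)] labD(5)[OF start_lab(1)] True by simp
    then have "z1 = c1" using Q_inj labD(2)[OF z(1)] c(2) by blast
    moreover have "Q z2 = Q c2"
      using labD(5)[OF z(2)] labD(5)[OF start_lab(2)] \<open>Q z1 = Q c1\<close> by simp
    then have "z2 = c2" using Q_inj labD(2)[OF z(2)] c(3) by blast
    ultimately show ?thesis by simp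
  next
    case False
    then obtain t0 where "t0 \<in> Q c0 - Q z0" using sub by blast
    then have "\<exists>t\<in>Q c0 - Q z0. \<forall>w\<in>Q c0 - Q z0. fst w \<le> fst t"
      by (intro ex_maximizer) auto
    then obtain t where t: "t \<in> Q c0" "t \<notin> Q z0" and tmax: "\<And>w. w \<in> Q c0 \<Longrightarrow> w \<notin> Q z0 \<Longrightarrow> fst w \<le> fst t"
      by blast
    have tP: "t \<in> P" "m < fst t" "snd p \<le> snd t" using t Qc by auto
    have ft: "fst t < fst (\<kappa> z0)" using t(2) tP less.prems(2) by (auto simp: Q_iff)
    have pz: "p \<in> Q z0" "q \<in> Q z0" "q \<in> Q z1"
      using labD(3)[OF z(1)] labD(3)[OF z(2)] labD(5)[OF z(1)] by auto
    have "\<exists>y0\<in>carrier D. Q y0 = insert t (Q z0)"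
    proof (rule ex_elem)
      fix z u v assume w: "z \<in> P" "u \<in> insert t (Q z0)" "v \<in> insert t (Q z0)" "fst u \<le> fst z" "snd v \<le> snd z"
      have "fst t \<le> fst z" using w(2,4) ft by (auto simp: Q_iff)
      moreover have "snd p \<le> snd z" using w(3,5) tP(3) less.prems(2) by (auto simp: Q_iff)
      ultimately have "z \<in> Q c0" using tP w(1) Qc(1) by auto
      then show "z \<in> insert t (Q z0)"
        using tmax[of z] \<open>fst t \<le> fst z\<close> fst_eqD[OF w(1) tP(1)] by fastforce
    qed (use Q_sub tP in auto)
    then obtain y0 where y0: "y0 \<in> carrier D" "Q y0 = insert t (Q z0)" by blast
    have "snd (\<kappa> y0) = snd p"
    proof -
      obtain w where w: "w \<in> Q y0" "snd w = snd (\<kappa> y0)" using ex_lowest[OF y0(1)] by blast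
      have "w = t \<or> w \<in> Q z0" using w(1) y0(2) by blast
      then have "snd p \<le> snd w" using tP(3) less.prems(2) by (auto simp: Q_iff)
      moreover have "p \<in> Q y0" using y0(2) pz(1) by simp
      then have "snd (\<kappa> y0) \<le> snd p" by (simp add: Q_iff)
      ultimately show ?thesis using w(2) by simp
    qed
    moreover have "Q y0 \<noteq> {p}" using y0(2) pz pq(4) by auto
    ultimately obtain y1 where y1: "lab y0 y1 p"
      using remove_lowest[OF y0(1), of p] y0 pz unfolding lab_def by auto
    have Qy1: "Q y1 = insert t (Q z1)" using labD(5)[OF y1] y0(2) labD(5)[OF z(1)] t(2) pz by auto
    have "snd (\<kappa> y1) = snd q"
    proof -
      have qy: "q \<in> Q y1" using Qy1 pz by simp
      obtain w where w: "w \<in> Q y1" "snd w = snd (\<kappa> y1)" using ex_lowest[OF labD(2)[OF y1]] by blast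
      have "w \<in> Q c0" "w \<noteq> p" using w labD(5)[OF y1] y0(2) t sub by auto
      then have "snd q \<le> snd w" using row_cases[of w] Qc(1) by auto
      then show ?thesis using w qy by (auto simp: Q_iff)
    qed
    then obtain y2 where y2: "lab y1 y2 q"
      using remove_lowest[OF labD(2)[OF y1], of q] Q_not_q[OF labD(2)[OF y1]] Qy1 pz labD(2)[OF y1]
      unfolding lab_def by auto
    have Qy2: "Q y2 = insert t (Q z2)" using labD(5)[OF y2] Qy1 labD(5)[OF z(2)] t(2) pz by auto
    have lt: "lab y0 z0 t" "lab y1 z1 t" "lab y2 z2 t"
      using y0 labD(1,2)[OF y1] labD(2)[OF y2] labD(1,2)[OF z(1)] labD(2)[OF z(2)] Qy1 Qy2 t(2)
        labD(5)[OF z(1)] labD(5)[OF z(2)] by (auto simp: lab_def)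
    have inv: "wing_inv m p q (y0, y1, y2)"
    proof -
      obtain w where w: "w \<in> Q y0" "fst w = fst (\<kappa> y0)" using ex_leftmost[OF y0(1)] by blast
      have "w = t \<or> w \<in> Q z0" using w(1) y0(2) by blast
      then have "m < fst w" using tP z(3) by (auto simp: Q_iff)
      then have "m < fst (\<kappa> y0)" using w(2) by simp
      then show ?thesis using y1 y2 by (simp add: wing_inv_def)
    qed
    have "t \<in> Q y1" using Qy1 by simp
    then have "fst (\<kappa> y1) < fst (\<kappa> z0)" using ft by (simp add: Q_iff)
    then have "left_upper D y0 z0 y1" using left_ofI[OF lab_covers[OF lt(1)] lab_covers[OF y1]] by simp
    then have "next_left D (y0, y1, y2) (z0, z1, z2)"
      using consecutive_removal[OF y1 y2 lt] by simp
    moreover have "(next_left D)\<^sup>*\<^sup>* (c0, c1, c2) (y0, y1, y2)"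
    proof (rule less.hyps[OF _ inv \<open>snd (\<kappa> y0) = snd p\<close>])
      have "Q c0 - Q y0 \<subset> Q c0 - Q z0" using t y0(2) by auto
      then show "card (Q c0 - Q y0) < card (Q c0 - Q z0)" by (intro psubset_card_mono) auto
    qed
    ultimately show ?thesis by (rule rtranclp.rtrancl_into_rtrancl[rotated])
  qed
qed

text \<open>The descending part: when the bottom is off the row of \<open>p\<close>, it lies in the
  column of \<open>p\<close>. Deleting the lowest point from all three quadrants goes back one step,
  and this ends in the row of \<open>p\<close>, where \<open>reach_up\<close> applies.\<close>

lemma reach:
  assumes "wing_inv m p q (z0, z1, z2)"
  shows "(next_left D)\<^sup>*\<^sup>* (c0, c1, c2) (z0, z1, z2)"
  using assms
proof (induction "card (Q z0)" arbitrary: z0 z1 z2 rule: less_induct)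
  case less
  have z: "lab z0 z1 p" "lab z1 z2 q" "m < fst (\<kappa> z0)" using less.prems by (auto simp: wing_inv_def)
  have pz: "p \<in> Q z0" "q \<in> Q z0" "q \<in> Q z1"
    using labD(3)[OF z(1)] labD(3)[OF z(2)] labD(5)[OF z(1)] by auto
  show ?case
  proof (cases "snd (\<kappa> z0) = snd p")
    case True
    then show ?thesis using reach_up less.prems by blast
  next
    case False
    obtain w where w: "w \<in> Q z0" "snd w = snd (\<kappa> z0)" using ex_lowest labD(1)[OF z(1)] by blast
    have sw: "snd w < snd p" using pz(1) False w(2) by (auto simp: Q_iff)
    have fp: "fst (\<kappa> z0) = fst p" using lab_extremal[OF z(1)] False by auto
    have "w \<noteq> p" "w \<noteq> q" using sw pq(5) by auto
    then have w1: "w \<in> Q z1" "w \<in> Q z2" using w(1) labD(5)[OF z(1)] labD(5)[OF z(2)] by simp_all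
    have k1: "snd w = snd (\<kappa> z1)" "snd w = snd (\<kappa> z2)"
      using w1 kappa_mono[OF lab_covers[OF z(1)]] kappa_mono[OF lab_covers[OF z(2)]] w(2)
      by (auto simp: Q_iff less_eq_prod_def)
    have z2P: "Q z2 \<noteq> {w}"
    proof
      assume "Q z2 = {w}"
      obtain v where v: "v \<in> P" "\<And>z. z \<in> P \<Longrightarrow> z \<le> v" using ex_max by blast
      then have "v = w" using max_in_Q[OF v labD(2)[OF z(2)]] \<open>Q z2 = {w}\<close> by blast
      then show False using v(2)[OF pq(1)] sw by (auto simp: less_eq_prod_def)
    qed
    have ne: "Q z0 \<noteq> {w}" "Q z1 \<noteq> {w}" using pz \<open>w \<noteq> p\<close> \<open>w \<noteq> q\<close> by auto
    obtain y0 where y0: "lab z0 y0 w"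
      using remove_lowest[OF labD(1)[OF z(1)] w ne(1)] w labD(1)[OF z(1)] unfolding lab_def by blast
    obtain y1 where y1: "lab z1 y1 w"
      using remove_lowest[OF labD(2)[OF z(1)] w1(1) k1(1) ne(2)] w1 labD(2)[OF z(1)]
      unfolding lab_def by blast
    obtain y2 where y2: "lab z2 y2 w"
      using remove_lowest[OF labD(2)[OF z(2)] w1(2) k1(2) z2P] w1 labD(2)[OF z(2)]
      unfolding lab_def by blast
    have "Q y1 = Q y0 - {p}" "Q y2 = Q y1 - {q}" "p \<in> Q y0" "q \<in> Q y1"
      unfolding labD(5)[OF y0] labD(5)[OF y1] labD(5)[OF y2] labD(5)[OF z(2)]
      using labD(5)[OF z(1)] pz \<open>w \<noteq> p\<close> \<open>w \<noteq> q\<close> by blast+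
    then have l: "lab y0 y1 p" "lab y1 y2 q"
      using labD(2)[OF y0] labD(2)[OF y1] labD(2)[OF y2] by (simp_all add: lab_def)
    have "\<kappa> z0 \<le> \<kappa> y0" using kappa_mono[OF lab_covers[OF y0]] .
    then have inv: "wing_inv m p q (y0, y1, y2)" using l z(3) by (auto simp: wing_inv_def less_eq_prod_def)
    have "card (Q y0) < card (Q z0)"
      using labD(3,5)[OF y0] by (intro psubset_card_mono) auto
    then have r: "(next_left D)\<^sup>*\<^sup>* (c0, c1, c2) (y0, y1, y2)" using less.hyps inv by blast
    have "fst (\<kappa> y0) < fst (\<kappa> z1)"
    proof -
      have "fst (\<kappa> y0) \<le> fst p" using labD(3)[OF l(1)] by (simp add: Q_iff)
      moreover obtain v where v: "v \<in> Q z1" "fst v = fst (\<kappa> z1)" using ex_leftmost labD(2)[OF z(1)] by blast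
      then have "v \<in> Q z0" "v \<noteq> p" using labD(5)[OF z(1)] by auto
      then have "fst p < fst v" using fp fst_eqD[of v p] pq(1) by (force simp: Q_iff)
      ultimately show ?thesis using v by simp
    qed
    then have "left_upper D z0 z1 y0" using left_ofI[OF lab_covers[OF z(1)] lab_covers[OF y0]] by simp
    moreover have "consecutive D (y0, y1, y2) (z0, z1, z2)"
      using consecutive_removal[OF z(1,2) y0 y1 y2] consecutive_sym by blast
    ultimately have "next_left D (y0, y1, y2) (z0, z1, z2)" by simp
    with r show ?thesis by (rule rtranclp.rtrancl_into_rtrancl)
  qed
qed

lemma left_wing_middle:
  "middle ` left_wing D (c0, c1, c2) =
    {e \<in> carrier D. snd (\<kappa> e) = snd q \<and> m < fst (\<kappa> e) \<or> fst (\<kappa> e) = fst q}"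
proof (intro equalityI subsetI)
  fix e assume "e \<in> middle ` left_wing D (c0, c1, c2)"
  then obtain z0 z2 where "(next_left D)\<^sup>*\<^sup>* (c0, c1, c2) (z0, e, z2)"
    by (auto simp: left_wing_eq middle_def)
  then have i: "wing_inv m p q (z0, e, z2)" using wing_inv_reach start_inv pq(3) by blast
  then have "e \<in> carrier D" using labD(2)[of z0 e p] by (auto simp: wing_inv_def)
  then show "e \<in> {e \<in> carrier D. snd (\<kappa> e) = snd q \<and> m < fst (\<kappa> e) \<or> fst (\<kappa> e) = fst q}"
    using middle_coordinates[OF i] by blast
next
  fix e assume "e \<in> {e \<in> carrier D. snd (\<kappa> e) = snd q \<and> m < fst (\<kappa> e) \<or> fst (\<kappa> e) = fst q}"
  then obtain z0 z2 where "wing_inv m p q (z0, e, z2)" using chain_at_middle by blast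
  then have "(z0, e, z2) \<in> left_wing D (c0, c1, c2)" using reach by (simp add: left_wing_eq)
  then show "e \<in> middle ` left_wing D (c0, c1, c2)"
    by (rule image_eqI[rotated]) (simp add: middle_def)
qed

text \<open>The half-planes starting in the adjacent columns of \<open>p\<close> and of
  \<open>q\<close> begin the last chain. All its elements are on the left boundary, and a further
  step would need an element to the left of one of them.\<close>

lemma left_wing_end:
  "\<exists>Z\<in>left_wing D (c0, c1, c2). (\<nexists>Y. next_left D Z Y) \<and> chain3_set Z \<subseteq> boundary D"
proof -
  obtain z0 where z0: "z0 \<in> carrier D" "Q z0 = {w\<in>P. fst p \<le> fst w}"
    using ex_left_elem[OF pq(1) order_refl] by blast
  obtain z1 where z1: "z1 \<in> carrier D" "Q z1 = {w\<in>P. fst q \<le> fst w}"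
    using ex_left_elem[OF pq(2) order_refl] by blast
  have "fst q = fst (\<kappa> z1)"
  proof -
    obtain w where "w \<in> Q z1" "fst w = fst (\<kappa> z1)" using ex_leftmost[OF z1(1)] by blast
    moreover from this have "fst q \<le> fst w" using z1(2) by simp
    moreover have "q \<in> Q z1" using z1(2) pq(2) by simp
    then have "fst (\<kappa> z1) \<le> fst q" by (simp add: Q_iff)
    ultimately show ?thesis by simp
  qed
  then obtain z2 where z2: "lab z1 z2 q"
    using remove_leftmost[OF z1(1), of q] Q_not_q[OF z1(1)] z1 pq(2) unfolding lab_def by auto
  have "z \<in> Q z1 \<longleftrightarrow> z \<in> Q z0 \<and> z \<noteq> p" for z
    using column_cases[of z] z0(2) z1(2) pq by auto
  then have "Q z1 = Q z0 - {p}" by blast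
  then have l: "lab z0 z1 p" using z0 z1 pq by (simp add: lab_def)
  have "m < fst (\<kappa> z0)"
  proof -
    obtain w where "w \<in> Q z0" "fst w = fst (\<kappa> z0)" using ex_leftmost[OF z0(1)] by blast
    then show ?thesis using z0(2) pq(3) by auto
  qed
  then have "(z0, z1, z2) \<in> left_wing D (c0, c1, c2)"
    using reach l z2 by (simp add: left_wing_eq wing_inv_def)
  moreover have lb: "z0 \<in> left_boundary D" "z1 \<in> left_boundary D"
    using z0 z1 by (auto intro!: left_boundaryI)
  have "z2 \<in> left_boundary D"
  proof (rule left_boundaryI)
    show "z2 \<in> carrier D" using labD(2)[OF z2] .
    fix z w assume w: "z \<in> P" "w \<in> Q z2" "fst w \<le> fst z"
    then have "fst q < fst w" using labD(5)[OF z2] z1(2) fst_eqD[of w q] pq(2) by force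
    then show "z \<in> Q z2" using w labD(5)[OF z2] z1(2) by auto
  qed
  moreover have "\<not> next_left D (z0, z1, z2) Y" for Y
  proof (cases Y)
    case (fields y0 y1 y2)
    then show ?thesis using lb left_boundary_iff left_upper_iff by auto
  qed
  ultimately show ?thesis
    using lb by (intro bexI[of _ "(z0, z1, z2)"]) (auto simp: chain3_set_def boundary_def)
qed

end

text \<open>The labels of a square with a scheme: \<open>a1\<close>, \<open>a2\<close> on its lower
  left side, \<open>b1\<close>, \<open>b2\<close> on its lower right side. The conditions on the
  strips between \<open>a1\<close> and \<open>a2\<close> and between \<open>b1\<close> and
  \<open>b2\<close> make it a cover-preserving square; the last two conditions make the wings end on
  the boundary.\<close>

definition resectable ::
    "(real \<times> real) set \<Rightarrow> real \<times> real \<Rightarrow> real \<times> real \<Rightarrow> real \<times> real \<Rightarrow> real \<times> real \<Rightarrow> bool" where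
  "resectable P a1 a2 b1 b2 \<longleftrightarrow> {a1, a2, b1, b2} \<subseteq> P \<and>
     fst a1 < fst a2 \<and> fst a2 < fst b1 \<and> fst b1 < fst b2 \<and>
     snd b1 < snd b2 \<and> snd b2 < snd a1 \<and> snd a1 < snd a2 \<and>
     (\<forall>z\<in>P. fst a1 < fst z \<longrightarrow> fst z < fst a2 \<longrightarrow> snd z < snd b1) \<and>
     (\<forall>z\<in>P. snd b1 < snd z \<longrightarrow> snd z < snd b2 \<longrightarrow> fst z < fst a1) \<and>
     (\<forall>z\<in>P. fst b1 < fst z \<longrightarrow> fst b2 \<le> fst z) \<and>
     (\<forall>z\<in>P. snd a1 < snd z \<longrightarrow> snd a2 \<le> snd z)"

lemma resectableD:
  assumes "resectable P a1 a2 b1 b2"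
  shows "a1 \<in> P" "a2 \<in> P" "b1 \<in> P" "b2 \<in> P" "fst a1 < fst a2" "fst a2 < fst b1" "fst b1 < fst b2"
    "snd b1 < snd b2" "snd b2 < snd a1" "snd a1 < snd a2"
    "\<And>z. z \<in> P \<Longrightarrow> fst a1 < fst z \<Longrightarrow> fst z < fst a2 \<Longrightarrow> snd z < snd b1"
    "\<And>z. z \<in> P \<Longrightarrow> snd b1 < snd z \<Longrightarrow> snd z < snd b2 \<Longrightarrow> fst z < fst a1"
    "\<And>z. z \<in> P \<Longrightarrow> fst b1 < fst z \<Longrightarrow> fst b2 \<le> fst z"
    "\<And>z. z \<in> P \<Longrightarrow> snd a1 < snd z \<Longrightarrow> snd a2 \<le> snd z"
  using assms unfolding resectable_def by blast+

text \<open>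
  In coordinates, the interior elements of the scheme other than its anchor, which is
  \<open>(fst a2, snd b2)\<close>: the first two disjuncts come from the left wing, the others from the right wing.
\<close>

definition removed :: "real \<times> real \<Rightarrow> real \<times> real \<Rightarrow> real \<times> real \<Rightarrow> bool" where
  "removed a2 b2 e \<longleftrightarrow> snd e = snd b2 \<and> fst a2 < fst e \<or> fst e = fst b2 \<or>
     fst e = fst a2 \<and> snd b2 < snd e \<or> snd e = snd a2"

definition reduce :: "(real \<times> real) set \<Rightarrow> real \<times> real \<Rightarrow> real \<times> real \<Rightarrow> (real \<times> real) set" where
  "reduce P a2 b2 = insert (fst a2, snd b2) (P - {a2, b2})"

text \<open>The new set has no point in the column of \<open>b2\<close> or in the row of
  \<open>a2\<close>, while the column of \<open>a2\<close> and the row of \<open>b2\<close> now end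
  at the new point. These are the four ways in which a corner can cease to be tight.\<close>

lemma tight_reduce:
  assumes inj: "inj_on fst P" "inj_on snd P" and ab: "a2 \<in> P" "b2 \<in> P" "fst a2 < fst b2" "snd b2 < snd a2"
  shows "tight (reduce P a2 b2) = {p \<in> tight P. \<not> removed a2 b2 p}"
proof (intro equalityI subsetI)
  have fe: "z = w" if "z \<in> P" "w \<in> P" "fst z = fst w" for z w using inj(1) that by (auto simp: inj_on_def)
  have se: "z = w" if "z \<in> P" "w \<in> P" "snd z = snd w" for z w using inj(2) that by (auto simp: inj_on_def)
  fix p
  {
    assume "p \<in> tight (reduce P a2 b2)"
    then obtain z w where z: "z \<in> reduce P a2 b2" "fst z = fst p" "snd p \<le> snd z"
      and w: "w \<in> reduce P a2 b2" "snd w = snd p" "fst p \<le> fst w"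
      by (auto simp: tight_def)
    have "\<exists>z'\<in>P. fst z' = fst p \<and> snd p \<le> snd z'"
    proof (cases "z \<in> P")
      case True then show ?thesis using z by blast
    next
      case False
      then have "z = (fst a2, snd b2)" using z(1) by (auto simp: reduce_def)
      then show ?thesis using z ab by (intro bexI[of _ a2]) auto
    qed
    then obtain z' where z': "z' \<in> P" "fst z' = fst p" "snd p \<le> snd z'" by blast
    have "\<exists>w'\<in>P. snd w' = snd p \<and> fst p \<le> fst w'"
    proof (cases "w \<in> P")
      case True then show ?thesis using w by blast
    next
      case False
      then have "w = (fst a2, snd b2)" using w(1) by (auto simp: reduce_def)
      then show ?thesis using w ab by (intro bexI[of _ b2]) auto
    qed
    then obtain w' where w': "w' \<in> P" "snd w' = snd p" "fst p \<le> fst w'" by blast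
    have "p \<in> tight P" by (rule tightI[OF z' w'])
    moreover have "fst p \<noteq> fst b2"
    proof
      assume "fst p = fst b2"
      then show False using z(1,2) fe[of z b2] ab by (auto simp: reduce_def)
    qed
    moreover have "snd p \<noteq> snd a2"
    proof
      assume "snd p = snd a2"
      then show False using w(1,2) se[of w a2] ab by (auto simp: reduce_def)
    qed
    moreover have "snd p \<le> snd b2" if "fst p = fst a2"
      using z that fe[of z a2] ab by (auto simp: reduce_def)
    moreover have "fst p \<le> fst a2" if "snd p = snd b2"
      using w that se[of w b2] ab by (auto simp: reduce_def)
    ultimately show "p \<in> {p \<in> tight P. \<not> removed a2 b2 p}" by (auto simp: removed_def)
  }
  {
    assume "p \<in> {p \<in> tight P. \<not> removed a2 b2 p}"
    then have t: "p \<in> tight P" and n: "fst p \<noteq> fst b2" "snd p \<noteq> snd a2"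
      "fst p = fst a2 \<Longrightarrow> snd p \<le> snd b2" "snd p = snd b2 \<Longrightarrow> fst p \<le> fst a2"
      by (auto simp: removed_def)
    obtain z w where z: "z \<in> P" "fst z = fst p" "snd p \<le> snd z"
      and w: "w \<in> P" "snd w = snd p" "fst p \<le> fst w"
      using t by (auto simp: tight_def)
    have "\<exists>z'\<in>reduce P a2 b2. fst z' = fst p \<and> snd p \<le> snd z'"
    proof (cases "z = a2")
      case True
      then show ?thesis using z n(3) by (intro bexI[of _ "(fst a2, snd b2)"]) (auto simp: reduce_def)
    next
      case False
      then show ?thesis using z n(1) by (intro bexI[of _ z]) (auto simp: reduce_def)
    qed
    then obtain z' where z': "z' \<in> reduce P a2 b2" "fst z' = fst p" "snd p \<le> snd z'" by blast
    have "\<exists>w'\<in>reduce P a2 b2. snd w' = snd p \<and> fst p \<le> fst w'"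
    proof (cases "w = b2")
      case True
      then show ?thesis using w n(4) by (intro bexI[of _ "(fst a2, snd b2)"]) (auto simp: reduce_def)
    next
      case False
      then show ?thesis using w n(2) by (intro bexI[of _ w]) (auto simp: reduce_def)
    qed
    then obtain w' where w': "w' \<in> reduce P a2 b2" "snd w' = snd p" "fst p \<le> fst w'" by blast
    show "p \<in> tight (reduce P a2 b2)" by (rule tightI[OF z' w'])
  }
qed

lemma config_reduce:
  assumes P: "config P" and ab: "a2 \<in> P" "b2 \<in> P" "fst a2 < fst b2" "snd b2 < snd a2"
  shows "config (reduce P a2 b2)"
proof -
  have fe: "z = w" if "z \<in> P" "w \<in> P" "fst z = fst w" for z w
    using P that by (auto simp: config_def inj_on_def)
  have se: "z = w" if "z \<in> P" "w \<in> P" "snd z = snd w" for z w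
    using P that by (auto simp: config_def inj_on_def)
  obtain w where w: "w \<in> P" "\<And>z. z \<in> P \<Longrightarrow> z \<le> w" using P by (auto simp: config_def)
  have "w \<noteq> a2" "w \<noteq> b2" using w(2)[OF ab(1)] w(2)[OF ab(2)] ab by (auto simp: less_eq_prod_def)
  then have "w \<in> reduce P a2 b2" using w(1) by (simp add: reduce_def)
  moreover have "z \<le> w" if "z \<in> reduce P a2 b2" for z
    using that w(2)[OF ab(1)] w(2)[OF ab(2)] w(2)[of z] by (auto simp: reduce_def less_eq_prod_def)
  moreover have "inj_on fst (reduce P a2 b2)"
  proof (rule inj_onI)
    fix z w assume h: "z \<in> reduce P a2 b2" "w \<in> reduce P a2 b2" "fst z = fst w"
    have "fst t \<noteq> fst a2" if "t \<in> P" "t \<noteq> a2" for t using fe[of t a2] ab that by blast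
    moreover have "t = (fst a2, snd b2) \<or> t \<in> P \<and> t \<noteq> a2" if "t \<in> reduce P a2 b2" for t
      using that by (auto simp: reduce_def)
    ultimately show "z = w" using h fe[of z w] by (metis fst_conv)
  qed
  moreover have "inj_on snd (reduce P a2 b2)"
  proof (rule inj_onI)
    fix z w assume h: "z \<in> reduce P a2 b2" "w \<in> reduce P a2 b2" "snd z = snd w"
    have "snd t \<noteq> snd b2" if "t \<in> P" "t \<noteq> b2" for t using se[of t b2] ab that by blast
    moreover have "t = (fst a2, snd b2) \<or> t \<in> P \<and> t \<noteq> b2" if "t \<in> reduce P a2 b2" for t
      using that by (auto simp: reduce_def)
    ultimately show "z = w" using h se[of z w] by (metis snd_conv)
  qed
  moreover have "finite (reduce P a2 b2)" using P by (simp add: reduce_def config_def)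
  ultimately show ?thesis unfolding config_def by blast
qed

text \<open>The descent from \<open>a2\<close> to \<open>b1\<close> cannot occur beyond
  \<open>u\<close>, so \<open>a2\<close> lies to the left of \<open>u\<close>; likewise
  \<open>b2\<close> lies below \<open>v\<close>. Hence the new point belongs to neither of the two
  increasing sequences.\<close>

lemma rect_at_reduce:
  assumes r: "rect_at P u v" and s: "resectable P a1 a2 b1 b2"
  shows "rect_at (reduce P a2 b2) u v"
proof -
  note r = rect_atD[OF r] and s = resectableD[OF s]
  have u2: "u \<noteq> a2" "u \<noteq> b2" using r(4)[OF s(3)] s by auto
  have v2: "v \<noteq> a2" "v \<noteq> b2" using r(5)[OF s(1)] s by auto
  have a: "fst a2 < fst u"
  proof (rule ccontr)
    assume "\<not> fst a2 < fst u"
    then show False using r(6)[OF s(2,3)] s by auto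
  qed
  have b: "snd b2 < snd v"
  proof (rule ccontr)
    assume "\<not> snd b2 < snd v"
    then show False using r(7)[OF s(4,1)] s by auto
  qed
  have new: "z \<in> reduce P a2 b2 \<Longrightarrow> fst u \<le> fst z \<or> snd v \<le> snd z \<Longrightarrow> z \<in> P" for z
    using a b by (auto simp: reduce_def)
  have low: "snd u \<le> snd z" "fst v \<le> fst z" if "z \<in> reduce P a2 b2" for z
    using that r(4)[OF s(4)] r(5)[OF s(2)] r(4)[of z] r(5)[of z] by (auto simp: reduce_def)
  have mem: "u \<in> reduce P a2 b2" "v \<in> reduce P a2 b2" using u2 v2 r by (auto simp: reduce_def)
  have up: "w \<le> z" if z: "z \<in> reduce P a2 b2" "fst u \<le> fst z" "snd v \<le> snd z" and w: "w \<in> reduce P a2 b2" for z w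
  proof (cases "w \<in> P")
    case True
    then show ?thesis using r(8) new z by blast
  next
    case False
    then have "w = (fst a2, snd b2)" using w by (auto simp: reduce_def)
    then show ?thesis using r(8)[OF new, of z a2] r(8)[OF new, of z b2] z s by (auto simp: less_eq_prod_def)
  qed
  show ?thesis
    unfolding rect_at_def
  proof (intro conjI ballI impI)
    fix z t assume zt: "z \<in> reduce P a2 b2" "t \<in> reduce P a2 b2"
    { assume "fst u \<le> fst z" "fst z < fst t"
      then show "snd z < snd t" using r(6)[of z t] new zt by auto }
    { assume "snd v \<le> snd z" "snd z < snd t"
      then show "fst z < fst t" using r(7)[of z t] new zt by auto }
  qed (use mem r(3) low up in auto)
qed

lemma resectable_swap:
  "resectable P a1 a2 b1 b2 \<Longrightarrow>
    resectable (prod.swap ` P) (prod.swap b1) (prod.swap b2) (prod.swap a1) (prod.swap a2)"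
  unfolding resectable_def by auto

lemma less3_cases:
  fixes i :: nat
  assumes "i < 3"
  obtains "i = 0" | "i = 1" | "i = 2"
  using assms by fastforce

context represented
begin

section \<open>Resectable points and schemes\<close>

lemma Q_mirror: "represented.Q (prod.swap \<circ> \<kappa>) (prod.swap ` P) x = prod.swap ` Q x"
proof -
  interpret m: represented "mirror D" "prod.swap \<circ> \<kappa>" "prod.swap ` P" by (rule rep_mirror)
  show ?thesis by (auto simp: m.Q_iff Q_iff)
qed

lemma lab_mirror: "represented.lab (mirror D) (prod.swap \<circ> \<kappa>) (prod.swap ` P) x y (prod.swap p) \<longleftrightarrow> lab x y p"
proof -
  interpret m: represented "mirror D" "prod.swap \<circ> \<kappa>" "prod.swap ` P" by (rule rep_mirror)
  have "prod.swap ` A = prod.swap ` B - {prod.swap p} \<longleftrightarrow> A = B - {p}" for A B :: "(real \<times> real) set"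
    by (metis (no_types, lifting) image_empty image_insert image_set_diff inj_image_eq_iff inj_swap)
  then show ?thesis
    by (simp add: m.lab_def lab_def Q_mirror inj_image_mem_iff[OF inj_swap])
qed

text \<open>The nine quadrants of a square with labels \<open>a1\<close>, \<open>a2\<close>,
  \<open>b1\<close>, \<open>b2\<close>. The strict inequalities at index 2 express that
  \<open>a2\<close> and \<open>b2\<close> themselves are gone.\<close>

definition framed ::
    "(nat \<Rightarrow> nat \<Rightarrow> 'a) \<Rightarrow> real \<times> real \<Rightarrow> real \<times> real \<Rightarrow> real \<times> real \<Rightarrow> real \<times> real \<Rightarrow> bool" where
  "framed f a1 a2 b1 b2 \<longleftrightarrow> (\<forall>i<3. \<forall>j<3. f i j \<in> carrier D \<and> Q (f i j) = {z\<in>P.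
     (if i = 0 then fst a1 \<le> fst z else if i = 1 then fst a2 \<le> fst z else fst a2 < fst z) \<and>
     (if j = 0 then snd b1 \<le> snd z else if j = 1 then snd b2 \<le> snd z else snd b2 < snd z)})"

lemma framed_left_scheme:
  assumes s: "resectable P a1 a2 b1 b2" and f: "framed f a1 a2 b1 b2"
  shows "left_scheme D \<kappa> P (fst a2) b1 b2 (f 2 0) (f 2 1) (f 2 2)"
proof
  note s = resectableD[OF s]
  show "f 2 0 \<in> carrier D" "f 2 1 \<in> carrier D" "f 2 2 \<in> carrier D"
    "Q (f 2 0) = {z \<in> P. fst a2 < fst z \<and> snd b1 \<le> snd z}"
    "Q (f 2 1) = {z \<in> P. fst a2 < fst z \<and> snd b2 \<le> snd z}"
    "Q (f 2 2) = {z \<in> P. fst a2 < fst z \<and> snd b2 < snd z}"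
    using f by (auto simp: framed_def)
  show "b1 \<in> P" "b2 \<in> P" "fst a2 < fst b1" "fst b1 < fst b2" "snd b1 < snd b2" using s by auto
  show False if "z \<in> P" "fst b1 < fst z" "fst z < fst b2" for z using s(13)[OF that(1,2)] that(3) by simp
  show False if "z \<in> P" "fst a2 < fst z" "snd b1 < snd z" "snd z < snd b2" for z
    using s(12)[OF that(1,3,4)] s(5) that(2) by simp
qed

lemma framed_mirror:
  assumes f: "framed f a1 a2 b1 b2"
  shows "represented.framed (mirror D) (prod.swap \<circ> \<kappa>) (prod.swap ` P) (\<lambda>i j. f j i)
    (prod.swap b1) (prod.swap b2) (prod.swap a1) (prod.swap a2)"
proof -
  interpret m: represented "mirror D" "prod.swap \<circ> \<kappa>" "prod.swap ` P" by (rule rep_mirror)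
  have "prod.swap ` {z\<in>P. A z \<and> B z} = {z\<in>prod.swap ` P. B (prod.swap z) \<and> A (prod.swap z)}" for A B
    by auto
  then show ?thesis
    using f unfolding m.framed_def framed_def Q_mirror by simp
qed

lemma framed_anchor:
  assumes s: "resectable P a1 a2 b1 b2" and f: "framed f a1 a2 b1 b2"
  shows "\<kappa> (f 1 1) = (fst a2, snd b2)" "\<not> removed a2 b2 (\<kappa> (f 1 1))"
proof -
  note s = resectableD[OF s]
  have c: "f 1 1 \<in> carrier D" and q: "Q (f 1 1) = {z\<in>P. fst a2 \<le> fst z \<and> snd b2 \<le> snd z}"
    using f by (auto simp: framed_def)
  have "a2 \<in> Q (f 1 1)" "b2 \<in> Q (f 1 1)" using q s by auto
  then have "fst (\<kappa> (f 1 1)) \<le> fst a2" "snd (\<kappa> (f 1 1)) \<le> snd b2" by (auto simp: Q_iff)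
  moreover obtain w where "w \<in> Q (f 1 1)" "fst w = fst (\<kappa> (f 1 1))" using ex_leftmost[OF c] by blast
  moreover obtain w' where "w' \<in> Q (f 1 1)" "snd w' = snd (\<kappa> (f 1 1))" using ex_lowest[OF c] by blast
  ultimately show "\<kappa> (f 1 1) = (fst a2, snd b2)" unfolding q by (auto simp: prod_eq_iff)
  then show "\<not> removed a2 b2 (\<kappa> (f 1 1))" using s by (auto simp: removed_def)
qed

lemma framed_interior:
  assumes s: "resectable P a1 a2 b1 b2" and f: "framed f a1 a2 b1 b2"
  shows "scheme_interior D f - {f 1 1} = {e \<in> carrier D. removed a2 b2 (\<kappa> e)}"
proof -
  interpret m: represented "mirror D" "prod.swap \<circ> \<kappa>" "prod.swap ` P" by (rule rep_mirror)
  interpret L: left_scheme D \<kappa> P "fst a2" b1 b2 "f 2 0" "f 2 1" "f 2 2"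
    by (rule framed_left_scheme[OF assms])
  interpret R: left_scheme "mirror D" "prod.swap \<circ> \<kappa>" "prod.swap ` P" "snd b2" "prod.swap a1" "prod.swap a2"
    "f 0 2" "f 1 2" "f 2 2"
    using m.framed_left_scheme[OF resectable_swap[OF s] framed_mirror[OF f]] by simp
  have "scheme_interior D f = {f 1 1} \<union> {e \<in> carrier D. removed a2 b2 (\<kappa> e)}"
    unfolding scheme_interior_def scheme_left_wing_def scheme_right_wing_def right_wing_mirror
      L.left_wing_middle R.left_wing_middle by (auto simp: removed_def)
  then show ?thesis using framed_anchor[OF assms] by auto
qed

text \<open>The strip conditions ensure that raising a threshold from \<open>a1\<close> to
  \<open>a2\<close>, or from \<open>b1\<close> to \<open>b2\<close>, loses a single point of the
  square, so that neighbouring quadrants form coverings.\<close>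

lemma resectable_scheme:
  assumes s: "resectable P a1 a2 b1 b2"
  shows "\<exists>f. C3_scheme D f \<and> scheme_interior D f - {f 1 1} = {e \<in> carrier D. removed a2 b2 (\<kappa> e)}"
proof -
  note s' = resectableD[OF s]
  define U where "U i j = {z\<in>P.
     (if i = 0 then fst a1 \<le> fst z else if i = 1 then fst a2 \<le> fst z else fst a2 < fst z) \<and>
     (if j = 0 then snd b1 \<le> snd z else if j = 1 then snd b2 \<le> snd z else snd b2 < snd z)}" for i j :: nat
  obtain w where w: "w \<in> P" "\<And>z. z \<in> P \<Longrightarrow> z \<le> w" using ex_max by blast
  have wU: "w \<in> U i j" for i j
    using w(1) w(2)[OF s'(4)] w(2)[OF s'(2)] s' by (auto simp: U_def less_eq_prod_def)
  have "\<exists>x\<in>carrier D. Q x = U i j" for i j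
  proof (rule ex_elem)
    show "U i j \<noteq> {}" using wU by blast
  qed (auto simp: U_def split: if_splits)
  then obtain f where f: "\<And>i j. f i j \<in> carrier D" "\<And>i j. Q (f i j) = U i j" by metis
  have fr: "framed f a1 a2 b1 b2" using f by (simp add: framed_def U_def)
  define p t where "p i = (if i = 0 then a1 else a2)" and "t j = (if j = 0 then b1 else b2)" for i j :: nat
  have pim: "p ` {..<0} = {}" "p ` {..<1} = {a1}" "p ` {..<2} = {a1, a2}"
    "t ` {..<0} = {}" "t ` {..<1} = {b1}" "t ` {..<2} = {b1, b2}"
    by (auto simp: p_def t_def lessThan_Suc numeral_2_eq_2)
  have col: "fst a2 \<le> fst z \<longleftrightarrow> z \<noteq> a1" "fst a2 < fst z \<longleftrightarrow> z \<noteq> a1 \<and> z \<noteq> a2"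
    if "z \<in> P" "fst a1 \<le> fst z" "snd b1 \<le> snd z" for z
    using s'(11)[OF that(1)] fst_eqD[OF that(1) s'(1)] fst_eqD[OF that(1) s'(2)] s'(5) that by force+
  have row: "snd b2 \<le> snd z \<longleftrightarrow> z \<noteq> b1" "snd b2 < snd z \<longleftrightarrow> z \<noteq> b1 \<and> z \<noteq> b2"
    if "z \<in> P" "fst a1 \<le> fst z" "snd b1 \<le> snd z" for z
    using s'(12)[OF that(1)] snd_eqD[OF that(1) s'(3)] snd_eqD[OF that(1) s'(4)] s'(8) that by force+
  have QU: "U i j = U 0 0 - p ` {..<i} - t ` {..<j}" if "i < 3" "j < 3" for i j
  proof -
    have "z \<in> U i j \<longleftrightarrow> z \<in> U 0 0 - p ` {..<i} - t ` {..<j}" for z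
    proof (cases "z \<in> U 0 0")
      case True
      then have z: "z \<in> P" "fst a1 \<le> fst z" "snd b1 \<le> snd z" by (auto simp: U_def)
      have "i = 0 \<or> i = 1 \<or> i = 2" "j = 0 \<or> j = 1 \<or> j = 2" using that by auto
      then show ?thesis
        using z col[OF z] row[OF z] by (elim disjE; hypsubst) (simp_all add: U_def pim del: One_nat_def)
    next
      case False
      then show ?thesis using s' by (auto simp: U_def split: if_splits)
    qed
    then show ?thesis by blast
  qed
  have cg: "cover_preserving_grid D 3 3 f"
  proof (rule labelled_grid[where S = "U 0 0" and p = p and t = t])
    show "inj_on p {i. Suc i < 3}" "inj_on t {j. Suc j < 3}"
      using s' by (auto simp: inj_on_def p_def t_def)
    show "p i \<in> U 0 0" "t i \<in> U 0 0" for i using s' by (auto simp: p_def t_def U_def)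
    show "p i \<noteq> t j" for i j using s' by (auto simp: p_def t_def)
    show "f i j \<in> carrier D" for i j by (rule f(1))
    show "Q (f i j) = U 0 0 - p ` {..<i} - t ` {..<j}" if "i < 3" "j < 3" for i j
      using QU[OF that] f(2)[of i j] by simp
  qed
  then have "covers D (f 0 0) (f 1 0)" "covers D (f 0 0) (f 0 1)"
    by (simp_all add: cover_preserving_grid_def)
  moreover have "fst (\<kappa> (f 0 1)) < fst (\<kappa> (f 1 0))"
  proof -
    have "a1 \<in> Q (f 0 1)" using f(2) s' by (simp add: U_def)
    then have "fst (\<kappa> (f 0 1)) \<le> fst a1" by (simp add: Q_iff)
    moreover obtain w where "w \<in> Q (f 1 0)" "fst w = fst (\<kappa> (f 1 0))" using ex_leftmost f(1) by blast
    then have "fst a2 \<le> fst (\<kappa> (f 1 0))" using f(2)[of 1 0] by (auto simp: U_def)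
    ultimately show ?thesis using s' by simp
  qed
  ultimately have "left_upper D (f 0 0) (f 1 0) (f 0 1)" by (rule left_ofI)
  then have oc: "oriented_C3_square D f" using cg by (simp add: oriented_C3_square_def)
  interpret m: represented "mirror D" "prod.swap \<circ> \<kappa>" "prod.swap ` P" by (rule rep_mirror)
  interpret L: left_scheme D \<kappa> P "fst a2" b1 b2 "f 2 0" "f 2 1" "f 2 2"
    by (rule framed_left_scheme[OF s fr])
  interpret R: left_scheme "mirror D" "prod.swap \<circ> \<kappa>" "prod.swap ` P" "snd b2" "prod.swap a1" "prod.swap a2"
    "f 0 2" "f 1 2" "f 2 2"
    using m.framed_left_scheme[OF resectable_swap[OF s] framed_mirror[OF fr]] by simp
  have "C3_scheme D f"
    unfolding C3_scheme_def scheme_left_wing_def scheme_right_wing_def right_wing_mirror next_right_mirror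
    using oc L.left_wing_end R.left_wing_end boundary_mirror(3)[OF planar] by simp
  then show ?thesis using framed_interior[OF s fr] by blast
qed

text \<open>In every chain of the wing the first two elements are to the left of \<open>d\<close>.
  So in the last chain they lie on the left boundary, and their quadrants are half-planes. If some
  column separated \<open>p\<close> from \<open>q\<close>, then \<open>q\<close> would be the lowest
  point to the right of \<open>p\<close>. This puts \<open>p\<close> in the column of
  \<open>u\<close> or beyond, where the points increase, and a point in between would be lower than
  \<open>q\<close>. Rectangularity enters here.\<close>

lemma wing_adjacent:
  assumes r: "(next_left D)\<^sup>*\<^sup>* (c0, c1, c2) (z0, z1, z2)"
    and c: "lab c0 c1 p" "lab c1 c2 q" "m < fst (\<kappa> c0)" "m < fst p" and pq: "snd p < snd q"
    and b: "chain3_set (z0, z1, z2) \<subseteq> boundary D"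
    and d: "d \<in> carrier D" "fst (\<kappa> d) \<le> m" "snd q < snd (\<kappa> d)"
    and rect: "rect_at P u v"
  shows "fst p < fst q" "\<And>z. z \<in> P \<Longrightarrow> fst p < fst z \<Longrightarrow> fst q \<le> fst z"
proof -
  have "wing_inv m p q (z0, z1, z2)"
    using wing_inv_reach[OF r _ c(4)] c by (simp add: wing_inv_def)
  then have z: "lab z0 z1 p" "lab z1 z2 q" "m < fst (\<kappa> z0)" by (auto simp: wing_inv_def)
  have "p \<in> Q z0" "q \<in> Q z1" using labD(3) z by blast+
  then have k: "fst (\<kappa> z0) \<le> fst p" "snd (\<kappa> z0) \<le> snd p" "fst (\<kappa> z1) \<le> fst q" "snd (\<kappa> z1) \<le> snd q"
    by (auto simp: Q_iff)
  have k01: "fst (\<kappa> z0) \<le> fst (\<kappa> z1)"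
    using kappa_mono[OF lab_covers[OF z(1)]] by (simp add: less_eq_prod_def)
  note zc = labD(1,2)[OF z(1)]
  have nr: "left_of D z0 d" "left_of D z1 d"
    using left_iff[OF zc(1) d(1)] left_iff[OF zc(2) d(1)] k k01 d pq z(3) by auto
  then have lb: "z0 \<in> left_boundary D" "z1 \<in> left_boundary D"
    using b right_boundary_iff by (auto simp: chain3_set_def boundary_def)
  have Q0: "Q z0 = {w\<in>P. fst (\<kappa> z0) \<le> fst w}" and Q1: "Q z1 = {w\<in>P. fst (\<kappa> z1) \<le> fst w}"
    using left_boundary_Q_eq lb by auto
  have pz: "p \<notin> Q z1" "p \<in> P" "q \<in> P" using labD(4)[OF z(1)] labD(6)[OF z(1)] labD(6)[OF z(2)] by auto
  then have p1: "fst p < fst (\<kappa> z1)" unfolding Q1 by simp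
  then show lt: "fst p < fst q" using k(3) by simp
  fix t assume t: "t \<in> P" "fst p < fst t"
  show "fst q \<le> fst t"
  proof (rule ccontr)
    assume nt: "\<not> fst q \<le> fst t"
    have above: "w \<in> Q z1" if "w \<in> P" "fst p < fst w" for w
      using that k(1) labD(5)[OF z(1)] unfolding Q0 by auto
    have "fst q \<noteq> fst (\<kappa> z1)" using above[OF t] nt unfolding Q1 by auto
    then have "snd q = snd (\<kappa> z1)" using lab_extremal[OF z(2)] by blast
    then have low: "snd q \<le> snd w" if "w \<in> P" "fst p < fst w" for w
      using above[OF that] by (simp add: Q_iff)
    note rt = rect_atD[OF rect]
    have "\<not> fst p < fst u" using low[OF rt(1)] rt(4)[OF pz(2)] pq by auto
    then have "snd t < snd q" using rt(6)[OF t(1) pz(3)] t(2) nt by auto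
    then show False using low[OF t] by simp
  qed
qed

text \<open>Opposite sides of the cells have equal labels, so four labels determine all nine
  quadrants. The strip conditions hold because each covering deletes a single point; adjacency comes
  from the ends of the wings.\<close>

lemma scheme_resectable:
  assumes sch: "C3_scheme D f" and rect: "rect_at P u v"
  shows "\<exists>a1 a2 b1 b2. resectable P a1 a2 b1 b2 \<and> framed f a1 a2 b1 b2"
proof -
  have g: "cover_preserving_grid D 3 3 f" and lu: "left_upper D (f 0 0) (f 1 0) (f 0 1)"
    using sch by (auto simp: C3_scheme_def oriented_C3_square_def)
  have fc: "f i j \<in> carrier D" if "i < 3" "j < 3" for i j
    using g that by (simp add: cover_preserving_grid_def)
  have cov1: "covers D (f i j) (f (Suc i) j)" if "i < 2" "j < 3" for i j
    using g that by (simp add: cover_preserving_grid_def)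
  have cov2: "covers D (f i j) (f i (Suc j))" if "i < 3" "j < 2" for i j
    using g that by (simp add: cover_preserving_grid_def)
  have jn: "f i j \<squnion> f k l = f (max i k) (max j l)" if "i < 3" "j < 3" "k < 3" "l < 3" for i j k l
    using g that by (simp add: cover_preserving_grid_def)
  obtain a1 where a1: "lab (f 0 0) (f 1 0) a1" using covers_lab[OF cov1[of 0 0]] by auto
  obtain a2 where a2: "lab (f 1 0) (f 2 0) a2" using covers_lab[OF cov1[of 1 0]] by (auto simp: numeral_2_eq_2)
  obtain b1 where b1: "lab (f 0 0) (f 0 1) b1" using covers_lab[OF cov2[of 0 0]] by auto
  obtain b2 where b2: "lab (f 0 1) (f 0 2) b2" using covers_lab[OF cov2[of 0 1]] by (auto simp: numeral_2_eq_2)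
  have shift1: "lab (f i (Suc j)) (f (Suc i) (Suc j)) p" if "lab (f i j) (f (Suc i) j) p" "i < 2" "j < 2" for i j p
  proof -
    have "f (Suc i) j \<squnion> f i (Suc j) = f (Suc i) (Suc j)"
      using jn[of "Suc i" j i "Suc j"] that by (simp add: max_def)
    then show ?thesis
      using parallel_lab[OF cov1[of i j] cov1[of i "Suc j"], of p] coversD(3)[OF cov2[of i j]] that by simp
  qed
  have shift2: "lab (f (Suc i) j) (f (Suc i) (Suc j)) p" if "lab (f i j) (f i (Suc j)) p" "i < 2" "j < 2" for i j p
  proof -
    have "f i (Suc j) \<squnion> f (Suc i) j = f (Suc i) (Suc j)"
      using jn[of i "Suc j" "Suc i" j] that by (simp add: max_def)
    then show ?thesis
      using parallel_lab[OF cov2[of i j] cov2[of "Suc i" j], of p] coversD(3)[OF cov1[of i j]] that by simp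
  qed
  have a1': "lab (f 0 1) (f 1 1) a1" "lab (f 0 2) (f 1 2) a1"
    using shift1[of 0 0 a1] shift1[of 0 1 a1] a1 by (simp_all add: numeral_2_eq_2)
  have a2': "lab (f 1 1) (f 2 1) a2" "lab (f 1 2) (f 2 2) a2"
    using shift1[of 1 0 a2] shift1[of 1 1 a2] a2 by (simp_all add: numeral_2_eq_2)
  have b1': "lab (f 1 0) (f 1 1) b1" "lab (f 2 0) (f 2 1) b1"
    using shift2[of 0 0 b1] shift2[of 1 0 b1] b1 by (simp_all add: numeral_2_eq_2)
  have b2': "lab (f 1 1) (f 1 2) b2" "lab (f 2 1) (f 2 2) b2"
    using shift2[of 0 1 b2] shift2[of 1 1 b2] b2 by (simp_all add: numeral_2_eq_2)
  have P4: "a1 \<in> P" "a2 \<in> P" "b1 \<in> P" "b2 \<in> P" using labD(6) a1 a2 b1 b2 by blast+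
  have mem: "a1 \<in> Q (f 0 0)" "a2 \<in> Q (f 1 0)" "b1 \<in> Q (f 0 0)" "b2 \<in> Q (f 0 1)" "b1 \<in> Q (f 1 0)"
    "b1 \<in> Q (f 2 0)" "b2 \<in> Q (f 1 1)" "b2 \<in> Q (f 2 1)" "a1 \<in> Q (f 0 1)" "a1 \<in> Q (f 0 2)"
    "a2 \<in> Q (f 1 1)" "a2 \<in> Q (f 1 2)"
    using labD(3) a1 a2 b1 b2 a1' a2' b1' b2' by blast+
  have eqs: "Q (f 1 0) = Q (f 0 0) - {a1}" "Q (f 2 0) = Q (f 1 0) - {a2}" "Q (f 0 1) = Q (f 0 0) - {b1}"
    "Q (f 0 2) = Q (f 0 1) - {b2}" "Q (f 1 1) = Q (f 0 1) - {a1}" "Q (f 1 2) = Q (f 0 2) - {a1}"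
    "Q (f 2 1) = Q (f 1 1) - {a2}" "Q (f 2 2) = Q (f 1 2) - {a2}"
    using labD(5) a1 a2 b1 b2 a1' a2' by blast+
  have left: "left_of D (f 1 0) (f 0 1)" using lu left_upper_iff by blast
  then have lk: "fst (\<kappa> (f 0 1)) < fst (\<kappa> (f 1 0))" "snd (\<kappa> (f 1 0)) < snd (\<kappa> (f 0 1))"
    using left_iff fc by auto
  have mono: "\<kappa> (f 0 0) \<le> \<kappa> (f 0 1)" "\<kappa> (f 0 0) \<le> \<kappa> (f 1 0)" "\<kappa> (f 0 1) \<le> \<kappa> (f 0 2)" "\<kappa> (f 1 0) \<le> \<kappa> (f 2 0)"
    using kappa_mono cov1[of 0 0] cov2[of 0 0] cov1[of 1 0] cov2[of 0 1] by (auto simp: numeral_2_eq_2)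
  have fa1: "fst a1 = fst (\<kappa> (f 0 0))"
  proof -
    obtain w where w: "w \<in> Q (f 0 0)" "fst w = fst (\<kappa> (f 0 0))" using ex_leftmost[OF fc[of 0 0]] by auto
    have "w \<notin> Q (f 1 0)" using w lk(1) mono(1) by (auto simp: Q_iff less_eq_prod_def)
    then have "w = a1" using w eqs(1) by blast
    then show ?thesis using w by simp
  qed
  have sb1: "snd b1 = snd (\<kappa> (f 0 0))"
  proof -
    obtain w where w: "w \<in> Q (f 0 0)" "snd w = snd (\<kappa> (f 0 0))" using ex_lowest[OF fc[of 0 0]] by auto
    have "w \<notin> Q (f 0 1)" using w lk(2) mono(2) by (auto simp: Q_iff less_eq_prod_def)
    then have "w = b1" using w eqs(3) by blast
    then show ?thesis using w by simp
  qed
  have k10: "snd (\<kappa> (f 1 0)) = snd b1" using mem(5) mono(2) sb1 by (auto simp: Q_iff less_eq_prod_def)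
  have k01: "fst (\<kappa> (f 0 1)) = fst a1" using mem(9) mono(1) fa1 by (auto simp: Q_iff less_eq_prod_def)
  have ab: "a2 \<noteq> b1" "b2 \<noteq> a1" "a1 \<noteq> a2" "b1 \<noteq> b2" "a2 \<noteq> b2" using mem eqs by auto
  have fa2: "fst a2 = fst (\<kappa> (f 1 0))"
    using lab_extremal[OF a2] k10 snd_eqD[OF P4(2,3)] ab by auto
  have sb2: "snd b2 = snd (\<kappa> (f 0 1))"
    using lab_extremal[OF b2] k01 fst_eqD[OF P4(4,1)] ab by auto
  have lt: "fst a1 < fst a2" "snd b1 < snd b2" using lk k01 k10 fa2 sb2 by auto
  have "b2 \<in> Q (f 1 0)" using mem(4) eqs(1,3) ab by blast
  moreover have "a2 \<in> Q (f 0 1)" using mem(2) eqs(1,3) ab by blast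
  ultimately have ge: "fst a2 \<le> fst b1" "fst a2 \<le> fst b2" "snd b2 \<le> snd a1" "snd b2 \<le> snd a2"
    using mem(5) mem(9) fa2 sb2 unfolding Q_iff by simp_all
  then have gt: "fst a2 < fst b1" "fst a2 < fst b2" "snd b2 < snd a1" "snd b2 < snd a2"
    using fst_eqD[OF P4(2,3)] fst_eqD[OF P4(2,4)] snd_eqD[OF P4(4,1)] snd_eqD[OF P4(4,2)] ab
    by (auto simp: less_le)
  have Q00: "Q (f 0 0) = {z\<in>P. fst a1 \<le> fst z \<and> snd b1 \<le> snd z}"
    and Q10: "Q (f 1 0) = {z\<in>P. fst a2 \<le> fst z \<and> snd b1 \<le> snd z}"
    and Q01: "Q (f 0 1) = {z\<in>P. fst a1 \<le> fst z \<and> snd b2 \<le> snd z}"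
    using fa1 fa2 sb1 sb2 k01 k10 by (auto simp: Q_iff)
  have fa: "z \<noteq> a2 \<longleftrightarrow> fst a2 < fst z" if "z \<in> P" "fst a2 \<le> fst z" for z
    using fst_eqD[OF that(1) P4(2)] that by force
  have sb: "z \<noteq> b2 \<longleftrightarrow> snd b2 < snd z" if "z \<in> P" "snd b2 \<le> snd z" for z
    using snd_eqD[OF that(1) P4(4)] that by force
  have Q11: "Q (f 1 1) = {z\<in>P. fst a2 \<le> fst z \<and> snd b2 \<le> snd z}"
  proof -
    have "Q (f 1 1) = Q (f 1 0) \<inter> Q (f 0 1)" using eqs(1,3,5) by blast
    also have "\<dots> = {z\<in>P. fst a2 \<le> fst z \<and> snd b2 \<le> snd z}" unfolding Q10 Q01 using lt by auto
    finally show ?thesis .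
  qed
  have Q20: "Q (f 2 0) = {z\<in>P. fst a2 < fst z \<and> snd b1 \<le> snd z}" unfolding eqs(2) Q10 using fa by auto
  have Q21: "Q (f 2 1) = {z\<in>P. fst a2 < fst z \<and> snd b2 \<le> snd z}" unfolding eqs(7) Q11 using fa by auto
  have Q02: "Q (f 0 2) = {z\<in>P. fst a1 \<le> fst z \<and> snd b2 < snd z}" unfolding eqs(4) Q01 using sb by auto
  have Q12: "Q (f 1 2) = {z\<in>P. fst a2 \<le> fst z \<and> snd b2 < snd z}"
  proof -
    have "Q (f 1 2) = Q (f 1 1) \<inter> Q (f 0 2)" using eqs(4,5,6) by blast
    also have "\<dots> = {z\<in>P. fst a2 \<le> fst z \<and> snd b2 < snd z}" unfolding Q11 Q02 using lt by auto
    finally show ?thesis .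
  qed
  have Q22: "Q (f 2 2) = {z\<in>P. fst a2 < fst z \<and> snd b2 < snd z}" unfolding eqs(8) Q12 using fa by auto
  have fr: "framed f a1 a2 b1 b2"
    unfolding framed_def
  proof (intro allI impI)
    fix i j :: nat assume i: "i < 3" and j: "j < 3"
    show "f i j \<in> carrier D \<and> Q (f i j) = {z\<in>P.
     (if i = 0 then fst a1 \<le> fst z else if i = 1 then fst a2 \<le> fst z else fst a2 < fst z) \<and>
     (if j = 0 then snd b1 \<le> snd z else if j = 1 then snd b2 \<le> snd z else snd b2 < snd z)}"
      by (rule less3_cases[OF i]; rule less3_cases[OF j])
        (simp_all add: fc Q00 Q01 Q02 Q10 Q11 Q12 Q20 Q21 Q22 del: One_nat_def)
  qed
  have e1: "snd z < snd b1" if "z \<in> P" "fst a1 < fst z" "fst z < fst a2" for z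
  proof (rule ccontr)
    assume "\<not> snd z < snd b1"
    then have "z \<in> Q (f 0 0)" "z \<noteq> a1" using that Q00 by auto
    then have "z \<in> Q (f 1 0)" using eqs(1) by blast
    then show False using that Q10 by auto
  qed
  have e2: "fst z < fst a1" if "z \<in> P" "snd b1 < snd z" "snd z < snd b2" for z
  proof (rule ccontr)
    assume "\<not> fst z < fst a1"
    then have "z \<in> Q (f 0 0)" "z \<noteq> b1" using that Q00 by auto
    then have "z \<in> Q (f 0 1)" using eqs(3) by blast
    then show False using that Q01 by auto
  qed
  interpret m: represented "mirror D" "prod.swap \<circ> \<kappa>" "prod.swap ` P" by (rule rep_mirror)
  obtain z0 z1 z2 where zl: "(next_left D)\<^sup>*\<^sup>* (f 2 0, f 2 1, f 2 2) (z0, z1, z2)"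
    "chain3_set (z0, z1, z2) \<subseteq> boundary D"
    using sch unfolding C3_scheme_def scheme_left_wing_def left_wing_eq by force
  obtain y0 y1 y2 where yr: "(next_left (mirror D))\<^sup>*\<^sup>* (f 0 2, f 1 2, f 2 2) (y0, y1, y2)"
    "chain3_set (y0, y1, y2) \<subseteq> boundary D"
    using sch unfolding C3_scheme_def scheme_right_wing_def right_wing_mirror left_wing_eq by force
  have k20: "fst a2 < fst (\<kappa> (f 2 0))"
  proof -
    obtain w where w: "w \<in> Q (f 2 0)" "fst w = fst (\<kappa> (f 2 0))" using ex_leftmost[OF fc[of 2 0]] by auto
    then show ?thesis unfolding Q20 by auto
  qed
  have k02: "snd b2 < snd (\<kappa> (f 0 2))"
  proof -
    obtain w where w: "w \<in> Q (f 0 2)" "snd w = snd (\<kappa> (f 0 2))" using ex_lowest[OF fc[of 0 2]] by auto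
    then show ?thesis unfolding Q02 by auto
  qed
  have k12: "fst (\<kappa> (f 1 2)) \<le> fst a2" "snd b2 < snd (\<kappa> (f 1 2))"
  proof -
    show "fst (\<kappa> (f 1 2)) \<le> fst a2" using mem(12) by (simp add: Q_iff)
    obtain w where w: "w \<in> Q (f 1 2)" "snd w = snd (\<kappa> (f 1 2))" using ex_lowest[OF fc[of 1 2]] by auto
    then show "snd b2 < snd (\<kappa> (f 1 2))" unfolding Q12 by auto
  qed
  have k21: "snd (\<kappa> (f 2 1)) \<le> snd b2" "fst a2 < fst (\<kappa> (f 2 1))"
  proof -
    show "snd (\<kappa> (f 2 1)) \<le> snd b2" using mem(8) by (simp add: Q_iff)
    obtain w where w: "w \<in> Q (f 2 1)" "fst w = fst (\<kappa> (f 2 1))" using ex_leftmost[OF fc[of 2 1]] by auto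
    then show "fst a2 < fst (\<kappa> (f 2 1))" unfolding Q21 by auto
  qed
  \<comment> \<open>In the role of \<open>d\<close>, the element \<open>f 1 2\<close> bounds the
    left wing; in the reflected diagram \<open>f 2 1\<close> bounds the right one.\<close>
  have adj1: "fst b1 < fst b2" "\<And>z. z \<in> P \<Longrightarrow> fst b1 < fst z \<Longrightarrow> fst b2 \<le> fst z"
    using wing_adjacent[OF zl(1) b1'(2) b2'(2) k20 gt(1) lt(2) zl(2) fc[of 1 2] k12 rect] by simp_all
  have adj2: "fst (prod.swap a1) < fst (prod.swap a2)"
    "\<And>z. z \<in> prod.swap ` P \<Longrightarrow> fst (prod.swap a1) < fst z \<Longrightarrow> fst (prod.swap a2) \<le> fst z"
  proof -
    have yb: "chain3_set (y0, y1, y2) \<subseteq> boundary (mirror D)" using yr(2) boundary_mirror(3)[OF planar] by simp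
    have l: "m.lab (f 0 2) (f 1 2) (prod.swap a1)" "m.lab (f 1 2) (f 2 2) (prod.swap a2)"
      using a1'(2) a2'(2) lab_mirror by auto
    note w = m.wing_adjacent[OF yr(1) l, of "snd b2" "f 2 1", OF _ _ _ yb _ _ _ rect_at_swap[OF rect]]
    show "fst (prod.swap a1) < fst (prod.swap a2)"
      by (rule w(1)) (use k02 gt lt k21 fc[of 2 1] in auto)
    show "\<And>z. z \<in> prod.swap ` P \<Longrightarrow> fst (prod.swap a1) < fst z \<Longrightarrow> fst (prod.swap a2) \<le> fst z"
      by (rule w(2)) (use k02 gt lt k21 fc[of 2 1] in auto)
  qed
  have "snd a1 < snd a2" "\<And>z. z \<in> P \<Longrightarrow> snd a1 < snd z \<Longrightarrow> snd a2 \<le> snd z"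
    using adj2 by fastforce+
  then have "resectable P a1 a2 b1 b2"
    unfolding resectable_def using P4 lt gt adj1 e1 e2 by blast
  then show ?thesis using fr by blast
qed

end

section \<open>Undoing a resection\<close>

definition middles :: "(real \<times> real) set \<Rightarrow> real \<times> real \<Rightarrow> real \<times> real \<Rightarrow> (real \<times> real) set" where
  "middles P u v = {z\<in>P. fst z < fst u \<and> snd z < snd v}"

definition decreasing :: "(real \<times> real) set \<Rightarrow> (real \<times> real \<Rightarrow> nat) \<Rightarrow> bool" where
  "decreasing P h \<longleftrightarrow> (\<forall>z\<in>P. \<forall>w\<in>P. fst z < fst w \<longrightarrow> snd w < snd z \<longrightarrow> h w < h z)"

text \<open>Used to place a new column or row immediately beyond an old one.\<close>

lemma ex_gap:
  fixes A :: "real set"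
  assumes "finite A"
  shows "\<exists>y>x. \<forall>a\<in>A. x < a \<longrightarrow> y < a"
proof (cases "{a\<in>A. x < a} = {}")
  case True
  then show ?thesis by (intro exI[of _ "x + 1"]) auto
next
  case False
  define b where "b = Min {a\<in>A. x < a}"
  have "b \<in> {a\<in>A. x < a}" unfolding b_def using False assms by (intro Min_in) auto
  moreover have "b \<le> a" if "a \<in> A" "x < a" for a unfolding b_def using that assms by (intro Min_le) auto
  ultimately show ?thesis by (intro exI[of _ "(x + b) / 2"]) force
qed

text \<open>A point \<open>c\<close> is split into \<open>a2\<close>, above it in the same column,
  and \<open>b2\<close>, to its right in the same row; \<open>reduce\<close> merges them again. Only
  \<open>b2\<close> can become a middle point, and it weighs less than \<open>c\<close>.\<close>

lemma ex_expansion: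
  assumes P: "config P" and r: "rect_at P u v" and ne: "middles P u v \<noteq> {}" and h: "decreasing P h"
  shows "\<exists>P' a1 a2 b1 b2 h'. config P' \<and> rect_at P' u v \<and> resectable P' a1 a2 b1 b2 \<and>
    P = reduce P' a2 b2 \<and> decreasing P' h' \<and> sum h' (middles P' u v) < sum h (middles P u v)"
proof -
  note r = rect_atD[OF r]
  have finP: "finite P" using P by (simp add: config_def)
  have fe: "z = w" if "z \<in> P" "w \<in> P" "fst z = fst w" for z w
    using P that by (auto simp: config_def inj_on_def)
  have se: "z = w" if "z \<in> P" "w \<in> P" "snd z = snd w" for z w
    using P that by (auto simp: config_def inj_on_def)
  have hd: "h w < h z" if "z \<in> P" "w \<in> P" "fst z < fst w" "snd w < snd z" for z w
    using h that unfolding decreasing_def by blast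
  obtain t where t: "t \<in> P" "\<And>z. z \<in> P \<Longrightarrow> z \<le> t" using P by (auto simp: config_def)
  have finM: "finite (middles P u v)" using finP by (simp add: middles_def)
  obtain c0 where "c0 \<in> middles P u v" using ne by blast
  then have "\<exists>c\<in>middles P u v. \<forall>z\<in>middles P u v. fst c \<le> fst z" by (rule ex_minimizer[OF finM])
  then obtain c where c: "c \<in> middles P u v" and cmin: "\<And>z. z \<in> middles P u v \<Longrightarrow> fst c \<le> fst z" by blast
  have c': "c \<in> P" "fst c < fst u" "snd c < snd v" using c by (auto simp: middles_def)
  have vc: "fst v < fst c" using r(5)[OF c'(1)] fe[OF r(2) c'(1)] c'(3) by force
  have uc: "snd u < snd c" using r(4)[OF c'(1)] se[OF r(1) c'(1)] c'(2) by force
  have "\<exists>a\<in>{z\<in>P. fst z < fst c}. \<forall>z\<in>{z\<in>P. fst z < fst c}. fst z \<le> fst a"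
    by (rule ex_maximizer[of _ v]) (use finP r(2) vc in auto)
  then obtain a1 where a1: "a1 \<in> P" "fst a1 < fst c" and a1max: "\<And>z. z \<in> P \<Longrightarrow> fst z < fst c \<Longrightarrow> fst z \<le> fst a1"
    by blast
  \<comment> \<open>The highest point to the lower right of \<open>c\<close>, where \<open>u\<close>
    is available. This choice keeps the strip between the rows of \<open>b1\<close> and
    \<open>c\<close> free of points to the right of \<open>c\<close>.\<close>
  have "\<exists>b\<in>{z\<in>P. fst c < fst z \<and> snd z < snd c}. \<forall>z\<in>{z\<in>P. fst c < fst z \<and> snd z < snd c}. snd z \<le> snd b"
    by (rule ex_maximizer[of _ u]) (use finP r(1) uc c' in auto)
  then obtain b1 where b1: "b1 \<in> P" "fst c < fst b1" "snd b1 < snd c"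
    and b1max: "\<And>z. z \<in> P \<Longrightarrow> fst c < fst z \<Longrightarrow> snd z < snd c \<Longrightarrow> snd z \<le> snd b1"
    by blast
  \<comment> \<open>Since \<open>c\<close> is the leftmost middle point, the point in the column
    before it is not below \<open>v\<close>; so \<open>a2\<close>, placed higher still, will be
    above \<open>v\<close>.\<close>
  have "a1 \<notin> middles P u v" using cmin[of a1] a1(2) by auto
  then have va: "snd v \<le> snd a1" using a1 c' by (auto simp: middles_def)
  obtain x where x: "fst b1 < x" and xgap': "\<forall>a\<in>fst ` P. fst b1 < a \<longrightarrow> x < a"
    using ex_gap[of "fst ` P" "fst b1"] finP by auto
  obtain y where y: "snd a1 < y" and ygap': "\<forall>a\<in>snd ` P. snd a1 < a \<longrightarrow> y < a"
    using ex_gap[of "snd ` P" "snd a1"] finP by auto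
  have xgap: "x < fst z" if "z \<in> P" "fst b1 < fst z" for z using xgap' that by blast
  have ygap: "y < snd z" if "z \<in> P" "snd a1 < snd z" for z using ygap' that by blast
  have xnew: "fst z \<noteq> x" if "z \<in> P" for z using xgap[OF that] x by auto
  have ynew: "snd z \<noteq> y" if "z \<in> P" for z using ygap[OF that] y by auto
  have xle: "fst z \<le> fst b1" if "z \<in> P" "fst z < x" for z using xgap[OF that(1)] that(2) by force
  have yle: "snd z \<le> snd a1" if "z \<in> P" "snd z < y" for z using ygap[OF that(1)] that(2) by force
  \<comment> \<open>The row \<open>y\<close> is directly above \<open>a1\<close>, and the column
    \<open>x\<close> is directly to the right of \<open>b1\<close>.\<close>
  define a2 b2 where "a2 = (fst c, y)" and "b2 = (x, snd c)"
  have ab [simp]: "fst a2 = fst c" "snd a2 = y" "fst b2 = x" "snd b2 = snd c" by (auto simp: a2_def b2_def)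
  define P' where "P' = insert a2 (insert b2 (P - {c}))"
  have nab: "a2 \<notin> P" "b2 \<notin> P" using xnew[of b2] ynew[of a2] by auto
  have P'cases: "z = a2 \<or> z = b2 \<or> z \<in> P \<and> z \<noteq> c" if "z \<in> P'" for z
    using that by (auto simp: P'_def)
  have fc: "fst z \<noteq> fst c" "snd z \<noteq> snd c" if "z \<in> P" "z \<noteq> c" for z
    using that fe[OF that(1) c'(1)] se[OF that(1) c'(1)] by auto
  have cx: "fst c < x" using b1 x by simp
  have cy: "snd c < y" using c'(3) va y by simp
  have red: "P = reduce P' a2 b2"
    using nab c'(1) by (auto simp: reduce_def P'_def prod_eq_iff)
  have tu: "fst u \<le> fst t" "snd v \<le> snd t" "snd c \<le> snd t" "fst c \<le> fst t"
    using t(2)[OF r(1)] t(2)[OF r(2)] t(2)[OF c'(1)] by (auto simp: less_eq_prod_def)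
  have tc: "t \<noteq> c" "t \<noteq> a1" "t \<noteq> b1" using tu c' a1 b1 by auto
  have ty: "y < snd t" using ygap[OF t(1)] t(2)[OF a1(1)] se[OF a1(1) t(1)] tc by (force simp: less_eq_prod_def)
  have tx: "x < fst t" using xgap[OF t(1)] t(2)[OF b1(1)] fe[OF b1(1) t(1)] tc by (force simp: less_eq_prod_def)
  have conf: "config P'"
    unfolding config_def
  proof (intro conjI)
    show "finite P'" using finP by (simp add: P'_def)
    show "inj_on fst P'"
    proof (rule inj_onI)
      fix z w assume zw: "z \<in> P'" "w \<in> P'" "fst z = fst w"
      have c: "s = a2" if "s \<in> P'" "fst s = fst c" for s
        using P'cases[OF that(1)] that(2) fc(1)[of s] cx by auto
      have d: "s = b2" if "s \<in> P'" "fst s = x" for s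
        using P'cases[OF that(1)] that(2) xnew[of s] cx by auto
      show "z = w"
      proof (cases "fst z = fst c \<or> fst z = x")
        case True
        then show ?thesis using c[OF zw(1)] c[OF zw(2)] d[OF zw(1)] d[OF zw(2)] zw(3) by metis
      next
        case False
        then have "z \<in> P" "w \<in> P" using P'cases[OF zw(1)] P'cases[OF zw(2)] zw(3) by auto
        then show ?thesis using fe zw(3) by blast
      qed
    qed
    show "inj_on snd P'"
    proof (rule inj_onI)
      fix z w assume zw: "z \<in> P'" "w \<in> P'" "snd z = snd w"
      have c: "s = b2" if "s \<in> P'" "snd s = snd c" for s
        using P'cases[OF that(1)] that(2) fc(2)[of s] cy by auto
      have d: "s = a2" if "s \<in> P'" "snd s = y" for s
        using P'cases[OF that(1)] that(2) ynew[of s] cy by auto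
      show "z = w"
      proof (cases "snd z = snd c \<or> snd z = y")
        case True
        then show ?thesis using c[OF zw(1)] c[OF zw(2)] d[OF zw(1)] d[OF zw(2)] zw(3) by metis
      next
        case False
        then have "z \<in> P" "w \<in> P" using P'cases[OF zw(1)] P'cases[OF zw(2)] zw(3) by auto
        then show ?thesis using se zw(3) by blast
      qed
    qed
    have "z \<le> t" if "z \<in> P'" for z
      using P'cases[OF that] t(2)[of z] tu tx ty by (auto simp: less_eq_prod_def)
    moreover have "t \<in> P'" using t tc by (simp add: P'_def)
    ultimately show "\<exists>w\<in>P'. \<forall>z\<in>P'. z \<le> w" by blast
  qed
  have a1': "a1 \<in> P'" and b1': "b1 \<in> P'" and u': "u \<in> P'" and v': "v \<in> P'"
    using a1 b1 r(1,2) c' vc by (auto simp: P'_def)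
  have res: "resectable P' a1 a2 b1 b2"
    unfolding resectable_def
  proof (intro conjI ballI impI)
    show "{a1, a2, b1, b2} \<subseteq> P'" using a1' b1' by (simp add: P'_def)
    show "snd b2 < snd a1" using c'(3) va by simp
    fix z assume z: "z \<in> P'"
    { assume "fst a1 < fst z" "fst z < fst a2"
      then show "snd z < snd b1" using P'cases[OF z] a1max[of z] cx by auto }
    { assume "snd b1 < snd z" "snd z < snd b2"
      then show "fst z < fst a1"
        using P'cases[OF z] b1max[of z] a1max[of z] fc(1)[of z] fe[of z a1] a1(1) c'(3) va cy by force }
    { assume "fst b1 < fst z"
      then show "fst b2 \<le> fst z" using P'cases[OF z] xgap[of z] b1(2) by auto }
    { assume "snd a1 < snd z"
      then show "snd a2 \<le> snd z" using P'cases[OF z] ygap[of z] c'(3) va by auto }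
  qed (use a1 b1 x y in auto)
  have rect: "rect_at P' u v"
    unfolding rect_at_def
  proof (intro conjI ballI impI)
    show "u \<in> P'" "v \<in> P'" "u \<noteq> v" using u' v' r(3) .
    fix z assume z: "z \<in> P'"
    show "snd u \<le> snd z" using P'cases[OF z] r(4)[of z] uc cy by auto
    show "fst v \<le> fst z" using P'cases[OF z] r(5)[of z] vc cx by auto
    fix w assume w: "w \<in> P'"
    { assume zu: "fst u \<le> fst z" "fst z < fst w"
      have "z \<noteq> a2" "w \<noteq> a2" using zu c' by auto
      then consider "z = b2" "w \<in> P" "w \<noteq> c" | "z \<in> P" "w = b2" | "z \<in> P" "w \<in> P"
        using P'cases[OF z] P'cases[OF w] zu by auto
      then show "snd z < snd w"
      proof cases
        case 1
        \<comment> \<open>If \<open>b2\<close> is beyond \<open>u\<close>, then \<open>b1\<close> is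
          not before \<open>u\<close>, as no old column lies between \<open>b1\<close> and
          \<open>b2\<close>. Later points are higher than \<open>b1\<close>, hence above the row of
          \<open>c\<close> by the choice of \<open>b1\<close>.\<close>
        then have "fst u \<le> fst b1" "fst b1 < fst w" using zu xle[OF r(1)] xnew[OF r(1)] x by force+
        then have "snd b1 < snd w" using r(6)[OF b1(1) 1(2)] by simp
        then have "\<not> snd w < snd c" using b1max[OF 1(2)] b1(2) \<open>fst b1 < fst w\<close> by force
        then show ?thesis using fc(2)[OF 1(2,3)] 1(1) by simp
      next
        case 2
        then have "fst z \<le> fst b1" using xle zu by simp
        then have "snd z \<le> snd b1" using r(6)[OF 2(1) b1(1) zu(1)] fe[OF 2(1) b1(1)] by force
        then show ?thesis using b1(3) 2(2) by simp
      next
        case 3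
        then show ?thesis using r(6) zu by blast
      qed }
    { assume zv: "snd v \<le> snd z" "snd z < snd w"
      have "z \<noteq> b2" "w \<noteq> b2" using zv c' by auto
      then consider "z = a2" "w \<in> P" "w \<noteq> c" | "z \<in> P" "w = a2" | "z \<in> P" "w \<in> P"
        using P'cases[OF z] P'cases[OF w] zv by auto
      then show "fst z < fst w"
      proof cases
        case 1
        then have "snd a1 < snd w" using zv y by simp
        then have "fst a1 < fst w" using r(7)[OF a1(1) 1(2) va] by simp
        then have "\<not> fst w < fst c" using a1max[OF 1(2)] by force
        then show ?thesis using fc(1)[OF 1(2,3)] 1(1) by simp
      next
        case 2
        then have "snd z \<le> snd a1" using yle zv by simp
        then have "fst z \<le> fst a1" using r(7)[OF 2(1) a1(1) zv(1)] se[OF 2(1) a1(1)] by force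
        then show ?thesis using a1(2) 2(2) by simp
      next
        case 3
        then show ?thesis using r(7) zv by blast
      qed }
    { assume zz: "fst u \<le> fst z" "snd v \<le> snd z"
      then have "z \<in> P" using P'cases[OF z] c' by auto
      then have "z = t" using r(8)[OF _ zz t(1)] t(2)[of z] by (auto intro: order_antisym)
      then show "w \<le> z" using P'cases[OF w] t(2)[of w] tu tx ty by (auto simp: less_eq_prod_def) }
  qed
  \<comment> \<open>An old point to the upper left or lower right of \<open>a2\<close> is in the
    same position relative to \<open>a1\<close>, and likewise for \<open>b2\<close> and
    \<open>b1\<close>. So the new points can inherit these weights.\<close>
  define h' where "h' z = (if z = a2 then h a1 else if z = b2 then h b1 else h z)" for z
  have nab2: "a2 \<noteq> b2" using cx by (auto simp: a2_def b2_def)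
  have hold: "h' z = h z" if "z \<in> P" for z using that nab by (auto simp: h'_def)
  have h'ab: "h' a2 = h a1" "h' b2 = h b1" using nab2 by (auto simp: h'_def)
  have dec: "decreasing P' h'"
    unfolding decreasing_def
  proof (intro ballI impI)
    fix z w assume zw: "z \<in> P'" "w \<in> P'" "fst z < fst w" "snd w < snd z"
    consider "z = a2" "w = b2" | "z = b2" "w = a2" | "z = a2" "w \<in> P" | "z = b2" "w \<in> P"
      | "z \<in> P" "w = a2" | "z \<in> P" "w = b2" | "z \<in> P" "w \<in> P"
      using P'cases[OF zw(1)] P'cases[OF zw(2)] zw by auto
    then show "h' w < h' z"
    proof cases
      case 1
      then show ?thesis using h'ab hd[OF a1(1) b1(1)] a1 b1 va c' by simp
    next
      case 2
      then show ?thesis using zw cx by simp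
    next
      case 3
      then have "snd w \<le> snd a1" "fst a1 < fst w" using yle[of w] zw a1 by auto
      then have "snd w < snd a1" using se[OF 3(2) a1(1)] by force
      then show ?thesis using hd[OF a1(1) 3(2)] \<open>fst a1 < fst w\<close> 3 h'ab hold by simp
    next
      case 4
      then have "fst b1 < fst w" "snd w < snd c" using zw x by auto
      moreover then have "snd w \<le> snd b1" using b1max[OF 4(2)] b1 by simp
      ultimately have "snd w < snd b1" using se[OF 4(2) b1(1)] by force
      then show ?thesis using hd[OF b1(1) 4(2)] \<open>fst b1 < fst w\<close> 4 h'ab hold by simp
    next
      case 5
      then have "fst z \<le> fst a1" "snd a1 < snd z" using a1max[of z] zw y by auto
      then have "fst z < fst a1" using fe[OF 5(1) a1(1)] by force
      then show ?thesis using hd[OF 5(1) a1(1)] \<open>snd a1 < snd z\<close> 5 h'ab hold by simp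
    next
      case 6
      then have "fst z \<le> fst b1" "snd b1 < snd z" using xle[of z] zw b1 by auto
      then have "fst z < fst b1" using fe[OF 6(1) b1(1)] by force
      then show ?thesis using hd[OF 6(1) b1(1)] \<open>snd b1 < snd z\<close> 6 h'ab hold by simp
    next
      case 7
      then show ?thesis using hd zw hold by simp
    qed
  qed
  have "middles P' u v \<subseteq> insert b2 (middles P u v - {c})"
  proof
    fix z assume "z \<in> middles P' u v"
    then have z: "z \<in> P'" "fst z < fst u" "snd z < snd v" by (auto simp: middles_def)
    then show "z \<in> insert b2 (middles P u v - {c})"
      using P'cases[OF z(1)] va y nab c'(1) z(2,3) by (auto simp: middles_def)
  qed
  then have "sum h' (middles P' u v) \<le> sum h' (insert b2 (middles P u v - {c}))"
    using finM by (intro sum_mono2) auto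
  also have "\<dots> = h b1 + sum h' (middles P u v - {c})"
    using finM nab h'ab by (subst sum.insert) (auto simp: middles_def)
  also have "sum h' (middles P u v - {c}) = sum h (middles P u v - {c})"
    by (rule sum.cong) (auto simp: middles_def hold)
  also have "h b1 + \<dots> < h c + \<dots>" using hd[OF c'(1) b1(1)] b1 by simp
  also have "\<dots> = sum h (middles P u v)" using finM c by (simp add: sum.remove)
  finally show ?thesis using conf rect res red dec by blast
qed


section \<open>Grids\<close>

text \<open>Two increasing sequences with a common last point, the top: \<open>\<alpha>\<close> on
  the upper left, starting at the leftmost point, and \<open>\<beta>\<close> on the lower right,
  starting at the lowest point.\<close>

locale grid_points =
  fixes p q :: nat and \<alpha> \<beta> :: "nat \<Rightarrow> real \<times> real"
  assumes pq: "1 \<le> p" "1 \<le> q" and corner: "\<alpha> p = \<beta> q"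
    and fa: "\<And>i k. i < k \<Longrightarrow> k \<le> p \<Longrightarrow> fst (\<alpha> i) < fst (\<alpha> k)"
    and sa: "\<And>i k. i < k \<Longrightarrow> k \<le> p \<Longrightarrow> snd (\<alpha> i) < snd (\<alpha> k)"
    and fb: "\<And>j l. j < l \<Longrightarrow> l \<le> q \<Longrightarrow> fst (\<beta> j) < fst (\<beta> l)"
    and sb: "\<And>j l. j < l \<Longrightarrow> l \<le> q \<Longrightarrow> snd (\<beta> j) < snd (\<beta> l)"
    and fab: "\<And>i j. i < p \<Longrightarrow> j \<le> q \<Longrightarrow> fst (\<alpha> i) < fst (\<beta> j)"
    and sab: "\<And>i j. i \<le> p \<Longrightarrow> j < q \<Longrightarrow> snd (\<beta> j) < snd (\<alpha> i)"
begin

definition pts :: "(real \<times> real) set" where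
  "pts = \<alpha> ` {..p} \<union> \<beta> ` {..q}"

text \<open>The corner of the quadrant that has lost the first \<open>i\<close> points of
  \<open>\<alpha>\<close> and the first \<open>j\<close> points of \<open>\<beta>\<close>. When only
  the top remains of one sequence, the other one determines both coordinates.\<close>

definition coord :: "nat \<times> nat \<Rightarrow> real \<times> real" where
  "coord = (\<lambda>(i, j). (if i < p then fst (\<alpha> i) else fst (\<beta> j), if j < q then snd (\<beta> j) else snd (\<alpha> i)))"

lemma fa_le: "i \<le> k \<Longrightarrow> k \<le> p \<Longrightarrow> fst (\<alpha> i) \<le> fst (\<alpha> k)"
  using fa[of i k] by (cases "i = k") auto

lemma sa_le: "i \<le> k \<Longrightarrow> k \<le> p \<Longrightarrow> snd (\<alpha> i) \<le> snd (\<alpha> k)"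
  using sa[of i k] by (cases "i = k") auto

lemma fb_le: "j \<le> l \<Longrightarrow> l \<le> q \<Longrightarrow> fst (\<beta> j) \<le> fst (\<beta> l)"
  using fb[of j l] by (cases "j = l") auto

lemma sb_le: "j \<le> l \<Longrightarrow> l \<le> q \<Longrightarrow> snd (\<beta> j) \<le> snd (\<beta> l)"
  using sb[of j l] by (cases "j = l") auto

lemma coord_le_iff:
  assumes "i \<le> p" "j \<le> q" "k \<le> p" "l \<le> q"
  shows "coord (i, j) \<le> coord (k, l) \<longleftrightarrow> i \<le> k \<and> j \<le> l"
proof
  assume le: "coord (i, j) \<le> coord (k, l)"
  show "i \<le> k \<and> j \<le> l"
  proof (rule ccontr)
    assume "\<not> ?thesis"
    then consider "k < i" | "l < j" by fastforce
    then show False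
    proof cases
      case 1
      then have "fst (coord (k, l)) < fst (coord (i, j))"
        using fa[of k i] fab[of k j] assms by (auto simp: coord_def)
      then show False using le by (auto simp: less_eq_prod_def)
    next
      case 2
      then have "snd (coord (k, l)) < snd (coord (i, j))"
        using sb[of l j] sab[of i l] assms by (auto simp: coord_def)
      then show False using le by (auto simp: less_eq_prod_def)
    qed
  qed
next
  assume ikjl: "i \<le> k \<and> j \<le> l"
  have "fst (coord (i, j)) \<le> fst (coord (k, l))"
    using fa_le[of i k] fab[of i l] fb_le[of j l] ikjl assms
    by (cases "i < p"; cases "k < p") (simp_all add: coord_def)
  moreover have "snd (coord (i, j)) \<le> snd (coord (k, l))"
    using sb_le[of j l] sab[of k j] sa_le[of i k] ikjl assms
    by (cases "j < q"; cases "l < q") (simp_all add: coord_def)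
  ultimately show "coord (i, j) \<le> coord (k, l)" by (simp add: less_eq_prod_def)
qed

text \<open>The common end point is counted in \<open>\<beta>\<close> only, so the two cases exclude
  each other.\<close>

lemma pts_cases:
  assumes "z \<in> pts"
  obtains i where "i < p" "z = \<alpha> i" | j where "j \<le> q" "z = \<beta> j"
proof -
  from assms consider i where "i \<le> p" "z = \<alpha> i" | j where "j \<le> q" "z = \<beta> j"
    by (auto simp: pts_def)
  then show ?thesis
  proof cases
    case (1 i)
    then show ?thesis using that(1)[of i] that(2)[of q] corner by (cases "i = p") auto
  qed (rule that(2))
qed

lemma fst_order:
  "i < p \<Longrightarrow> k < p \<Longrightarrow> fst (\<alpha> i) \<le> fst (\<alpha> k) \<longleftrightarrow> i \<le> k"
  "j \<le> q \<Longrightarrow> l \<le> q \<Longrightarrow> fst (\<beta> j) \<le> fst (\<beta> l) \<longleftrightarrow> j \<le> l"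
proof -
  show "i < p \<Longrightarrow> k < p \<Longrightarrow> fst (\<alpha> i) \<le> fst (\<alpha> k) \<longleftrightarrow> i \<le> k"
    using fa[of k i] fa_le[of i k] by (cases "i \<le> k") auto
  show "j \<le> q \<Longrightarrow> l \<le> q \<Longrightarrow> fst (\<beta> j) \<le> fst (\<beta> l) \<longleftrightarrow> j \<le> l"
    using fb[of l j] fb_le[of j l] by (cases "j \<le> l") auto
qed

lemma snd_order:
  "i < p \<Longrightarrow> k < p \<Longrightarrow> snd (\<alpha> i) \<le> snd (\<alpha> k) \<longleftrightarrow> i \<le> k"
  "j \<le> q \<Longrightarrow> l \<le> q \<Longrightarrow> snd (\<beta> j) \<le> snd (\<beta> l) \<longleftrightarrow> j \<le> l"
proof -
  show "i < p \<Longrightarrow> k < p \<Longrightarrow> snd (\<alpha> i) \<le> snd (\<alpha> k) \<longleftrightarrow> i \<le> k"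
    using sa[of k i] sa_le[of i k] by (cases "i \<le> k") auto
  show "j \<le> q \<Longrightarrow> l \<le> q \<Longrightarrow> snd (\<beta> j) \<le> snd (\<beta> l) \<longleftrightarrow> j \<le> l"
    using sb[of l j] sb_le[of j l] by (cases "j \<le> l") auto
qed

lemma alpha_below_corner: "i < p \<Longrightarrow> snd (\<alpha> i) < snd (\<beta> q)"
  using sa[of i p] corner by simp

lemma coord_image: "coord ` ({..<Suc p} \<times> {..<Suc q}) = tight pts"
proof (intro equalityI subsetI)
  fix e assume "e \<in> coord ` ({..<Suc p} \<times> {..<Suc q})"
  then obtain s where s: "s \<in> {..<Suc p} \<times> {..<Suc q}" "e = coord s" by blast
  obtain i j where "s = (i, j)" by (cases s)
  then have ij: "i \<le> p" "j \<le> q" and e: "e = coord (i, j)" using s by auto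
  have pt: "\<alpha> i \<in> pts" "\<beta> j \<in> pts" "\<beta> q \<in> pts" using ij by (auto simp: pts_def)
  consider "i < p" "j < q" | "i < p" "j = q" | "i = p" "j < q" | "i = p" "j = q" using ij by linarith
  then show "e \<in> tight pts"
  proof cases
    case 1
    then have ee: "e = (fst (\<alpha> i), snd (\<beta> j))" by (simp add: e coord_def)
    have "snd (\<beta> j) < snd (\<alpha> i)" "fst (\<alpha> i) < fst (\<beta> j)" using sab fab ij 1 by simp_all
    then show ?thesis
      unfolding ee by (intro tightI[OF pt(1) _ _ pt(2)]) simp_all
  next
    case 2
    then have "e = \<alpha> i" by (simp add: e coord_def)
    then show ?thesis using point_tight pt by simp
  next
    case 3
    then have "e = \<beta> j" by (simp add: e coord_def)
    then show ?thesis using point_tight pt by simp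
  next
    case 4
    then have "e = \<beta> q" by (simp add: e coord_def corner)
    then show ?thesis using point_tight pt by simp
  qed
next
  fix e assume "e \<in> tight pts"
  then obtain z w where z: "z \<in> pts" "fst z = fst e" "snd e \<le> snd z"
    and w: "w \<in> pts" "snd w = snd e" "fst e \<le> fst w" by (auto simp: tight_def)
  have im: "coord (i, j) \<in> coord ` ({..<Suc p} \<times> {..<Suc q})" if "i \<le> p" "j \<le> q" for i j
    using that by auto
  from z(1) show "e \<in> coord ` ({..<Suc p} \<times> {..<Suc q})"
  proof (cases rule: pts_cases)
    case z1: (1 i)
    from w(1) show ?thesis
    proof (cases rule: pts_cases)
      case w1: (1 k)
      have "i = k" using z w z1 w1 fst_order(1)[of i k] snd_order(1)[of k i] by auto
      then have "e = coord (i, q)" using z w z1 w1 by (auto simp: coord_def prod_eq_iff)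
      then show ?thesis using im[of i q] z1 by simp
    next
      case w1: (2 j)
      have "j \<noteq> q" using z w z1 w1 alpha_below_corner[of i] by auto
      then have "e = coord (i, j)" using z w z1 w1 by (auto simp: coord_def prod_eq_iff)
      then show ?thesis using im[of i j] z1 w1 by simp
    qed
  next
    case z1: (2 j)
    from w(1) show ?thesis
    proof (cases rule: pts_cases)
      case w1: (1 k)
      then show ?thesis using z w z1 fab[of k j] by auto
    next
      case w1: (2 l)
      have "j = l" using z w z1 w1 fst_order(2)[of j l] snd_order(2)[of l j] by auto
      then have "e = coord (p, j)" using z w z1 w1 corner by (auto simp: coord_def prod_eq_iff)
      then show ?thesis using im[of p j] z1 by simp
    qed
  qed
qed

lemma coord_bij: "bij_betw coord ({..<Suc p} \<times> {..<Suc q}) (tight pts)"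
proof -
  have "inj_on coord ({..<Suc p} \<times> {..<Suc q})"
  proof (rule inj_onI)
    fix a b assume a: "a \<in> {..<Suc p} \<times> {..<Suc q}" and b: "b \<in> {..<Suc p} \<times> {..<Suc q}"
      and e: "coord a = coord b"
    obtain i j where ij: "a = (i, j)" "i \<le> p" "j \<le> q" using a by auto
    obtain k l where kl: "b = (k, l)" "k \<le> p" "l \<le> q" using b by auto
    show "a = b"
      using coord_le_iff[of i j k l] coord_le_iff[of k l i j] e ij kl by auto
  qed
  then show ?thesis using coord_image by (simp add: bij_betw_def)
qed

lemma config_pts: "config pts"
  unfolding config_def
proof (intro conjI)
  show "finite pts" by (simp add: pts_def)
  show "inj_on fst pts"
  proof (rule inj_onI)
    fix z w assume z: "z \<in> pts" and w: "w \<in> pts" and e: "fst z = fst w"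
    from z show "z = w"
    proof (cases rule: pts_cases)
      case z1: (1 i)
      from w show ?thesis
        by (cases rule: pts_cases) (use e z1 fab[of i] fst_order(1)[of i] fst_order(1)[of _ i] in fastforce)+
    next
      case z1: (2 j)
      from w show ?thesis
        by (cases rule: pts_cases) (use e z1 fab[of _ j] fst_order(2)[of j] fst_order(2)[of _ j] in fastforce)+
    qed
  qed
  show "inj_on snd pts"
  proof (rule inj_onI)
    fix z w assume z: "z \<in> pts" and w: "w \<in> pts" and e: "snd z = snd w"
    have ab: "snd (\<alpha> i) \<noteq> snd (\<beta> j)" if "i < p" "j \<le> q" for i j
      using sab[of i j] alpha_below_corner[of i] that by (cases "j = q") auto
    from z show "z = w"
    proof (cases rule: pts_cases)
      case z1: (1 i)
      from w show ?thesis
        by (cases rule: pts_cases) (use e z1 ab[of i] snd_order(1)[of i] snd_order(1)[of _ i] in fastforce)+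
    next
      case z1: (2 j)
      from w show ?thesis
        by (cases rule: pts_cases) (use e z1 ab[of _ j] snd_order(2)[of j] snd_order(2)[of _ j] in fastforce)+
    qed
  qed
  have "z \<le> \<beta> q" if "z \<in> pts" for z
    using that
    by (cases rule: pts_cases)
      (use fab[of _ q] alpha_below_corner fb_le[of _ q] sb_le[of _ q] in \<open>fastforce simp: less_eq_prod_def\<close>)+
  moreover have "\<beta> q \<in> pts" by (simp add: pts_def)
  ultimately show "\<exists>w\<in>pts. \<forall>z\<in>pts. z \<le> w" by blast
qed

lemma rect_at_pts: "rect_at pts (\<beta> 0) (\<alpha> 0)"
proof -
  have fz: "\<exists>j\<le>q. z = \<beta> j" if "z \<in> pts" "fst (\<beta> 0) \<le> fst z" for z
    using that(1)
  proof (cases rule: pts_cases)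
    case (1 i)
    then show ?thesis using that(2) fab[of i 0] by auto
  qed auto
  have sz: "\<exists>i\<le>p. z = \<alpha> i" if "z \<in> pts" "snd (\<alpha> 0) \<le> snd z" for z
    using that(1)
  proof (cases rule: pts_cases)
    case (2 j)
    then show ?thesis using that(2) sab[of 0 j] corner by (cases "j = q") auto
  next
    case (1 i)
    then show ?thesis using less_imp_le by blast
  qed
  show ?thesis
    unfolding rect_at_def
  proof (intro conjI ballI impI)
    show "\<beta> 0 \<in> pts" "\<alpha> 0 \<in> pts" by (auto simp: pts_def)
    show "\<beta> 0 \<noteq> \<alpha> 0" using fab[of 0 0] pq by auto
    fix z assume z: "z \<in> pts"
    show "snd (\<beta> 0) \<le> snd z"
      using z
    proof (cases rule: pts_cases)
      case (1 i)
      then show ?thesis using sab[of i 0] pq by auto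
    next
      case (2 j)
      then show ?thesis using sb_le[of 0 j] by auto
    qed
    show "fst (\<alpha> 0) \<le> fst z"
      using z
    proof (cases rule: pts_cases)
      case (1 i)
      then show ?thesis using fa_le[of 0 i] by auto
    next
      case (2 j)
      then show ?thesis using fab[of 0 j] pq by auto
    qed
    fix t assume t: "t \<in> pts"
    { assume zt: "fst (\<beta> 0) \<le> fst z" "fst z < fst t"
      obtain j where j: "j \<le> q" "z = \<beta> j" using fz[OF z zt(1)] by blast
      obtain l where l: "l \<le> q" "t = \<beta> l" using fz[OF t] zt by auto
      have "j < l" using zt(2) fst_order(2)[of l j] j l by auto
      then show "snd z < snd t" using sb j l by simp }
    { assume zt: "snd (\<alpha> 0) \<le> snd z" "snd z < snd t"
      obtain j where j: "j \<le> p" "z = \<alpha> j" using sz[OF z zt(1)] by blast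
      obtain l where l: "l \<le> p" "t = \<alpha> l" using sz[OF t] zt by auto
      have "j < l" using zt(2) sa_le[of l j] j l by (cases "j < l") auto
      then show "fst z < fst t" using fa j l by simp }
    { assume zt: "fst (\<beta> 0) \<le> fst z" "snd (\<alpha> 0) \<le> snd z"
      obtain j where j: "j \<le> q" "z = \<beta> j" using fz[OF z zt(1)] by blast
      have "j = q" using zt(2) sab[of 0 j] j by (cases "j = q") auto
      then have "z = \<beta> q" using j by simp
      from t show "t \<le> z"
      proof (cases rule: pts_cases)
        case (1 i)
        then show ?thesis using \<open>z = \<beta> q\<close> fab[of i q] alpha_below_corner[of i] by (simp add: less_eq_prod_def)
      next
        case (2 l)
        then show ?thesis using \<open>z = \<beta> q\<close> fb_le[of l q] sb_le[of l q] by (simp add: less_eq_prod_def)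
      qed }
  qed
qed

lemma ex_grid_drawing: "\<exists>G :: (nat \<times> nat) diagram. grid G \<and> represents G coord pts"
proof -
  define G :: "(nat \<times> nat) diagram" where
    "G = \<lparr>carrier = {..<Suc p} \<times> {..<Suc q}, eq = (=),
       le = (\<lambda>x y. fst x \<le> fst y \<and> snd x \<le> snd y),
       pos = (\<lambda>x. (snd (coord x) - fst (coord x), fst (coord x) + snd (coord x)))\<rparr>"
  have "represents G coord pts"
  proof (rule represents_drawn)
    fix x y assume "x \<in> carrier G" "y \<in> carrier G"
    then show "x \<sqsubseteq>\<^bsub>G\<^esub> y \<longleftrightarrow> coord x \<le> coord y"
      using coord_le_iff[of "fst x" "snd x" "fst y" "snd y"] by (auto simp: G_def)
  qed (use config_pts coord_bij in \<open>auto simp: G_def\<close>)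
  moreover have "grid G"
    unfolding grid_def
  proof (intro conjI exI)
    show "planar_diagram G" using calculation by (simp add: represents_def)
  qed (use pq in \<open>auto simp: G_def\<close>)
  ultimately show ?thesis by blast
qed

end

text \<open>The drawing of the grid is arbitrary, so the left-right order of all pairs has to be
  derived from that of the two corners.\<close>

lemma grid_slim_rectangular_aux:
  fixes G :: "(nat \<times> nat) diagram"
  assumes pl: "planar_diagram G" and pq: "1 \<le> p" "1 \<le> q" and car: "carrier G = {..<Suc p} \<times> {..<Suc q}"
    and le: "\<And>x y. x \<in> carrier G \<Longrightarrow> y \<in> carrier G \<Longrightarrow> x \<sqsubseteq>\<^bsub>G\<^esub> y \<longleftrightarrow> fst x \<le> fst y \<and> snd x \<le> snd y"
    and lr: "left_of G (p, 0) (0, q)"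
  shows "\<exists>\<kappa> P u v. represents G \<kappa> P \<and> rect_at P u v"
proof -
  \<comment> \<open>The first sequence has the abscissas 0, ..., p - 1, the second one p, ..., p + q
    - 1; ordinates are assigned with the roles exchanged. Both end at (p + q, p + q).\<close>
  interpret g: grid_points p q "\<lambda>i. (real (if i < p then i else p + q), real (q + i))"
      "\<lambda>j. (real (p + j), real (if j < q then j else p + q))"
    by unfold_locales (use pq in auto)
  interpret planar G using pl by unfold_locales
  have left: "left_of G x y" if x: "x \<in> carrier G" and y: "y \<in> carrier G" and o: "fst y < fst x" "snd x < snd y" for x y
  proof (rule ccontr)
    assume n: "\<not> left_of G x y"
    obtain i j where ij: "x = (i, j)" "i \<le> p" "j \<le> q" using x car by auto
    obtain k l where kl: "y = (k, l)" "k \<le> p" "l \<le> q" using y car by auto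
    have mem: "(0, l) \<in> carrier G" "(i, 0) \<in> carrier G" "(p, 0) \<in> carrier G" "(0, q) \<in> carrier G"
      using ij kl car by auto
    have "incomparable G x y" using le x y o by (auto simp: incomparable_def)
    then have "left_of G y x" using n left_of_total x y by blast
    \<comment> \<open>A pair in the wrong order is moved, by monotonicity, until it consists of the
      two corners.\<close>
    then have "left_of G (0, l) x"
      by (rule left_of_antimono_left[OF _ mem(1)]) (use le x y mem ij kl o in auto)
    then have "left_of G (0, l) (i, 0)"
      by (rule left_of_antimono_right[OF _ mem(2)]) (use le x mem ij o in auto)
    then have "left_of G (0, l) (p, 0)"
      by (rule left_of_mono_right[OF _ mem(3)]) (use le mem ij kl o in auto)
    then have "left_of G (0, q) (p, 0)"
      by (rule left_of_mono_left[OF _ mem(4)]) (use le mem pq kl o in auto)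
    then show False using left_of_asym[OF lr] by blast
  qed
  have "represents G g.coord g.pts"
    unfolding represents_def
  proof (intro conjI ballI)
    fix x y assume x: "x \<in> carrier G" and y: "y \<in> carrier G"
    obtain i j where ij: "x = (i, j)" "i \<le> p" "j \<le> q" using x car by auto
    obtain k l where kl: "y = (k, l)" "k \<le> p" "l \<le> q" using y car by auto
    show lec: "x \<sqsubseteq>\<^bsub>G\<^esub> y \<longleftrightarrow> g.coord x \<le> g.coord y"
      using le[OF x y] g.coord_le_iff[OF ij(2,3) kl(2,3)] ij kl by simp
    have cf: "g.coord x \<le> g.coord y \<longleftrightarrow> i \<le> k \<and> j \<le> l" "g.coord y \<le> g.coord x \<longleftrightarrow> k \<le> i \<and> l \<le> j"
      using g.coord_le_iff[OF ij(2,3) kl(2,3)] g.coord_le_iff[OF kl(2,3) ij(2,3)] ij kl by auto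
    have o1: "k < i \<Longrightarrow> fst (g.coord y) < fst (g.coord x)" "j < l \<Longrightarrow> snd (g.coord x) < snd (g.coord y)"
      "i < k \<Longrightarrow> fst (g.coord x) < fst (g.coord y)"
      unfolding ij(1) kl(1) g.coord_def using ij(2,3) kl(2,3) by auto
    show "left_of G x y \<longleftrightarrow> fst (g.coord y) < fst (g.coord x) \<and> snd (g.coord x) < snd (g.coord y)"
    proof
      assume l: "left_of G x y"
      have "\<not> (i \<le> k \<and> j \<le> l)" "\<not> (k \<le> i \<and> l \<le> j)" using left_ofD[OF l] le x y ij kl by auto
      moreover have "\<not> (i < k \<and> l < j)" using left[OF y x] left_of_asym[OF l] ij kl by auto
      ultimately have "k < i" "j < l" by linarith+
      then show "fst (g.coord y) < fst (g.coord x) \<and> snd (g.coord x) < snd (g.coord y)" using o1 by blast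
    next
      assume r: "fst (g.coord y) < fst (g.coord x) \<and> snd (g.coord x) < snd (g.coord y)"
      then have "\<not> (i \<le> k \<and> j \<le> l)" "\<not> (k \<le> i \<and> l \<le> j)" "\<not> i < k"
        using cf o1(3) by (auto simp: less_eq_prod_def)
      then have "k < i" "j < l" by linarith+
      then show "left_of G x y" using left[OF x y] ij kl by simp
    qed
  qed (use pl g.config_pts g.coord_bij car in auto)
  then show ?thesis using g.rect_at_pts by blast
qed

text \<open>\<open>grid\<close> leaves open which factor is drawn on the left; one of the two
  orientations is reduced to the other by reflection.\<close>

lemma grid_slim_rectangular:
  assumes "grid G"
  shows "slim_rectangular_diagram G"
proof -
  obtain m n where mn: "2 \<le> m" "2 \<le> n" "carrier G = {..<m} \<times> {..<n}" and pl: "planar_diagram G"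
    and le': "\<forall>x\<in>carrier G. \<forall>y\<in>carrier G. x \<sqsubseteq>\<^bsub>G\<^esub> y \<longleftrightarrow> fst x \<le> fst y \<and> snd x \<le> snd y"
    using assms unfolding grid_def by blast
  have le: "x \<sqsubseteq>\<^bsub>G\<^esub> y \<longleftrightarrow> fst x \<le> fst y \<and> snd x \<le> snd y"
    if "x \<in> carrier G" "y \<in> carrier G" for x y
    using le' that by blast
  define p q where "p = m - 1" and "q = n - 1"
  have pq: "1 \<le> p" "1 \<le> q" "carrier G = {..<Suc p} \<times> {..<Suc q}" using mn by (auto simp: p_def q_def)
  interpret planar G using pl by unfold_locales
  have mem: "(p, 0) \<in> carrier G" "(0, q) \<in> carrier G" using pq by auto
  have "incomparable G (p, 0) (0, q)" using le mem pq by (simp add: incomparable_def)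
  then consider "left_of G (p, 0) (0, q)" | "left_of G (0, q) (p, 0)"
    using left_of_total[OF mem] by blast
  then have "\<exists>\<kappa> P u v. represents G \<kappa> P \<and> rect_at P u v"
  proof cases
    case 1
    show ?thesis by (rule grid_slim_rectangular_aux[OF pl pq le 1])
  next
    case 2
    then have "left_of (mirror G) (p, 0) (0, q)" using left_of_mirror[OF lattice_axioms] by blast
    then have "\<exists>\<kappa> P u v. represents (mirror G) \<kappa> P \<and> rect_at P u v"
      by (rule grid_slim_rectangular_aux[OF planar_mirror[OF pl] pq(1,2), rotated 2]) (use pq(3) le in simp_all)
    then obtain \<kappa> P u v where "represents (mirror G) \<kappa> P" "rect_at P u v" by blast
    then have "represents G (prod.swap \<circ> \<kappa>) (prod.swap ` P)"
      using represents_mirror[of "mirror G" \<kappa> P] by simp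
    then show ?thesis using rect_at_swap[OF \<open>rect_at P u v\<close>] by blast
  qed
  then obtain \<kappa> P u v where "represents G \<kappa> P" "rect_at P u v" by blast
  then show ?thesis using represented.rect_at_rectangular[of G \<kappa> P] by (simp add: represented_def)
qed

lemma ex_increasing_enumeration:
  fixes A :: "(real \<times> real) set"
  assumes "finite A" "\<And>z w. z \<in> A \<Longrightarrow> w \<in> A \<Longrightarrow> fst z < fst w \<Longrightarrow> snd z < snd w" "inj_on fst A"
  shows "\<exists>e. e ` {..<card A} = A \<and> (\<forall>i k. i < k \<longrightarrow> k < card A \<longrightarrow> fst (e i) < fst (e k) \<and> snd (e i) < snd (e k))"
proof -
  have c: "card (fst ` A) = card A" using assms(3) by (rule card_image)
  define g where "g i = sorted_list_of_set (fst ` A) ! i" for i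
  have l: "length (sorted_list_of_set (fst ` A)) = card A" using c by simp
  have g: "g ` {..<card A} = fst ` A"
  proof -
    have "set (sorted_list_of_set (fst ` A)) = g ` {..<card A}"
      unfolding set_conv_nth l g_def by auto
    then show ?thesis using assms(1) by simp
  qed
  have g_mono: "g i < g k" if "i < k" "k < card A" for i k
    using sorted_wrt_nth_less[OF strict_sorted_list_of_set[of "fst ` A"] that(1)] that(2) l by (simp add: g_def)
  define e where "e i = inv_into A fst (g i)" for i
  have gi: "g i \<in> fst ` A" if "i < card A" for i using g that by blast
  have e: "e i \<in> A" "fst (e i) = g i" if "i < card A" for i
    using inv_into_into[OF gi[OF that]] f_inv_into_f[OF gi[OF that]] by (auto simp: e_def)
  have "e ` {..<card A} = A"
  proof (intro equalityI subsetI)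
    fix z assume z: "z \<in> A"
    then have "fst z \<in> g ` {..<card A}" unfolding g by blast
    then obtain i where i: "i < card A" "g i = fst z" by auto
    then have "e i = z" using e[OF i(1)] z inj_onD[OF assms(3)] by metis
    then show "z \<in> e ` {..<card A}" using i by blast
  qed (use e in auto)
  moreover have "fst (e i) < fst (e k) \<and> snd (e i) < snd (e k)" if "i < k" "k < card A" for i k
  proof -
    have "fst (e i) < fst (e k)" using g_mono[OF that] e that by simp
    then show ?thesis using assms(2) e that by simp
  qed
  ultimately show ?thesis by blast
qed

text \<open>Without middle points, every point but the top belongs to exactly one of two increasing
  sequences, the one above \<open>v\<close> or the one to the right of \<open>u\<close>. Enumerating
  these gives the two factors.\<close>

lemma grid_config:
  assumes P: "config P" and r: "rect_at P u v" and e: "middles P u v = {}"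
  shows "\<exists>(G :: (nat \<times> nat) diagram) \<kappa>. grid G \<and> represents G \<kappa> P"
proof -
  note r = rect_atD[OF r]
  have finP: "finite P" using P by (simp add: config_def)
  have fe: "z = w" if "z \<in> P" "w \<in> P" "fst z = fst w" for z w
    using P that by (auto simp: config_def inj_on_def)
  have se: "z = w" if "z \<in> P" "w \<in> P" "snd z = snd w" for z w
    using P that by (auto simp: config_def inj_on_def)
  obtain t where t: "t \<in> P" "\<And>z. z \<in> P \<Longrightarrow> z \<le> t" using P by (auto simp: config_def)
  define A B where "A = {z\<in>P. fst z < fst u}" and "B = {z\<in>P. snd z < snd v}"
  have vu: "fst v < fst u" "snd u < snd v"
    using r(5)[OF r(1)] r(4)[OF r(2)] fe[OF r(1,2)] se[OF r(1,2)] r(3) by force+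
  have A: "z \<in> P" "fst z < fst u" "snd v \<le> snd z" if "z \<in> A" for z
  proof -
    show "z \<in> P" "fst z < fst u" using that by (auto simp: A_def)
    moreover have "z \<notin> middles P u v" using e by simp
    ultimately show "snd v \<le> snd z" by (simp add: middles_def)
  qed
  have B: "z \<in> P" "snd z < snd v" "fst u \<le> fst z" if "z \<in> B" for z
  proof -
    show "z \<in> P" "snd z < snd v" using that by (auto simp: B_def)
    moreover have "z \<notin> middles P u v" using e by simp
    ultimately show "fst u \<le> fst z" by (simp add: middles_def)
  qed
  have tu: "fst u \<le> fst t" "snd v \<le> snd t" using t(2)[OF r(1)] t(2)[OF r(2)] by (auto simp: less_eq_prod_def)
  have lt_t: "fst z < fst t" "snd z < snd t" if "z \<in> P" "z \<noteq> t" for z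
    using t(2)[OF that(1)] fe[OF that(1) t(1)] se[OF that(1) t(1)] that(2) by (auto simp: less_eq_prod_def less_le)
  have tAB: "t \<notin> A" "t \<notin> B" using tu by (auto simp: A_def B_def)
  have PAB: "P = A \<union> B \<union> {t}"
  proof -
    have "z \<in> A \<union> B \<union> {t}" if "z \<in> P" for z
    proof (cases "fst z < fst u \<or> snd z < snd v")
      case True then show ?thesis using that by (auto simp: A_def B_def)
    next
      case False
      then have "t \<le> z" using r(8)[OF that _ _ t(1)] by simp
      then show ?thesis using t(2)[OF that] by simp
    qed
    then show ?thesis using t(1) by (auto simp: A_def B_def)
  qed
  have incA: "snd z < snd w" if "z \<in> A" "w \<in> A" "fst z < fst w" for z w
  proof (rule ccontr)
    assume "\<not> ?thesis"
    then have "snd w < snd z" using se[OF A(1)[OF that(2)] A(1)[OF that(1)]] that(3) by force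
    then show False using r(7)[OF A(1)[OF that(2)] A(1)[OF that(1)] A(3)[OF that(2)]] that(3) by simp
  qed
  have incB: "snd z < snd w" if "z \<in> B" "w \<in> B" "fst z < fst w" for z w
    using r(6)[OF B(1)[OF that(1)] B(1)[OF that(2)] B(3)[OF that(1)] that(3)] .
  have finA: "finite A" "finite B" using finP by (auto simp: A_def B_def)
  have injA: "inj_on fst A" "inj_on fst B" using P by (auto simp: config_def A_def B_def inj_on_def)
  obtain a where a: "a ` {..<card A} = A"
    "\<And>i k. i < k \<Longrightarrow> k < card A \<Longrightarrow> fst (a i) < fst (a k) \<and> snd (a i) < snd (a k)"
    using ex_increasing_enumeration[OF finA(1) incA injA(1)] by blast
  obtain b where b: "b ` {..<card B} = B"
    "\<And>i k. i < k \<Longrightarrow> k < card B \<Longrightarrow> fst (b i) < fst (b k) \<and> snd (b i) < snd (b k)"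
    using ex_increasing_enumeration[OF finA(2) incB injA(2)] by blast
  define \<alpha> where "\<alpha> i = (if i < card A then a i else t)" for i
  define \<beta> where "\<beta> j = (if j < card B then b j else t)" for j
  have aA: "a i \<in> A" if "i < card A" for i using a(1) that by blast
  have bB: "b j \<in> B" if "j < card B" for j using b(1) that by blast
  have "v \<in> A" "u \<in> B" using r vu by (auto simp: A_def B_def)
  then have c1: "1 \<le> card A" "1 \<le> card B" using finA by (auto simp: Suc_le_eq card_gt_0_iff)
  interpret g: grid_points "card A" "card B" \<alpha> \<beta>
  proof
    show "1 \<le> card A" "1 \<le> card B" by (fact c1)+
    show "\<alpha> (card A) = \<beta> (card B)" by (simp add: \<alpha>_def \<beta>_def)
    show "fst (\<alpha> i) < fst (\<alpha> k)" "snd (\<alpha> i) < snd (\<alpha> k)" if "i < k" "k \<le> card A" for i k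
      using a(2)[OF that(1)] lt_t[OF A(1)[OF aA]] tAB aA[of i] that by (auto simp: \<alpha>_def)
    show "fst (\<beta> i) < fst (\<beta> k)" "snd (\<beta> i) < snd (\<beta> k)" if "i < k" "k \<le> card B" for i k
      using b(2)[OF that(1)] lt_t[OF B(1)[OF bB]] tAB bB[of i] that by (auto simp: \<beta>_def)
    show "fst (\<alpha> i) < fst (\<beta> j)" if "i < card A" "j \<le> card B" for i j
    proof -
      have "fst (\<alpha> i) < fst u" using A(2)[OF aA[OF that(1)]] that by (simp add: \<alpha>_def)
      moreover have "fst u \<le> fst (\<beta> j)" using B(3)[OF bB[of j]] tu by (auto simp: \<beta>_def)
      ultimately show ?thesis by simp
    qed
    show "snd (\<beta> j) < snd (\<alpha> i)" if "i \<le> card A" "j < card B" for i j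
    proof -
      have "snd (\<beta> j) < snd v" using B(2)[OF bB[OF that(2)]] that by (simp add: \<beta>_def)
      moreover have "snd v \<le> snd (\<alpha> i)" using A(3)[OF aA[of i]] tu by (auto simp: \<alpha>_def)
      ultimately show ?thesis by simp
    qed
  qed
  have "\<alpha> ` {..card A} = A \<union> {t}" "\<beta> ` {..card B} = B \<union> {t}"
  proof -
    have "\<alpha> ` {..card A} = \<alpha> ` {..<card A} \<union> {\<alpha> (card A)}" by (simp add: lessThan_Suc_atMost[symmetric] lessThan_Suc)
    also have "\<alpha> ` {..<card A} = a ` {..<card A}" by (rule image_cong) (auto simp: \<alpha>_def)
    finally show "\<alpha> ` {..card A} = A \<union> {t}" using a(1) by (simp add: \<alpha>_def)
    have "\<beta> ` {..card B} = \<beta> ` {..<card B} \<union> {\<beta> (card B)}" by (simp add: lessThan_Suc_atMost[symmetric] lessThan_Suc)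
    also have "\<beta> ` {..<card B} = b ` {..<card B}" by (rule image_cong) (auto simp: \<beta>_def)
    finally show "\<beta> ` {..card B} = B \<union> {t}" using b(1) by (simp add: \<beta>_def)
  qed
  then have "g.pts = P" unfolding g.pts_def using PAB by auto
  then show ?thesis using g.ex_grid_drawing by metis
qed


section \<open>Slim rectangular diagrams and resections of grids\<close>

text \<open>Coverings are deletions of single points. So they can be read from \<open>P\<close>, as
  can the order and the left-right order.\<close>

lemma similar_represented:
  assumes E: "represents E \<kappa> P" and D: "represents D \<mu> P"
  shows "similar E D"
proof -
  interpret e: represented E \<kappa> P using E by unfold_locales
  interpret d: represented D \<mu> P using D by unfold_locales
  define \<phi> where "\<phi> x = inv_into (carrier D) \<mu> (\<kappa> x)" for x
  have bE: "bij_betw \<kappa> (carrier E) (tight P)" and bD: "bij_betw \<mu> (carrier D) (tight P)"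
    using E D by (auto simp: represents_def)
  have bij: "bij_betw \<phi> (carrier E) (carrier D)"
    using bij_betw_trans[OF bE bij_betw_inv_into[OF bD]] by (simp add: \<phi>_def[abs_def] comp_def)
  have mem: "\<phi> x \<in> carrier D" if "x \<in> carrier E" for x using bij that bij_betwE by blast
  have mu: "\<mu> (\<phi> x) = \<kappa> x" if "x \<in> carrier E" for x
    using e.kappa_tight[OF that] bD unfolding \<phi>_def by (simp add: bij_betw_inv_into_right)
  have le: "x \<sqsubseteq>\<^bsub>E\<^esub> y \<longleftrightarrow> \<phi> x \<sqsubseteq>\<^bsub>D\<^esub> \<phi> y" if "x \<in> carrier E" "y \<in> carrier E" for x y
    using e.le_iff[OF that] d.le_iff[OF mem mem] mu that by simp
  have left: "left_of E x y \<longleftrightarrow> left_of D (\<phi> x) (\<phi> y)" if "x \<in> carrier E" "y \<in> carrier E" for x y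
    using e.left_iff[OF that] d.left_iff[OF mem mem] mu that by simp
  have Qeq: "d.Q (\<phi> x) = e.Q x" if "x \<in> carrier E" for x
    using mu[OF that] by (simp add: d.Q_def e.Q_def)
  have cov: "covers E x y \<longleftrightarrow> covers D (\<phi> x) (\<phi> y)" if "x \<in> carrier E" "y \<in> carrier E" for x y
    using e.covers_iff[OF that] d.covers_iff[OF mem mem] Qeq that by simp
  show ?thesis
    unfolding similar_def
  proof (intro exI[of _ \<phi>] conjI ballI)
    fix x b c assume "x \<in> carrier E" "b \<in> carrier E" "c \<in> carrier E"
    then show "left_upper E x b c \<longleftrightarrow> left_upper D (\<phi> x) (\<phi> b) (\<phi> c)"
      "left_lower E x b c \<longleftrightarrow> left_lower D (\<phi> x) (\<phi> b) (\<phi> c)"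
      using e.left_upper_iff d.left_upper_iff e.left_lower_iff d.left_lower_iff cov left by auto
  qed (use bij le in auto)
qed

text \<open>\<open>similar\<close> preserves the left-right order of covers only. For arbitrary
  incomparable elements it follows, because their order is decided at the upper covers of their
  meet.\<close>

lemma represents_similar:
  assumes E: "represents E \<kappa> P" and D: "planar_diagram D" and s: "similar E D"
  shows "\<exists>\<mu>. represents D \<mu> P"
proof -
  interpret e: represented E \<kappa> P using E by unfold_locales
  interpret d: planar D using D by unfold_locales
  obtain \<phi> where bij: "bij_betw \<phi> (carrier E) (carrier D)"
    and le': "\<forall>x\<in>carrier E. \<forall>y\<in>carrier E. x \<sqsubseteq>\<^bsub>E\<^esub> y \<longleftrightarrow> \<phi> x \<sqsubseteq>\<^bsub>D\<^esub> \<phi> y"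
    and lu': "\<forall>x\<in>carrier E. \<forall>b\<in>carrier E. \<forall>c\<in>carrier E.
      left_upper E x b c \<longleftrightarrow> left_upper D (\<phi> x) (\<phi> b) (\<phi> c)"
    using s unfolding similar_def by (elim exE conjE) simp
  have le: "x \<sqsubseteq>\<^bsub>E\<^esub> y \<longleftrightarrow> \<phi> x \<sqsubseteq>\<^bsub>D\<^esub> \<phi> y" if "x \<in> carrier E" "y \<in> carrier E" for x y
    using le' that by blast
  have lu: "left_upper E x b c \<longleftrightarrow> left_upper D (\<phi> x) (\<phi> b) (\<phi> c)"
    if "x \<in> carrier E" "b \<in> carrier E" "c \<in> carrier E" for x b c
    using lu' that by blast
  have mem: "\<phi> x \<in> carrier D" if "x \<in> carrier E" for x using bij that bij_betwE by blast
  have ex: "\<exists>x\<in>carrier E. \<phi> x = y" if "y \<in> carrier D" for y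
    using bij_betw_imp_surj_on[OF bij] that by (metis imageE)
  have inc: "incomparable E x y \<longleftrightarrow> incomparable D (\<phi> x) (\<phi> y)" if "x \<in> carrier E" "y \<in> carrier E" for x y
    using le that by (auto simp: incomparable_def)
  have meet: "\<phi> (x \<sqinter>\<^bsub>E\<^esub> y) = \<phi> x \<sqinter>\<^bsub>D\<^esub> \<phi> y" if xy: "x \<in> carrier E" "y \<in> carrier E" for x y
  proof -
    have m: "x \<sqinter>\<^bsub>E\<^esub> y \<in> carrier E" "x \<sqinter>\<^bsub>E\<^esub> y \<sqsubseteq>\<^bsub>E\<^esub> x" "x \<sqinter>\<^bsub>E\<^esub> y \<sqsubseteq>\<^bsub>E\<^esub> y"
      using e.meet_left[OF xy] e.meet_right[OF xy] xy by auto
    have n: "\<phi> x \<sqinter>\<^bsub>D\<^esub> \<phi> y \<in> carrier D" "\<phi> x \<sqinter>\<^bsub>D\<^esub> \<phi> y \<sqsubseteq>\<^bsub>D\<^esub> \<phi> x" "\<phi> x \<sqinter>\<^bsub>D\<^esub> \<phi> y \<sqsubseteq>\<^bsub>D\<^esub> \<phi> y"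
      using d.meet_left[OF mem mem] d.meet_right[OF mem mem] mem xy by auto
    obtain z where z: "z \<in> carrier E" "\<phi> z = \<phi> x \<sqinter>\<^bsub>D\<^esub> \<phi> y" using ex n(1) by blast
    have "z \<sqsubseteq>\<^bsub>E\<^esub> x" "z \<sqsubseteq>\<^bsub>E\<^esub> y" using le z n xy by auto
    then have "z \<sqsubseteq>\<^bsub>E\<^esub> x \<sqinter>\<^bsub>E\<^esub> y" using e.meet_le z xy by blast
    then have "\<phi> x \<sqinter>\<^bsub>D\<^esub> \<phi> y \<sqsubseteq>\<^bsub>D\<^esub> \<phi> (x \<sqinter>\<^bsub>E\<^esub> y)" using le z m by auto
    moreover have "\<phi> (x \<sqinter>\<^bsub>E\<^esub> y) \<sqsubseteq>\<^bsub>D\<^esub> \<phi> x \<sqinter>\<^bsub>D\<^esub> \<phi> y"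
      using d.meet_le[of "\<phi> (x \<sqinter>\<^bsub>E\<^esub> y)" "\<phi> x" "\<phi> y"] le m xy mem by blast
    ultimately show ?thesis using d.le_antisym n(1) mem[OF m(1)] by blast
  qed
  have left1: "left_of D (\<phi> x) (\<phi> y)" if l: "left_of E x y" for x y
  proof -
    obtain b c where bc: "x \<in> carrier E" "y \<in> carrier E" "incomparable E x y"
      "left_upper E (x \<sqinter>\<^bsub>E\<^esub> y) b c" "b \<sqsubseteq>\<^bsub>E\<^esub> x" "c \<sqsubseteq>\<^bsub>E\<^esub> y"
      using l unfolding left_of_def by blast
    have c: "b \<in> carrier E" "c \<in> carrier E" "x \<sqinter>\<^bsub>E\<^esub> y \<in> carrier E"
      using bc(1,2,4) by (auto simp: left_upper_def covers_def)
    have "left_upper D (\<phi> x \<sqinter>\<^bsub>D\<^esub> \<phi> y) (\<phi> b) (\<phi> c)" using lu[OF c(3,1,2)] bc meet by simp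
    moreover have "\<phi> b \<sqsubseteq>\<^bsub>D\<^esub> \<phi> x" "\<phi> c \<sqsubseteq>\<^bsub>D\<^esub> \<phi> y" using le bc c by auto
    ultimately show ?thesis
      unfolding left_of_def using mem bc(1,2,3) inc by blast
  qed
  have left: "left_of D (\<phi> x) (\<phi> y) \<longleftrightarrow> left_of E x y" if xy: "x \<in> carrier E" "y \<in> carrier E" for x y
  proof
    assume l: "left_of D (\<phi> x) (\<phi> y)"
    then have "incomparable E x y" using inc[OF xy] d.left_ofD[OF l] by (auto simp: incomparable_def)
    then show "left_of E x y" using e.left_of_total[OF xy] left1[of y x] d.left_of_asym[OF l] by blast
  qed (rule left1)
  define \<mu> where "\<mu> y = \<kappa> (inv_into (carrier E) \<phi> y)" for y
  have mu: "\<mu> (\<phi> x) = \<kappa> x" if "x \<in> carrier E" for x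
    using bij that by (simp add: \<mu>_def bij_betw_inv_into_left)
  have bE: "bij_betw \<kappa> (carrier E) (tight P)" using E by (simp add: represents_def)
  have "represents D \<mu> P"
    unfolding represents_def
  proof (intro conjI ballI)
    show "planar_diagram D" by (rule D)
    show "config P" using E by (simp add: represents_def)
    show "bij_betw \<mu> (carrier D) (tight P)"
      using bij_betw_trans[OF bij_betw_inv_into[OF bij] bE] by (simp add: \<mu>_def[abs_def] comp_def)
    fix x y assume "x \<in> carrier D" "y \<in> carrier D"
    then obtain a b where ab: "a \<in> carrier E" "\<phi> a = x" "b \<in> carrier E" "\<phi> b = y" using ex by metis
    show "x \<sqsubseteq>\<^bsub>D\<^esub> y \<longleftrightarrow> \<mu> x \<le> \<mu> y" using le[OF ab(1,3)] e.le_iff[OF ab(1,3)] mu ab by auto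
    show "left_of D x y \<longleftrightarrow> fst (\<mu> y) < fst (\<mu> x) \<and> snd (\<mu> x) < snd (\<mu> y)"
      using left[OF ab(1,3)] e.left_iff[OF ab(1,3)] mu ab by auto
  qed
  then show ?thesis by blast
qed

lemma slim_rectangular_coordinates:
  assumes "slim_rectangular_diagram D"
  shows "\<exists>\<kappa> P u v. represents D \<kappa> P \<and> rect_at P u v"
proof -
  obtain \<kappa> P where k: "represents D \<kappa> P"
    using ex_representation assms unfolding slim_rectangular_diagram_def by blast
  interpret represented D \<kappa> P using k by unfold_locales
  show ?thesis
    using rectangular_rect_at assms k unfolding slim_rectangular_diagram_def by blast
qed

section \<open>Resections in coordinates\<close>

lemma bij_betw_remaining:
  assumes k: "represents D \<kappa> P" and r: "resectable P a1 a2 b1 b2"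
  shows "bij_betw \<kappa> {e \<in> carrier D. \<not> removed a2 b2 (\<kappa> e)} (tight (reduce P a2 b2))"
proof -
  note r = resectableD[OF r]
  have b: "bij_betw \<kappa> (carrier D) (tight P)" and c: "config P" using k by (auto simp: represents_def)
  have t: "tight (reduce P a2 b2) = {p \<in> tight P. \<not> removed a2 b2 p}"
    using c r by (intro tight_reduce) (auto simp: config_def)
  have "\<kappa> ` {e \<in> carrier D. \<not> removed a2 b2 (\<kappa> e)} = {p \<in> \<kappa> ` carrier D. \<not> removed a2 b2 p}" by blast
  also have "\<kappa> ` carrier D = tight P" using b by (simp add: bij_betw_def)
  finally show ?thesis using b t unfolding bij_betw_def by (auto intro: inj_on_subset)
qed

text \<open>The remaining elements keep their coordinates: restricted to them,
  \<open>\<kappa>\<close> represents the resected diagram by the reduced set of points.\<close>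

lemma resection_slim_rectangular:
  assumes s: "slim_rectangular_diagram D" and r: "resection D D'"
  shows "slim_rectangular_diagram D'"
proof -
  obtain \<kappa> P u v where k: "represents D \<kappa> P" and uv: "rect_at P u v"
    using slim_rectangular_coordinates[OF s] by blast
  interpret represented D \<kappa> P using k by unfold_locales
  obtain f where f: "C3_scheme D f" and pl: "planar_diagram D'"
    and car: "carrier D' = carrier D - (scheme_interior D f - {f 1 1})"
    and le: "\<forall>x\<in>carrier D'. \<forall>y\<in>carrier D'. x \<sqsubseteq>\<^bsub>D'\<^esub> y \<longleftrightarrow> x \<sqsubseteq>\<^bsub>D\<^esub> y"
    and left: "\<forall>x\<in>carrier D'. \<forall>y\<in>carrier D'. left_of D' x y \<longleftrightarrow> left_of D x y"
    using r unfolding resection_def by blast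
  obtain a1 a2 b1 b2 where ab: "resectable P a1 a2 b1 b2" "framed f a1 a2 b1 b2"
    using scheme_resectable[OF f uv] by blast
  note ab' = resectableD[OF ab(1)]
  have car': "carrier D' = {e \<in> carrier D. \<not> removed a2 b2 (\<kappa> e)}"
    unfolding car framed_interior[OF ab] by blast
  have "represents D' \<kappa> (reduce P a2 b2)"
    unfolding represents_def
  proof (intro conjI ballI)
    show "config (reduce P a2 b2)"
      using k ab' by (intro config_reduce) (auto simp: represents_def)
    show "bij_betw \<kappa> (carrier D') (tight (reduce P a2 b2))"
      unfolding car' by (rule bij_betw_remaining[OF k ab(1)])
    fix x y assume xy: "x \<in> carrier D'" "y \<in> carrier D'"
    show "x \<sqsubseteq>\<^bsub>D'\<^esub> y \<longleftrightarrow> \<kappa> x \<le> \<kappa> y" using le xy le_iff[of x y] car' by simp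
    show "left_of D' x y \<longleftrightarrow> fst (\<kappa> y) < fst (\<kappa> x) \<and> snd (\<kappa> x) < snd (\<kappa> y)"
      using left xy left_iff[of x y] car' by simp
  qed (rule pl)
  then show ?thesis
    using represented.rect_at_rectangular rect_at_reduce[OF uv ab(1)] unfolding represented_def by blast
qed

text \<open>The old positions may not suit the new edges, so the remaining elements are redrawn from
  their coordinates, which retains their left-right order.\<close>

lemma ex_resection:
  assumes k: "represents D \<kappa> P" and r: "resectable P a1 a2 b1 b2"
  shows "\<exists>D'. resection D D' \<and> represents D' \<kappa> (reduce P a2 b2)"
proof -
  interpret represented D \<kappa> P using k by unfold_locales
  note r' = resectableD[OF r]
  obtain f where f: "C3_scheme D f"
    and int: "scheme_interior D f - {f 1 1} = {e \<in> carrier D. removed a2 b2 (\<kappa> e)}"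
    using resectable_scheme[OF r] by blast
  define D' where "D' = D\<lparr>carrier := {e \<in> carrier D. \<not> removed a2 b2 (\<kappa> e)},
    pos := \<lambda>x. (snd (\<kappa> x) - fst (\<kappa> x), fst (\<kappa> x) + snd (\<kappa> x))\<rparr>"
  have D': "carrier D' = {e \<in> carrier D. \<not> removed a2 b2 (\<kappa> e)}" "le D' = le D" "eq D' = eq D"
    "pos D' = (\<lambda>x. (snd (\<kappa> x) - fst (\<kappa> x), fst (\<kappa> x) + snd (\<kappa> x)))"
    by (simp_all add: D'_def)
  have k': "represents D' \<kappa> (reduce P a2 b2)"
  proof (rule represents_drawn)
    show "eq D' = (=)" using eq_is_equal D' by simp
    show "config (reduce P a2 b2)"
      using k r' by (intro config_reduce) (auto simp: represents_def)
    show "bij_betw \<kappa> (carrier D') (tight (reduce P a2 b2))"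
      unfolding D' by (rule bij_betw_remaining[OF k r])
    show "x \<sqsubseteq>\<^bsub>D'\<^esub> y \<longleftrightarrow> \<kappa> x \<le> \<kappa> y" if "x \<in> carrier D'" "y \<in> carrier D'" for x y
      using that le_iff by (simp add: D')
  qed (simp add: D')
  have "resection D D'"
    unfolding resection_def
  proof (intro conjI exI[of _ f] ballI)
    show "carrier D' = carrier D - (scheme_interior D f - {f 1 1})" unfolding int D' by blast
    fix x y assume xy: "x \<in> carrier D'" "y \<in> carrier D'"
    show "left_of D' x y \<longleftrightarrow> left_of D x y"
      using represented.left_iff[of D' \<kappa> _ x y] k' xy left_iff[of x y] by (simp add: represented_def D'(1))
  qed (use f slim_semimodular k' in \<open>auto simp: represents_def D'(2)\<close>)
  then show ?thesis using k' by blast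
qed

lemma ex_resection_sequence:
  assumes "config P" "rect_at P u v" "decreasing P h"
  shows "\<exists>(G :: (nat \<times> nat) diagram) E \<kappa>. grid G \<and> resection\<^sup>*\<^sup>* G E \<and> represents E \<kappa> P"
  using assms
proof (induction "sum h (middles P u v)" arbitrary: P h rule: less_induct)
  case less
  show ?case
  proof (cases "middles P u v = {}")
    case True
    then show ?thesis using grid_config[OF less.prems(1,2)] by blast
  next
    case False
    obtain P' a1 a2 b1 b2 h' where P': "config P'" "rect_at P' u v" "resectable P' a1 a2 b1 b2"
      "P = reduce P' a2 b2" "decreasing P' h'" "sum h' (middles P' u v) < sum h (middles P u v)"
      using ex_expansion[OF less.prems(1,2) False less.prems(3)] by blast
    obtain G :: "(nat \<times> nat) diagram" and E \<kappa> where G: "grid G" "resection\<^sup>*\<^sup>* G E" "represents E \<kappa> P'"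
      using less.hyps[OF P'(6,1,2,5)] by blast
    obtain E' where "resection E E'" "represents E' \<kappa> P"
      using ex_resection[OF G(3) P'(3)] P'(4) by blast
    then show ?thesis using G(1,2) rtranclp.rtrancl_into_rtrancl by metis
  qed
qed

lemma ex_decreasing: "finite P \<Longrightarrow> \<exists>h. decreasing P h"
proof -
  assume fin: "finite P"
  have "card {t\<in>P. snd t < snd w} < card {t\<in>P. snd t < snd z}" if "w \<in> P" "snd w < snd z" for z w
    using that fin by (intro psubset_card_mono) auto
  then show ?thesis by (intro exI[of _ "\<lambda>z. card {t\<in>P. snd t < snd z}"]) (auto simp: decreasing_def)
qed

theorem corollary3:
  fixes D :: "'a diagram"
  assumes "planar_diagram D"
  shows "slim_rectangular_diagram D \<longleftrightarrow>
    (\<exists>(G :: (nat \<times> nat) diagram) E. grid G \<and> resection\<^sup>*\<^sup>* G E \<and> similar E D)"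
proof
  assume "slim_rectangular_diagram D"
  then obtain \<kappa> P u v where k: "represents D \<kappa> P" and uv: "rect_at P u v"
    using slim_rectangular_coordinates by blast
  have c: "config P" using k by (simp add: represents_def)
  then obtain h where "decreasing P h" using ex_decreasing by (auto simp: config_def)
  then obtain G :: "(nat \<times> nat) diagram" and E \<mu> where "grid G" "resection\<^sup>*\<^sup>* G E" "represents E \<mu> P"
    using ex_resection_sequence[OF c uv] by blast
  then show "\<exists>(G :: (nat \<times> nat) diagram) E. grid G \<and> resection\<^sup>*\<^sup>* G E \<and> similar E D"
    using similar_represented[OF _ k] by blast
next
  assume "\<exists>(G :: (nat \<times> nat) diagram) E. grid G \<and> resection\<^sup>*\<^sup>* G E \<and> similar E D"
  then obtain G E :: "(nat \<times> nat) diagram" where G: "grid G" "resection\<^sup>*\<^sup>* G E" "similar E D" by blast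
  from G(2) have "slim_rectangular_diagram E"
    by (induction rule: rtranclp_induct)
      (auto intro: grid_slim_rectangular[OF G(1)] resection_slim_rectangular)
  then obtain \<kappa> P u v where "represents E \<kappa> P" and uv: "rect_at P u v"
    using slim_rectangular_coordinates by blast
  then obtain \<mu> where "represents D \<mu> P" using represents_similar[OF _ assms G(3)] by blast
  then show "slim_rectangular_diagram D"
    using represented.rect_at_rectangular uv unfolding represented_def by blast
qed

end
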